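(* Let $k\geq 5$ and $t\geq 1$ be integers. There exists $n_0=n_0(k,t)$ such that for all $n\geq n_0$: (1) $\mathrm{ex}_k(n,\mathbb{C}^{(k)}_{2t+1})=\binom{n}{k}-\binom{n-t}{k}$, and the only extremal family consists of all the $k$-subsets of $[n]$ that meet some fixed $t$-set $S\subseteq[n]$; (2) $\mathrm{ex}_k(n,\mathbb{C}^{(k)}_{2t+2})=\binom{n}{k}-\binom{n-t}{k}+\binom{n-t-2}{k-2}$, and the only extremal family consists of all the $k$-subsets of $[n]$ that intersect some fixed $t$-set $S\subseteq[n]$ together with all the $k$-subsets of $[n]\setminus S$ that contain some two fixed elements of $[n]\setminus S$.
   Context: A $k$-graph on $[n]=\{1,\dots,n\}$ is a family of $k$-element subsets of $[n]$. For $\ell\geq 3$, the $k$-uniform linear cycle $\mathbb{C}^{(k)}_\ell$ is the $k$-graph consisting of $k$-sets $F_1,\dots,F_\ell$ together with $\ell$ distinct vertices $v_1,\dots,v_\ell$ such that $F_i\cap\{v_1,\dots,v_\ell\}=\{v_i,v_{i+1}\}$ (indices mod $\ell$, $v_{\ell+1}=v_1$) and the sets $F_i\setminus\{v_1,\dots,v_\ell\}$ are pairwise disjoint; equivalently, a cyclic list of $k$-sets in which consecutive sets intersect in exactly one element and nonconsecutive sets are disjoint. A $k$-graph contains $H$ if it has a subfamily isomorphic to $H$. $\mathrm{ex}_k(n,H)$ denotes the maximum number of edges of a $k$-graph on $[n]$ that does not contain $H$; an extremal family is one attaining this maximum. *)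

theory Defs
  imports Complex_Main
begin

definition kgraph_on :: "nat \<Rightarrow> 'a set \<Rightarrow> 'a set set \<Rightarrow> bool" where
  "kgraph_on k V G \<longleftrightarrow> (\<forall>e\<in>G. e \<subseteq> V \<and> finite e \<and> card e = k)"

definition hypergraph_iso :: "'a set set \<Rightarrow> 'b set set \<Rightarrow> bool" where
  "hypergraph_iso H H' \<longleftrightarrow>
     (\<exists>f. bij_betw f (\<Union>H) (\<Union>H') \<and> H' = (\<lambda>e. f ` e) ` H)"

definition contains_copy :: "'a set set \<Rightarrow> 'b set set \<Rightarrow> bool" where
  "contains_copy G H \<longleftrightarrow> (\<exists>G'\<subseteq>G. hypergraph_iso H G')"

definition turan_number :: "nat \<Rightarrow> nat \<Rightarrow> 'b set set \<Rightarrow> nat" where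
  "turan_number k n H =
     Max {card G | G :: nat set set. kgraph_on k {1..n} G \<and> \<not> contains_copy G H}"

definition extremal_family :: "nat \<Rightarrow> nat \<Rightarrow> 'b set set \<Rightarrow> nat set set \<Rightarrow> bool" where
  "extremal_family k n H G \<longleftrightarrow>
     kgraph_on k {1..n} G \<and> \<not> contains_copy G H \<and> card G = turan_number k n H"

text \<open>Indices run over \<open>0, \<dots>, l - 1\<close> instead of \<open>1, \<dots>, l\<close>. The predicate determines
  \<open>H\<close> up to isomorphism. The distinguished vertices are needed for \<open>l = 3\<close>: three sets
  that pairwise meet in one and the same element do not form a linear cycle.\<close>

definition linear_cycle :: "nat \<Rightarrow> nat \<Rightarrow> 'a set set \<Rightarrow> bool" where
  "linear_cycle k l H \<longleftrightarrow> l \<ge> 3 \<and>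
     (\<exists>(F :: nat \<Rightarrow> 'a set) (v :: nat \<Rightarrow> 'a).
        H = F ` {..<l} \<and>
        (\<forall>i<l. finite (F i) \<and> card (F i) = k) \<and>
        inj_on v {..<l} \<and>
        (\<forall>i<l. F i \<inter> v ` {..<l} = {v i, v (Suc i mod l)}) \<and>
        (\<forall>i<l. \<forall>j<l. i \<noteq> j \<longrightarrow>
            (F i - v ` {..<l}) \<inter> (F j - v ` {..<l}) = {}))"

text \<open>Statements quantified over all linear cycles in \<open>nat\<close> are not vacuous.\<close>

lemma linear_cycle_exists:
  assumes "k \<ge> 2" and "l \<ge> 3"
  shows "\<exists>H :: nat set set. linear_cycle k l H"
proof -
  define P where "P i = (\<lambda>j. l + i + l * j) ` {..<k - 2}" for i :: nat
  define F where "F i = {i, Suc i mod l} \<union> P i" for i :: nat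
  have P_notin: "x \<notin> P i" if "x < l" for x i
    using that by (auto simp: P_def)
  have P_mod: "x mod l = i" if "x \<in> P i" "i < l" for x i
    using that by (auto simp: P_def mod_add_left_eq)
  have mod_less: "Suc i mod l < l" for i
    using assms by simp
  have ne: "i \<noteq> Suc i mod l" if "i < l" for i
    using that assms by (cases "Suc i = l") auto
  have card_P: "card (P i) = k - 2" for i
    unfolding P_def using assms by (subst card_image) (auto simp: inj_on_def)
  have fin_P: "finite (P i)" for i
    by (simp add: P_def)
  have card_F: "card (F i) = k" if "i < l" for i
  proof -
    have "{i, Suc i mod l} \<inter> P i = {}"
      using P_notin[OF that] P_notin[OF mod_less] by simp
    then have "card (F i) = card {i, Suc i mod l} + card (P i)"
      unfolding F_def by (intro card_Un_disjoint) (auto simp: fin_P)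
    then show ?thesis
      using ne[OF that] card_P assms by simp
  qed
  have int: "F i \<inter> id ` {..<l} = {id i, id (Suc i mod l)}" if "i < l" for i
    using P_notin[of _ i] that mod_less[of i] unfolding F_def by auto
  have diff: "F i - id ` {..<l} \<subseteq> P i" if "i < l" for i
    using that mod_less[of i] by (auto simp: F_def)
  have disj: "(F i - id ` {..<l}) \<inter> (F j - id ` {..<l}) = {}"
    if "i < l" "j < l" "i \<noteq> j" for i j
    using diff[OF that(1)] diff[OF that(2)] P_mod that by blast
  have fin: "finite (F i)" for i
    by (simp add: F_def fin_P)
  have "linear_cycle k l (F ` {..<l})"
    unfolding linear_cycle_def
    by (intro conjI exI[of _ F] exI[of _ id] allI impI)
       (use assms card_F int disj fin in auto)
  then show ?thesis by blast
qed

end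

theory Submission
  imports Defs "HOL-Library.FuncSet"
begin

text \<open>
  Call a vertex set rich if it lies in edges that avoid any prescribed bounded set outside it; a
  cyclic arrangement of rich sets extends greedily to a linear cycle. By a homogeneity argument of
  delta-system type, in a \<open>k\<close>-graph without a linear cycle of length \<open>2t+1\<close> or \<open>2t+2\<close> all but
  \<open>O(n^(k-2))\<close> edges have a centre, a vertex all of whose supersets inside the edge are rich; the
  only other possible intersection structure contains a triangle of rich pairs and hence cycles of
  every length (this needs \<open>k \<ge> 5\<close>). All but \<open>O(n^2)\<close> of the \<open>(k-1)\<close>-sets complete to edges in at
  most \<open>t\<close> centres, since \<open>t+1\<close> centres with many common rich neighbours close up to a cycle. So
  in a \<open>k\<close>-graph as large as the extremal families, all but \<open>O(n^(k-2))\<close> of the \<open>(k-1)\<close>-sets have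
  exactly \<open>t\<close> centres, and two such sets that share two vertices have the same centres. This gives a
  \<open>t\<close>-set \<open>S\<close> such that all but boundedly many vertices form rich pairs with every element of
  \<open>S\<close>. Every exceptional vertex costs on the order of \<open>n^(k-2)\<close> edges meeting \<open>S\<close>, while the edges
  that avoid \<open>S\<close> are very few, or, for even length, form up to few exceptions a family without
  singleton intersections. Such families are treated by the same argument with pairs as centres.
\<close>

subsection \<open>Rich sets and linear cycles\<close>

text \<open>Orders of magnitude shape the argument. A star on \<open>t\<close> vertices has
  \<open>t * (n choose (k - 1))\<close> edges up to O(n^(k-2)), so a count of edges by pairs of a
  (k-1)-set and a centre tolerates errors of that order, and each (k-1)-set without its
  \<open>t\<close> centres lowers the count by one. The passage from almost all (k-1)-sets to single
  vertices is an average over pairs: some pair lies in only O(n^(k-4)) exceptional (k-1)-sets, while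
  each further exceptional vertex would produce order n^(k-4) of them. A pair is the right size
  because two (k-1)-sets can be compared only through two shared vertices, the ends of a path that
  alternates between common rich neighbours and all of \<open>S\<close>. This path has
  \<open>2 * t\<close> rich pairs; one set through both ends closes it to length
  \<open>2 * t + 1\<close>, two sets that meet in one vertex close it to length
  \<open>2 * t + 2\<close>. In the cycle argument richness has the parameter
  \<open>2 * k * (2 * t + 2)\<close>: at most \<open>2 * t + 2\<close> sets are extended, and their
  union and the edges already chosen each have at most \<open>k * (2 * t + 2)\<close>
  vertices.\<close>

lemma card_supersets:
  assumes "finite V" "B \<subseteq> V" "card B \<le> k"
  shows "card {e. B \<subseteq> e \<and> e \<subseteq> V \<and> card e = k} = (card V - card B) choose (k - card B)"
proof -
  have fB: "finite B" using assms finite_subset by blast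
  have "bij_betw (\<lambda>h. B \<union> h) {h. h \<subseteq> V - B \<and> card h = k - card B}
      {e. B \<subseteq> e \<and> e \<subseteq> V \<and> card e = k}"
  proof (rule bij_betwI[where g = "\<lambda>e. e - B"])
    show "(\<lambda>h. B \<union> h) \<in> {h. h \<subseteq> V - B \<and> card h = k - card B} \<rightarrow>
        {e. B \<subseteq> e \<and> e \<subseteq> V \<and> card e = k}"
    proof
      fix h assume h: "h \<in> {h. h \<subseteq> V - B \<and> card h = k - card B}"
      then have "finite h" using assms(1) finite_subset by blast
      with h have "card (B \<union> h) = card B + card h"
        by (intro card_Un_disjoint) (use fB in auto)
      with h show "B \<union> h \<in> {e. B \<subseteq> e \<and> e \<subseteq> V \<and> card e = k}"
        using assms by auto
    qed
    show "(\<lambda>e. e - B) \<in> {e. B \<subseteq> e \<and> e \<subseteq> V \<and> card e = k} \<rightarrow>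
        {h. h \<subseteq> V - B \<and> card h = k - card B}"
      using fB by (auto simp: card_Diff_subset)
  qed auto
  then have "card {e. B \<subseteq> e \<and> e \<subseteq> V \<and> card e = k}
      = card {h. h \<subseteq> V - B \<and> card h = k - card B}"
    by (rule bij_betw_same_card[symmetric])
  also have "\<dots> = card (V - B) choose (k - card B)"
    using assms(1) by (simp add: n_subsets)
  finally show ?thesis
    using card_Diff_subset[OF fB assms(2)] by simp
qed

lemma binomial_le_power: "(n::nat) choose j \<le> n ^ j"
proof (cases "j \<le> n")
  case True
  then show ?thesis by (rule binomial_le_pow)
qed (simp add: binomial_eq_0)

text \<open>Here \<open>n \<le> 2 * (n - c)\<close> is combined with the bound of
  \<open>m choose j\<close> from below by (m/j)^j. Shifted binomials can thus be traded for powers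
  of \<open>n\<close> at the price of a constant that depends only on \<open>j\<close>.\<close>

lemma power_le_binomial_shift:
  fixes n c j :: nat
  assumes "2 * c \<le> n" "j + c \<le> n"
  shows "n ^ j \<le> (2 * j) ^ j * ((n - c) choose j)"
proof -
  have "real n ^ j \<le> real ((2 * j) ^ j * ((n - c) choose j))"
  proof (cases "j = 0")
    case False
    have "(real (n - c) / real j) ^ j \<le> real ((n - c) choose j)"
      using assms by (intro binomial_ge_n_over_k_pow_k) auto
    then have "real (n - c) ^ j \<le> real j ^ j * real ((n - c) choose j)"
      using False by (simp add: power_divide field_simps)
    moreover have "real n ^ j \<le> (2 * real (n - c)) ^ j"
      using assms by (intro power_mono) auto
    ultimately have "real n ^ j \<le> 2 ^ j * (real j ^ j * real ((n - c) choose j))"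
      by (simp add: power_mult_distrib order_trans)
    then show ?thesis by (simp add: power_mult_distrib)
  qed simp
  then show ?thesis
    by (metis of_nat_le_iff of_nat_power)
qed

lemma binomial_shift_upper:
  fixes n t j :: nat
  shows "n choose Suc j \<le> (n - t choose Suc j) + t * (n choose j)"
proof (induction t)
  case (Suc t)
  have "n - t choose Suc j \<le> (n - Suc t choose Suc j) + (n choose j)"
  proof (cases "n - t")
    case (Suc m)
    then have "m \<le> n" by simp
    then have "m choose j \<le> n choose j" by (rule binomial_right_mono)
    moreover have "n - Suc t = m" using Suc by simp
    ultimately show ?thesis using Suc by simp
  qed simp
  with Suc.IH show ?case by simp
qed simp

lemma binomial_shift_lower:
  fixes n t j :: nat
  assumes "t \<le> n"
  shows "t * (n - t choose j) + (n - t choose Suc j) \<le> n choose Suc j"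
  using assms
proof (induction t)
  case (Suc t)
  then have *: "n - t = Suc (n - Suc t)" by simp
  have "n - Suc t choose j \<le> n - t choose j" by (rule binomial_right_mono) simp
  then have "t * (n - Suc t choose j) \<le> t * (n - t choose j)" by simp
  moreover have "n - t choose Suc j = (n - Suc t choose j) + (n - Suc t choose Suc j)"
    by (subst *) simp
  moreover have "t * (n - t choose j) + (n - t choose Suc j) \<le> n choose Suc j"
    using Suc by simp
  ultimately show ?case unfolding mult_Suc by linarith
qed simp

text \<open>Both shift estimates at once: a star with \<open>t\<close> centres falls short of
  \<open>t * (n choose (k - 1))\<close> by order n^(k-2) at most. In this form a lower bound on the
  number of edges becomes one on incidences between (k-1)-sets and centres.\<close>

lemma star_lower_bound:
  fixes n t k :: nat
  assumes "t \<le> n" "2 \<le> k"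
  shows "t * (n choose (k - 1)) \<le> ((n choose k) - (n - t choose k)) + t * t * n ^ (k - 2)"
proof -
  obtain j where k: "k = Suc (Suc j)" using assms(2) by (metis add_2_eq_Suc le_Suc_ex)
  have "t * (n choose Suc j) \<le> t * ((n - t choose Suc j) + t * (n choose j))"
    using binomial_shift_upper by (rule mult_le_mono2)
  also have "\<dots> \<le> t * (n - t choose Suc j) + t * t * n ^ j"
    using binomial_le_power[of n j] by (simp add: algebra_simps)
  finally show ?thesis
    using binomial_shift_lower[OF assms(1), of "Suc j"] unfolding k by simp
qed

section \<open>Rich sets and their greedy extension\<close>

text \<open>A rich \<open>K\<close> acts as the kernel of a sunflower with many petals. In the
  avoidance form an edge is rich as well, so edges and small kernels can be mixed in one
  cycle.\<close>

definition rich :: "nat \<Rightarrow> 'a set set \<Rightarrow> 'a set \<Rightarrow> bool" where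
  "rich s H K \<longleftrightarrow> (\<forall>Z. finite Z \<and> card Z \<le> s \<longrightarrow> (\<exists>e\<in>H. K \<subseteq> e \<and> e \<inter> Z \<subseteq> K))"

lemma richD: "rich s H K \<Longrightarrow> finite Z \<Longrightarrow> card Z \<le> s \<Longrightarrow> \<exists>e\<in>H. K \<subseteq> e \<and> e \<inter> Z \<subseteq> K"
  by (auto simp: rich_def)

lemma rich_member: "K \<in> H \<Longrightarrow> rich s H K"
  by (auto simp: rich_def)

lemma rich_mono: "rich s F K \<Longrightarrow> F \<subseteq> H \<Longrightarrow> rich s H K"
  unfolding rich_def by (metis subsetD)

lemma rich_subset_edge: "rich s H K \<Longrightarrow> \<exists>e\<in>H. K \<subseteq> e"
  using richD[of s H K "{}"] by auto

lemma rich_finite: "kgraph_on k V H \<Longrightarrow> rich s H K \<Longrightarrow> finite K \<and> card K \<le> k \<and> K \<subseteq> V"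
proof -
  assume H: "kgraph_on k V H" and "rich s H K"
  then obtain e where e: "e \<in> H" "K \<subseteq> e" using rich_subset_edge by metis
  with H have "finite e" "card e = k" "e \<subseteq> V" by (auto simp: kgraph_on_def)
  with e show ?thesis using card_mono[of e K] finite_subset[of K e] by auto
qed

text \<open>If a blocking set \<open>Z\<close> refutes richness, every edge above \<open>K\<close>
  contains one of its at most \<open>s\<close> vertices outside \<open>K\<close>, and fixing one
  more vertex costs a factor of \<open>card V\<close>.\<close>

lemma card_supersets_not_rich:
  assumes H: "kgraph_on k V H" and V: "finite V" and nr: "\<not> rich s H K"
    and K: "K \<subseteq> V" "card K < k"
  shows "card {e \<in> H. K \<subseteq> e} \<le> s * card V ^ (k - card K - 1)"
proof -
  have fK: "finite K" using K V finite_subset by blast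
  obtain Z where Z: "finite Z" "card Z \<le> s" "\<forall>e\<in>H. K \<subseteq> e \<longrightarrow> \<not> e \<inter> Z \<subseteq> K"
    using nr unfolding rich_def by metis
  define Z' where "Z' = Z \<inter> V - K"
  define U where "U z = {e. insert z K \<subseteq> e \<and> e \<subseteq> V \<and> card e = k}" for z
  have fU: "finite (U z)" for z
    by (rule rev_finite_subset[of "Pow V"]) (use V in \<open>auto simp: U_def\<close>)
  have cU: "card (U z) \<le> card V ^ (k - card K - 1)" if "z \<in> Z'" for z
  proof -
    have c: "card (insert z K) = Suc (card K)"
      using that fK by (auto simp: Z'_def)
    have "card (U z) = (card V - Suc (card K)) choose (k - Suc (card K))"
      unfolding U_def c[symmetric] using that K c V
      by (intro card_supersets) (auto simp: Z'_def)
    also have "\<dots> \<le> card V choose (k - Suc (card K))"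
      by (rule binomial_right_mono) simp
    also have "\<dots> \<le> card V ^ (k - Suc (card K))" by (rule binomial_le_power)
    finally show ?thesis by simp
  qed
  have "{e \<in> H. K \<subseteq> e} \<subseteq> (\<Union>z\<in>Z'. U z)"
  proof
    fix e assume "e \<in> {e \<in> H. K \<subseteq> e}"
    then have e: "e \<in> H" "K \<subseteq> e" by auto
    then obtain z where "z \<in> e" "z \<in> Z" "z \<notin> K" using Z(3) by blast
    with e H show "e \<in> (\<Union>z\<in>Z'. U z)"
      by (auto simp: Z'_def U_def kgraph_on_def)
  qed
  moreover have fZ': "finite Z'" using Z by (simp add: Z'_def)
  ultimately have "card {e \<in> H. K \<subseteq> e} \<le> card (\<Union>z\<in>Z'. U z)"
    using fU by (intro card_mono) auto
  also have "\<dots> \<le> (\<Sum>z\<in>Z'. card (U z))" using fZ' by (rule card_UN_le)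
  also have "\<dots> \<le> (\<Sum>z\<in>Z'. card V ^ (k - card K - 1))" by (intro sum_mono cU)
  also have "\<dots> \<le> s * card V ^ (k - card K - 1)"
  proof -
    have "card Z' \<le> card Z" unfolding Z'_def using Z by (intro card_mono) auto
    then show ?thesis using Z(2) by simp
  qed
  finally show ?thesis .
qed

text \<open>Greedy choice. Half of \<open>2 * k * l\<close> pays for the union of all
  \<open>K j\<close>, the other half for the edges chosen so far.\<close>

lemma rich_extend:
  assumes H: "kgraph_on k V H" and rich: "\<And>i. i < l \<Longrightarrow> rich s H (K i)"
    and s: "2 * k * l \<le> s"
  shows "\<exists>F. (\<forall>i<l. F i \<in> H \<and> K i \<subseteq> F i \<and> F i \<inter> (\<Union>j<l. K j) \<subseteq> K i) \<and>
    (\<forall>i<l. \<forall>j<l. i \<noteq> j \<longrightarrow> F i \<inter> F j \<subseteq> K i \<inter> K j)"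
proof -
  define A where "A = (\<Union>j<l. K j)"
  have fK: "finite (K i)" "card (K i) \<le> k" if "i < l" for i
    using rich_finite[OF H rich[OF that]] by auto
  have fA: "finite A" using fK by (auto simp: A_def)
  have cA: "card A \<le> k * l"
  proof -
    have "card A \<le> (\<Sum>j<l. card (K j))" unfolding A_def by (rule card_UN_le) simp
    also have "\<dots> \<le> (\<Sum>j<l. k)" using fK by (intro sum_mono) auto
    finally show ?thesis by (simp add: mult.commute)
  qed
  have "\<exists>F. (\<forall>i<m. F i \<in> H \<and> K i \<subseteq> F i \<and> F i \<inter> A \<subseteq> K i) \<and>
    (\<forall>i<m. \<forall>j<i. F i \<inter> F j \<subseteq> K i \<inter> K j)" if "m \<le> l" for m
    using that
  proof (induction m)
    case (Suc m)
    have "m \<le> l" using Suc.prems by simp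
    from Suc.IH[OF this] obtain F where F: "\<forall>i<m. F i \<in> H \<and> K i \<subseteq> F i \<and> F i \<inter> A \<subseteq> K i"
      "\<forall>i<m. \<forall>j<i. F i \<inter> F j \<subseteq> K i \<inter> K j" by (elim exE conjE)
    note F = F[rule_format]
    \<comment> \<open>The new edge also avoids the sets \<open>K j\<close> that are still to be
      extended. Because of this, a later edge meets it inside \<open>K i \<inter> K j\<close> and
      not merely inside one of the two.\<close>
    define Z where "Z = A \<union> (\<Union>i<m. F i)"
    have fF: "finite (F i)" "card (F i) = k" if "i < m" for i
      using F(1)[OF that] H by (auto simp: kgraph_on_def)
    have "card (\<Union>i<m. F i) \<le> (\<Sum>i<m. card (F i))" by (rule card_UN_le) simp
    also have "\<dots> = k * m" using fF by simp
    also have "\<dots> \<le> k * l" using Suc.prems by simp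
    finally have "card Z \<le> k * l + k * l"
      unfolding Z_def using cA card_Un_le[of A "\<Union>i<m. F i"] by linarith
    then have "card Z \<le> s" using s by simp
    moreover have "finite Z" using fA fF by (auto simp: Z_def)
    ultimately obtain e where e: "e \<in> H" "K m \<subseteq> e" "e \<inter> Z \<subseteq> K m"
      using richD[OF rich[of m], of Z] Suc.prems by auto
    define F' where "F' = F(m := e)"
    have mA: "K m \<subseteq> A" unfolding A_def using Suc.prems by (intro UN_upper) simp
    have old: "e \<inter> F j \<subseteq> K m \<inter> K j" if "j < m" for j
    proof -
      have "e \<inter> F j \<subseteq> K m" using e that by (auto simp: Z_def)
      moreover have "K m \<inter> F j \<subseteq> K j" using F(1)[OF that] mA by blast
      ultimately show ?thesis by blast
    qed
    have "\<forall>i<Suc m. F' i \<in> H \<and> K i \<subseteq> F' i \<and> F' i \<inter> A \<subseteq> K i"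
      using F(1) e by (auto simp: F'_def less_Suc_eq Z_def)
    moreover have "\<forall>i<Suc m. \<forall>j<i. F' i \<inter> F' j \<subseteq> K i \<inter> K j"
      using F(2) old by (auto simp: F'_def less_Suc_eq)
    ultimately show ?case by blast
  qed auto
  from this[of l] obtain F where F: "\<forall>i<l. F i \<in> H \<and> K i \<subseteq> F i \<and> F i \<inter> A \<subseteq> K i"
    "\<forall>i<l. \<forall>j<i. F i \<inter> F j \<subseteq> K i \<inter> K j" by auto
  have "F i \<inter> F j \<subseteq> K i \<inter> K j" if "i < l" "j < l" "i \<noteq> j" for i j
  proof (cases "j < i")
    case False
    then have "F j \<inter> F i \<subseteq> K j \<inter> K i" using F(2) that by simp
    then show ?thesis by auto
  qed (use F(2) that in simp)
  with F(1) show ?thesis unfolding A_def by blast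
qed

text \<open>The extended edges meet only inside \<open>K i \<inter> K j\<close> and pick up no
  further distinguished vertices, so the kernels alone decide that they form a linear cycle.\<close>

lemma linear_cycle_of_rich_sets:
  assumes H: "kgraph_on k V H" and l: "3 \<le> l" and s: "2 * k * l \<le> s"
    and rich: "\<And>i. i < l \<Longrightarrow> rich s H (K i)" and v: "inj_on v {..<l}"
    and Kv: "\<And>i. i < l \<Longrightarrow> K i \<inter> v ` {..<l} = {v i, v (Suc i mod l)}"
    and disj: "\<And>i j. i < l \<Longrightarrow> j < l \<Longrightarrow> i \<noteq> j \<Longrightarrow> K i \<inter> K j \<subseteq> v ` {..<l}"
  shows "\<exists>C\<subseteq>H. linear_cycle k l C"
proof -
  obtain F where F: "\<forall>i<l. F i \<in> H \<and> K i \<subseteq> F i \<and> F i \<inter> (\<Union>j<l. K j) \<subseteq> K i"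
    "\<forall>i<l. \<forall>j<l. i \<noteq> j \<longrightarrow> F i \<inter> F j \<subseteq> K i \<inter> K j"
    using rich_extend[of k V H l s K, OF H _ s] rich by auto
  note F = F[rule_format]
  have vK: "v ` {..<l} \<subseteq> (\<Union>j<l. K j)"
  proof
    fix x assume "x \<in> v ` {..<l}"
    then obtain i where i: "i < l" "x = v i" by auto
    then have "x \<in> K i" using Kv[of i] by auto
    then show "x \<in> (\<Union>j<l. K j)" using i by auto
  qed
  have "F i \<inter> v ` {..<l} = {v i, v (Suc i mod l)}" if "i < l" for i
  proof -
    have "K i \<subseteq> F i" "F i \<inter> (\<Union>j<l. K j) \<subseteq> K i" using F(1)[OF that] by auto
    then have "F i \<inter> v ` {..<l} = K i \<inter> v ` {..<l}" using vK by (meson Int_greatest Int_lower1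
          Int_lower2 Int_mono order_refl order_trans subset_antisym)
    then show ?thesis using Kv[OF that] by simp
  qed
  moreover have "(F i - v ` {..<l}) \<inter> (F j - v ` {..<l}) = {}"
    if "i < l" "j < l" "i \<noteq> j" for i j
    using F(2)[OF that] disj[OF that] by blast
  ultimately have "linear_cycle k l (F ` {..<l})"
    unfolding linear_cycle_def using l v F(1) H
    by (intro conjI exI[of _ F] exI[of _ v]) (auto simp: kgraph_on_def)
  moreover have "F ` {..<l} \<subseteq> H" using F(1) by auto
  ultimately show ?thesis by blast
qed

section \<open>Closing paths of rich pairs\<close>

lemma close_path_with_one_set:
  assumes H: "kgraph_on k V H" and m: "2 \<le> m" and s: "2 * k * Suc m \<le> s"
    and w: "inj_on w {..m}" and path: "\<And>i. i < m \<Longrightarrow> rich s H {w i, w (Suc i)}"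
    and K: "rich s H K" "K \<inter> w ` {..m} = {w 0, w m}"
  shows "\<exists>C\<subseteq>H. linear_cycle k (Suc m) C"
proof (rule linear_cycle_of_rich_sets[OF H])
  let ?K = "\<lambda>i. if i < m then {w i, w (Suc i)} else K"
  show "3 \<le> Suc m" "2 * k * Suc m \<le> s" using m s by auto
  show "inj_on w {..<Suc m}" using w by (simp add: lessThan_Suc_atMost)
  show "rich s H (?K i)" if "i < Suc m" for i using path K by auto
  show "?K i \<inter> w ` {..<Suc m} = {w i, w (Suc i mod Suc m)}" if "i < Suc m" for i
  proof (cases "i < m")
    case True
    then have "w i \<in> w ` {..m}" "w (Suc i) \<in> w ` {..m}" by auto
    then show ?thesis using True by (auto simp: lessThan_Suc_atMost)
  next
    case False
    then have "i = m" using that by simp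
    then show ?thesis using K by (auto simp: lessThan_Suc_atMost)
  qed
  show "?K i \<inter> ?K j \<subseteq> w ` {..<Suc m}" if "i < Suc m" "j < Suc m" "i \<noteq> j" for i j
  proof -
    have "i < m \<or> j < m" using that by auto
    then show ?thesis by (auto simp: less_Suc_eq)
  qed
qed

text \<open>The common vertex \<open>u\<close> of the two closing sets becomes the last
  distinguished vertex. In the cyclic order \<open>K2\<close> follows the path and \<open>K1\<close>
  leads back to \<open>w 0\<close>.\<close>

lemma close_path_with_two_sets:
  assumes H: "kgraph_on k V H" and m: "1 \<le> m" and s: "2 * k * (m + 2) \<le> s"
    and w: "inj_on w {..m}" and path: "\<And>i. i < m \<Longrightarrow> rich s H {w i, w (Suc i)}"
    and K1: "rich s H K1" "K1 \<inter> w ` {..m} = {w 0}"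
    and K2: "rich s H K2" "K2 \<inter> w ` {..m} = {w m}"
    and u: "K1 \<inter> K2 = {u}"
  shows "\<exists>C\<subseteq>H. linear_cycle k (m + 2) C"
proof (rule linear_cycle_of_rich_sets[OF H])
  have wm: "w m \<noteq> w 0" using w m by (auto dest: inj_onD)
  have um: "u \<notin> w ` {..m}" 
  proof
    assume "u \<in> w ` {..m}"
    then have "u \<in> {w 0}" "u \<in> {w m}" using u K1(2) K2(2) by (metis IntI Int_iff singletonI)+
    then show False using wm by simp
  qed
  let ?v = "w(Suc m := u)"
  let ?K = "\<lambda>i. if i < m then {w i, w (Suc i)} else if i = m then K2 else K1"
  have dom: "{..<m + 2} = insert (Suc m) {..m}" by auto
  have img: "?v ` {..<m + 2} = insert u (w ` {..m})"
  proof -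
    have "?v ` {..m} = w ` {..m}" by (intro image_cong) auto
    then show ?thesis unfolding dom image_insert by simp
  qed
  show "3 \<le> m + 2" "2 * k * (m + 2) \<le> s" using m s by auto
  show "inj_on ?v {..<m + 2}" unfolding dom
    using w um by (auto simp: inj_on_def)
  show "rich s H (?K i)" if "i < m + 2" for i using path K1 K2 by auto
  show "?K i \<inter> ?v ` {..<m + 2} = {?v i, ?v (Suc i mod (m + 2))}" if i: "i < m + 2" for i
  proof -
    consider "i < m" | "i = m" | "i = Suc m" using i by linarith
    then show ?thesis
    proof cases
      case 1
      then have "w i \<in> w ` {..m}" "w (Suc i) \<in> w ` {..m}" by auto
      with 1 show ?thesis unfolding img by auto
    next
      case 2
      then show ?thesis unfolding img using K2(2) u by auto
    next
      case 3
      then show ?thesis unfolding img using K1(2) u by auto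
    qed
  qed
  show "?K i \<inter> ?K j \<subseteq> ?v ` {..<m + 2}" if "i < m + 2" "j < m + 2" "i \<noteq> j" for i j
  proof -
    consider "i < m" | "j < m" | "\<not> i < m" "\<not> j < m" by blast
    then show ?thesis
    proof cases
      case 1
      then have "w i \<in> w ` {..m}" "w (Suc i) \<in> w ` {..m}" by auto
      with 1 show ?thesis unfolding img by auto
    next
      case 2
      then have "w j \<in> w ` {..m}" "w (Suc j) \<in> w ` {..m}" by auto
      with 2 show ?thesis unfolding img by auto
    next
      case 3
      then have "?K i \<inter> ?K j \<subseteq> {u}" using that u by auto
      then show ?thesis unfolding img by auto
    qed
  qed
qed

text \<open>Replacing the closing pair by a detour through a fresh vertex lengthens the cycle by
  one, so a relation whose pairs always extend to triangles yields every length.\<close>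

lemma linear_cycle_of_triangle_relation:
  assumes H: "kgraph_on k V H" and l: "3 \<le> l" and s: "2 * k * l \<le> s"
    and sym: "\<And>x y. P x y \<Longrightarrow> P y x" and P: "\<And>x y. P x y \<Longrightarrow> x \<noteq> y \<and> rich s H {x, y}"
    and ext: "\<And>x y Z. P x y \<Longrightarrow> finite Z \<Longrightarrow> card Z \<le> l \<Longrightarrow> \<exists>z. z \<notin> Z \<and> P x z \<and> P z y"
    and start: "P a b"
  shows "\<exists>C\<subseteq>H. linear_cycle k l C"
proof -
  have "\<exists>w. inj_on w {..m} \<and> (\<forall>i<m. P (w i) (w (Suc i))) \<and> P (w m) (w 0)"
    if "1 \<le> m" "m < l" for m
    using that
  proof (induction m rule: dec_induct)
    \<comment> \<open>A degenerate cycle on two vertices that uses one pair twice; at least one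
      detour follows because \<open>l\<close> is at least 3.\<close>
    case base
    let ?w = "\<lambda>i::nat. if i = 0 then a else b"
    have "inj_on ?w {..1}" using P[OF start] by (auto simp: inj_on_def)
    then show ?case using start sym by (intro exI[of _ ?w]) auto
  next
    case (step m)
    then obtain w where w: "inj_on w {..m}" "\<forall>i<m. P (w i) (w (Suc i))" "P (w m) (w 0)"
      by auto
    have "card (w ` {..m}) \<le> l" using card_image_le[of "{..m}" w] step.prems by simp
    then obtain z where z: "z \<notin> w ` {..m}" "P (w m) z" "P z (w 0)"
      using ext[OF w(3)] by blast
    have "inj_on (w(Suc m := z)) {..Suc m}"
      unfolding atMost_Suc using w(1) z(1) by (auto simp: inj_on_def)
    moreover have "\<forall>i<Suc m. P ((w(Suc m := z)) i) ((w(Suc m := z)) (Suc i))"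
      using w z by (auto simp: less_Suc_eq)
    moreover have "P ((w(Suc m := z)) (Suc m)) ((w(Suc m := z)) 0)" using z by simp
    ultimately show ?case by (intro exI[of _ "w(Suc m := z)"] conjI)
  qed
  moreover have "1 \<le> l - 1" "l - 1 < l" using l by auto
  ultimately obtain w where w: "inj_on w {..l - 1}"
    "\<forall>i<l - 1. P (w i) (w (Suc i))" "P (w (l - 1)) (w 0)" by meson
  have "\<exists>C\<subseteq>H. linear_cycle k (Suc (l - 1)) C"
  proof (rule close_path_with_one_set[OF H _ _ w(1)])
    show "{w 0, w (l - 1)} \<inter> w ` {..l - 1} = {w 0, w (l - 1)}" by auto
    show "rich s H {w 0, w (l - 1)}" using P[OF sym[OF w(3)]] by simp
  qed (use l s P w in auto)
  then show ?thesis using l by simp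
qed

lemma distinct_representatives:
  fixes A :: "nat \<Rightarrow> 'a set"
  assumes "\<And>i. i < m \<Longrightarrow> card Z + m \<le> card (A i)" "finite Z"
  shows "\<exists>y. inj_on y {..<m} \<and> (\<forall>i<m. y i \<in> A i - Z)"
proof -
  have "\<exists>y. inj_on y {..<q} \<and> (\<forall>i<q. y i \<in> A i - Z)" if "q \<le> m" for q
    using that
  proof (induction q)
    case (Suc q)
    then obtain y where y: "inj_on y {..<q}" "\<forall>i<q. y i \<in> A i - Z" by auto
    have "card (Z \<union> y ` {..<q}) \<le> card Z + q"
      using card_Un_le[of Z "y ` {..<q}"] card_image_le[of "{..<q}" y] by simp
    also have "\<dots> < card (A q)" using assms(1)[of q] Suc.prems by simp
    finally have "\<not> A q \<subseteq> Z \<union> y ` {..<q}"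
      using card_mono[of "Z \<union> y ` {..<q}" "A q"] assms(2) by auto
    then obtain z where z: "z \<in> A q" "z \<notin> Z" "z \<notin> y ` {..<q}" by blast
    have "inj_on (y(q := z)) {..<Suc q}"
      using y(1) z(3) by (auto simp: inj_on_def less_Suc_eq)
    moreover have "\<forall>i<Suc q. (y(q := z)) i \<in> A i - Z"
      using y(2) z by (auto simp: less_Suc_eq)
    ultimately show ?case by blast
  qed auto
  then show ?thesis by blast
qed

section \<open>Sets with many common rich neighbours\<close>

definition rich_nbs :: "nat \<Rightarrow> 'a set set \<Rightarrow> 'a \<Rightarrow> 'a set" where
  "rich_nbs s H c = {x. x \<noteq> c \<and> rich s H {c, x}}"

definition linked :: "nat \<Rightarrow> nat \<Rightarrow> 'a set set \<Rightarrow> 'a set \<Rightarrow> bool" where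
  "linked r s H S \<longleftrightarrow>
     (\<forall>c\<in>S. \<forall>d\<in>S. c \<noteq> d \<longrightarrow> r \<le> card (rich_nbs s H c \<inter> rich_nbs s H d))"

text \<open>The path visits all of \<open>S\<close>, with a common rich neighbour between
  consecutive elements. There are at least \<open>r\<close> candidates for each such connector, so
  distinct ones off \<open>Z\<close> can be picked greedily.\<close>

lemma alternating_path:
  assumes S: "finite S" "card S = t" "1 \<le> t" and linked: "linked r s H S"
    and x: "x \<in> (\<Inter>c\<in>S. rich_nbs s H c)" "x' \<in> (\<Inter>c\<in>S. rich_nbs s H c)" "x \<noteq> x'"
    and Z: "finite Z" "S \<inter> Z = {}" and r: "card Z + 2 * t + 2 \<le> r"
  shows "\<exists>w. w 0 = x \<and> w (2 * t) = x' \<and> inj_on w {..2 * t} \<and>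
    (\<forall>i<2 * t. rich s H {w i, w (Suc i)}) \<and> w ` {..2 * t} \<inter> Z \<subseteq> {x, x'}"
proof -
  obtain \<sigma> where \<sigma>: "bij_betw \<sigma> {..<t} S"
    using S ex_bij_betw_nat_finite[of S] by (auto simp: atLeast0LessThan)
  have \<sigma>S: "\<sigma> i \<in> S" if "i < t" for i using \<sigma> that bij_betwE by fastforce
  have \<sigma>inj: "\<sigma> i = \<sigma> j \<longleftrightarrow> i = j" if "i < t" "j < t" for i j
    using \<sigma> that by (auto simp: bij_betw_def inj_on_def)
  \<comment> \<open>At most \<open>card Z + t + 2\<close> forbidden vertices and
    \<open>t - 1\<close> connectors to pick: this explains the bound on \<open>r\<close>.\<close>
  define Z' where "Z' = Z \<union> S \<union> {x, x'}"
  have cZ': "card Z' \<le> card Z + t + 2"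
    unfolding Z'_def using card_Un_le[of "Z \<union> S" "{x, x'}"] card_Un_le[of Z S] S
    by (simp add: x)
  have xS: "x \<notin> S" "x' \<notin> S" using x by (auto simp: rich_nbs_def)
  have "\<exists>y. inj_on y {..<t - 1} \<and>
    (\<forall>i<t - 1. y i \<in> rich_nbs s H (\<sigma> i) \<inter> rich_nbs s H (\<sigma> (Suc i)) - Z')"
  proof (rule distinct_representatives)
    show "finite Z'" using Z S by (simp add: Z'_def)
    fix i assume i: "i < t - 1"
    then have "\<sigma> i \<noteq> \<sigma> (Suc i)" "\<sigma> i \<in> S" "\<sigma> (Suc i) \<in> S"
      using \<sigma>S by (auto simp: \<sigma>inj)
    then have "r \<le> card (rich_nbs s H (\<sigma> i) \<inter> rich_nbs s H (\<sigma> (Suc i)))"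
      using linked unfolding linked_def by blast
    then show "card Z' + (t - 1) \<le> card (rich_nbs s H (\<sigma> i) \<inter> rich_nbs s H (\<sigma> (Suc i)))"
      using cZ' r by linarith
  qed
  then obtain y where y: "inj_on y {..<t - 1}"
    "\<And>i. i < t - 1 \<Longrightarrow> y i \<in> rich_nbs s H (\<sigma> i) \<inter> rich_nbs s H (\<sigma> (Suc i)) - Z'" by blast
  define Y where "Y i = (if i = 0 then x else if i = t then x' else y (i - 1))" for i
  have Ynot: "Y i \<notin> S" if "i \<le> t" for i
    using that xS y(2)[of "i - 1"] by (auto simp: Y_def Z'_def)
  have YZ: "Y i \<in> {x, x'} \<or> Y i \<notin> Z'" if "i \<le> t" for i
    using that y(2)[of "i - 1"] by (auto simp: Y_def)
  have Yin: "Y i \<noteq> Y j" if "i < j" "j \<le> t" for i j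
  proof -
    have "y (i - 1) \<noteq> y (j - 1)" if "0 < i" "j < t"
    proof -
      have "i - 1 < t - 1" "j - 1 < t - 1" "i - 1 \<noteq> j - 1" using that \<open>i < j\<close> by linarith+
      then show ?thesis using inj_onD[OF y(1), of "i - 1" "j - 1"] by auto
    qed
    moreover have "y (j - 1) \<noteq> x" if "0 < j" "j < t"
      using y(2)[of "j - 1"] that by (auto simp: Z'_def)
    moreover have "y (i - 1) \<noteq> x'" if "0 < i" "i < t"
      using y(2)[of "i - 1"] that by (auto simp: Z'_def)
    ultimately show ?thesis using that x(3) by (auto simp: Y_def)
  qed
  have Yinj: "Y i = Y j \<longleftrightarrow> i = j" if "i \<le> t" "j \<le> t" for i j
    using Yin[of i j] Yin[of j i] that by (metis linorder_neqE_nat)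
  have Yl: "Y i \<in> rich_nbs s H (\<sigma> i)" if "i < t" for i
    using that x \<sigma>S[OF that] y(2)[of "i - 1"] by (auto simp: Y_def)
  have Yr: "Y (Suc i) \<in> rich_nbs s H (\<sigma> i)" if "i < t" for i
    using that x \<sigma>S[OF that] y(2)[of i] by (auto simp: Y_def)
  define w where "w i = (if even i then Y (i div 2) else \<sigma> (i div 2))" for i
  have "w 0 = x" "w (2 * t) = x'" using S by (auto simp: w_def Y_def)
  moreover have "inj_on w {..2 * t}"
  proof (rule inj_onI)
    fix i j assume ij: "i \<in> {..2 * t}" "j \<in> {..2 * t}" and eq: "w i = w j"
    have odd_less: "q div 2 < t" if "odd q" "q \<le> 2 * t" for q
      using that by (auto elim!: oddE)
    have "even i = even j"
    proof (rule ccontr)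
      assume "even i \<noteq> even j"
      then consider "even i" "odd j" | "odd i" "even j" by blast
      then show False
      proof cases
        case 1
        then show False using eq Ynot[of "i div 2"] \<sigma>S[OF odd_less[of j]] ij
          by (auto simp: w_def)
      next
        case 2
        then show False using eq Ynot[of "j div 2"] \<sigma>S[OF odd_less[of i]] ij
          by (auto simp: w_def)
      qed
    qed
    moreover have "i div 2 = j div 2"
    proof (cases "even i")
      case True
      then show ?thesis using eq ij \<open>even i = even j\<close> Yinj[of "i div 2" "j div 2"]
        by (auto simp: w_def)
    next
      case False
      then show ?thesis using eq ij \<open>even i = even j\<close> \<sigma>inj[OF odd_less[of i] odd_less[of j]]
        by (auto simp: w_def)
    qed
    ultimately show "i = j"
      by (metis even_two_times_div_two odd_two_times_div_two_succ)
  qed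
  moreover have "rich s H {w i, w (Suc i)}" if "i < 2 * t" for i
  proof (cases "even i")
    case True
    then obtain j where "i = 2 * j" by blast
    then show ?thesis using Yl[of j] that by (auto simp: w_def rich_nbs_def insert_commute)
  next
    case False
    then obtain j where "i = 2 * j + 1" by (blast elim: oddE)
    then show ?thesis using Yr[of j] that by (auto simp: w_def rich_nbs_def)
  qed
  moreover have "w ` {..2 * t} \<inter> Z \<subseteq> {x, x'}"
  proof -
    have "w i \<notin> Z \<or> w i \<in> {x, x'}" if "i \<le> 2 * t" for i
    proof (cases "even i")
      case True
      then show ?thesis using YZ[of "i div 2"] that by (auto simp: w_def Z'_def)
    next
      case False
      then have "i div 2 < t" using that by (auto elim!: oddE)
      then show ?thesis using \<sigma>S[of "i div 2"] Z False by (auto simp: w_def)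
    qed
    then show ?thesis by blast
  qed
  ultimately show ?thesis by blast
qed

lemma odd_cycle_of_linked_set:
  assumes H: "kgraph_on k V H" and S: "finite S" "card S = t" "1 \<le> t"
    and linked: "linked r s H S" and r: "2 * k + 2 * t + 2 \<le> r"
    and s: "2 * k * (2 * t + 1) \<le> s"
    and x: "x \<in> (\<Inter>c\<in>S. rich_nbs s H c)" "x' \<in> (\<Inter>c\<in>S. rich_nbs s H c)" "x \<noteq> x'"
    and K: "rich s H K" "x \<in> K" "x' \<in> K" "K \<inter> S = {}"
  shows "\<exists>C\<subseteq>H. linear_cycle k (2 * t + 1) C"
proof -
  have fK: "finite K" "card K \<le> k" using rich_finite[OF H K(1)] by auto
  then obtain w where w: "w 0 = x" "w (2 * t) = x'" "inj_on w {..2 * t}"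
    "\<And>i. i < 2 * t \<Longrightarrow> rich s H {w i, w (Suc i)}" "w ` {..2 * t} \<inter> K \<subseteq> {x, x'}"
    using alternating_path[OF S linked x, of K] K r by (auto simp: Int_commute)
  have "x \<in> w ` {..2 * t}" "x' \<in> w ` {..2 * t}"
    using w(1,2) by (metis atMost_iff imageI order_refl zero_le)+
  moreover have "K \<inter> w ` {..2 * t} \<subseteq> {x, x'}" using w(5) by (simp add: Int_commute)
  ultimately have "K \<inter> w ` {..2 * t} = {w 0, w (2 * t)}"
    using K(2,3) w(1,2) by auto
  then show ?thesis
    using close_path_with_one_set[OF H _ _ w(3,4) K(1)] S s by simp
qed

text \<open>The path has to miss both closing sets apart from its own ends. Their union has at most
  \<open>2 * k\<close> vertices, which is the origin of the term \<open>2 * k\<close> in the bound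
  on \<open>r\<close>.\<close>

lemma even_cycle_of_linked_set:
  assumes H: "kgraph_on k V H" and S: "finite S" "card S = t" "1 \<le> t"
    and linked: "linked r s H S" and r: "2 * k + 2 * t + 2 \<le> r"
    and s: "2 * k * (2 * t + 2) \<le> s"
    and x: "x \<in> (\<Inter>c\<in>S. rich_nbs s H c)" "x' \<in> (\<Inter>c\<in>S. rich_nbs s H c)"
    and K1: "rich s H K1" "x \<in> K1" "K1 \<inter> S = {}"
    and K2: "rich s H K2" "x' \<in> K2" "K2 \<inter> S = {}"
    and u: "K1 \<inter> K2 = {u}" "x \<noteq> u" "x' \<noteq> u"
  shows "\<exists>C\<subseteq>H. linear_cycle k (2 * t + 2) C"
proof -
  have xx: "x \<noteq> x'" "x \<notin> K2" "x' \<notin> K1" using u K1 K2 by auto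
  have fK: "finite K1" "card K1 \<le> k" "finite K2" "card K2 \<le> k"
    using rich_finite[OF H K1(1)] rich_finite[OF H K2(1)] by auto
  have "card (K1 \<union> K2) + 2 * t + 2 \<le> r"
    using card_Un_le[of K1 K2] fK r by linarith
  then obtain w where w: "w 0 = x" "w (2 * t) = x'" "inj_on w {..2 * t}"
    "\<And>i. i < 2 * t \<Longrightarrow> rich s H {w i, w (Suc i)}" "w ` {..2 * t} \<inter> (K1 \<union> K2) \<subseteq> {x, x'}"
    using alternating_path[OF S linked x xx(1), of "K1 \<union> K2"] K1 K2 fK
    by (auto simp: Int_commute Int_Un_distrib2)
  have "x \<in> w ` {..2 * t}" "x' \<in> w ` {..2 * t}"
    using w(1,2) by (metis atMost_iff imageI order_refl zero_le)+
  moreover have "K1 \<inter> w ` {..2 * t} \<subseteq> {x}" "K2 \<inter> w ` {..2 * t} \<subseteq> {x'}"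
    using w(5) xx by auto
  ultimately have "K1 \<inter> w ` {..2 * t} = {w 0}" "K2 \<inter> w ` {..2 * t} = {w (2 * t)}"
    using w(1,2) K1(2) K2(2) by auto
  then show ?thesis
    using close_path_with_two_sets[OF H _ _ w(3,4) K1(1) _ K2(1) _ u(1)] S s by simp
qed

subsection \<open>Homogeneous subfamilies\<close>

text \<open>A random colouring with \<open>k\<close> colours makes a given edge rainbow with
  probability at least k^(-k), as a single fixed bijection on the edge already shows; some colouring
  does as well as the average.\<close>

lemma rainbow_colouring:
  fixes F :: "'a set set"
  assumes V: "finite V" and F: "kgraph_on k V F" and k: "1 \<le> k"
  shows "\<exists>\<chi>. card F \<le> k ^ k * card {e \<in> F. bij_betw \<chi> e {..<k}}"
proof (cases "F = {}")
  case False
  define X where "X = (V \<rightarrow>\<^sub>E {..<k})"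
  define n where "n = card V"
  have fX: "finite X" and cX: "card X = k ^ n"
    using V by (auto simp: X_def n_def card_PiE intro!: finite_PiE)
  have fF: "finite F"
    by (rule rev_finite_subset[of "Pow V"]) (use V F in \<open>auto simp: kgraph_on_def\<close>)
  have nk: "k \<le> n"
    using False F V card_mono[of V] unfolding kgraph_on_def n_def by force
  have many: "k ^ (n - k) \<le> card {\<chi> \<in> X. bij_betw \<chi> e {..<k}}" if "e \<in> F" for e
  proof -
    have e: "e \<subseteq> V" "finite e" "card e = k" using that F by (auto simp: kgraph_on_def)
    obtain b where b: "bij_betw b e {..<k}"
      using ex_bij_betw_finite_nat[OF e(2)] e(3) by (auto simp: atLeast0LessThan)
    define \<phi> where "\<phi> g = (\<lambda>x. if x \<in> e then b x else g x)" for g :: "'a \<Rightarrow> nat"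
    let ?Y = "(V - e) \<rightarrow>\<^sub>E {..<k}"
    have "card ?Y \<le> card {\<chi> \<in> X. bij_betw \<chi> e {..<k}}"
    proof (rule card_inj_on_le)
      show "inj_on \<phi> ?Y"
      proof (rule inj_onI)
        fix g h assume g: "g \<in> ?Y" and h: "h \<in> ?Y" and eq: "\<phi> g = \<phi> h"
        show "g = h"
        proof (rule PiE_ext[OF g h])
          fix x assume "x \<in> V - e"
          then show "g x = h x" using fun_cong[OF eq, of x] by (simp add: \<phi>_def)
        qed
      qed
      have "\<phi> g \<in> X" if "g \<in> ?Y" for g
        using that b e(1) by (auto simp: X_def \<phi>_def PiE_iff extensional_def bij_betw_def)
      moreover have "bij_betw (\<phi> g) e {..<k}" for g
        using b by (rule bij_betw_cong[THEN iffD1, rotated]) (simp add: \<phi>_def)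
      ultimately show "\<phi> ` ?Y \<subseteq> {\<chi> \<in> X. bij_betw \<chi> e {..<k}}" by auto
      show "finite {\<chi> \<in> X. bij_betw \<chi> e {..<k}}" using fX by simp
    qed
    moreover have "card ?Y = k ^ (n - k)"
      using V e by (simp add: card_PiE card_Diff_subset n_def)
    ultimately show ?thesis by simp
  qed
  show ?thesis
  proof (rule ccontr)
    assume "\<not> ?thesis"
    then have less: "k ^ k * card {e \<in> F. bij_betw \<chi> e {..<k}} < card F" for \<chi>
      by (simp add: not_le)
    have "X \<noteq> {}" using cX k by (metis card.empty not_one_le_zero power_eq_0_iff)
    then have "(\<Sum>\<chi>\<in>X. k ^ k * card {e \<in> F. bij_betw \<chi> e {..<k}}) < (\<Sum>\<chi>\<in>X. card F)"
      using less fX by (intro sum_strict_mono) auto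
    also have "\<dots> = k ^ n * card F" by (simp add: cX)
    finally have "k ^ k * (\<Sum>\<chi>\<in>X. card {e \<in> F. bij_betw \<chi> e {..<k}}) < k ^ n * card F"
      by (simp add: sum_distrib_left)
    moreover have "(\<Sum>\<chi>\<in>X. card {e \<in> F. bij_betw \<chi> e {..<k}})
        = (\<Sum>e\<in>F. card {\<chi> \<in> X. bij_betw \<chi> e {..<k}})"
      using fX fF by (intro sum_multicount_gen) auto
    moreover have "(\<Sum>e\<in>F. k ^ (n - k)) \<le> (\<Sum>e\<in>F. card {\<chi> \<in> X. bij_betw \<chi> e {..<k}})"
      by (intro sum_mono many)
    ultimately have "k ^ k * (card F * k ^ (n - k)) < k ^ n * card F"
      by (simp add: le_less_trans[OF mult_le_mono2])
    moreover have "k ^ n = k ^ k * k ^ (n - k)" using nk by (simp flip: power_add)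
    ultimately show False by simp
  qed
qed simp

text \<open>On a rainbow edge this is the subset whose colour set is \<open>K\<close>. It transports
  intersection types from one edge to another.\<close>

definition pattern :: "('a \<Rightarrow> nat) \<Rightarrow> nat set \<Rightarrow> 'a set \<Rightarrow> 'a set" where
  "pattern \<chi> K e = {x \<in> e. \<chi> x \<in> K}"

lemma pattern_image_Int:
  assumes "bij_betw \<chi> e U"
  shows "pattern \<chi> (\<chi> ` (e \<inter> f)) e = e \<inter> f"
proof -
  have "inj_on \<chi> e" using assms by (simp add: bij_betw_def)
  then show ?thesis by (auto simp: pattern_def dest: inj_onD)
qed

lemma image_pattern: "bij_betw \<chi> e U \<Longrightarrow> K \<subseteq> U \<Longrightarrow> \<chi> ` pattern \<chi> K e = K"
  by (auto simp: pattern_def bij_betw_def)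

lemma card_pattern: "bij_betw \<chi> e U \<Longrightarrow> K \<subseteq> U \<Longrightarrow> card (pattern \<chi> K e) = card K"
  using image_pattern[of \<chi> e U K]
  by (metis (no_types, lifting) bij_betw_def card_image inj_on_subset mem_Collect_eq
      pattern_def subsetI)

text \<open>Whenever some pattern is not rich in the current family, all edges with that pattern are
  removed together, until every pattern is rich. \<open>R K\<close> collects the removals caused by
  type \<open>K\<close>. As a pattern \<open>g\<close> disappears completely at its removal, one
  blocking set for each \<open>g\<close> suffices.\<close>

lemma peel_non_rich:
  fixes F :: "'a set set"
  assumes "finite F"
  shows "\<exists>F0 R. F0 \<subseteq> F \<and> (\<forall>e\<in>F0. \<forall>K\<in>\<K>. rich s F0 (pattern \<chi> K e)) \<and>
    (\<forall>K. R K \<subseteq> F \<and> (\<forall>g. \<exists>Z. finite Z \<and> card Z \<le> s \<and>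
       (\<forall>e\<in>R K. pattern \<chi> K e = g \<longrightarrow> \<not> e \<inter> Z \<subseteq> g))) \<and>
    F \<subseteq> F0 \<union> (\<Union>K\<in>\<K>. R K)"
  using assms
proof (induction F rule: finite_psubset_induct)
  case (psubset F)
  show ?case
  proof (cases "\<forall>e\<in>F. \<forall>K\<in>\<K>. rich s F (pattern \<chi> K e)")
    case True
    then show ?thesis
      by (intro exI[of _ F] exI[of _ "\<lambda>_. {}"]) (auto intro: exI[of _ "{}"])
  next
    case False
    then obtain e L where e: "e \<in> F" "L \<in> \<K>" "\<not> rich s F (pattern \<chi> L e)" by auto
    define g where "g = pattern \<chi> L e"
    obtain Z where Z: "finite Z" "card Z \<le> s" "\<forall>f\<in>F. g \<subseteq> f \<longrightarrow> \<not> f \<inter> Z \<subseteq> g"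
      using e(3) unfolding rich_def g_def by metis
    define G where "G = {f \<in> F. pattern \<chi> L f = g}"
    have "F - G \<subset> F" using e(1) by (auto simp: G_def g_def)
    from psubset.IH[OF this] obtain F0 R where
      IH: "F0 \<subseteq> F - G" "\<forall>e\<in>F0. \<forall>K\<in>\<K>. rich s F0 (pattern \<chi> K e)"
        "\<forall>K. R K \<subseteq> F - G \<and> (\<forall>g. \<exists>Z. finite Z \<and> card Z \<le> s \<and>
          (\<forall>e\<in>R K. pattern \<chi> K e = g \<longrightarrow> \<not> e \<inter> Z \<subseteq> g))"
        "F - G \<subseteq> F0 \<union> (\<Union>K\<in>\<K>. R K)"
      by (elim exE conjE)
    define R' where "R' = R(L := R L \<union> G)"
    have "R' K \<subseteq> F" for K using IH(3) by (auto simp: R'_def G_def)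
    moreover have "\<exists>Z. finite Z \<and> card Z \<le> s \<and>
        (\<forall>e\<in>R' K. pattern \<chi> K e = h \<longrightarrow> \<not> e \<inter> Z \<subseteq> h)" for K h
    proof (cases "K = L \<and> h = g")
      case True
      have "\<not> f \<inter> Z \<subseteq> h" if "f \<in> R' K" "pattern \<chi> K f = h" for f
      proof -
        have "f \<in> F" using that(1) IH(3) by (auto simp: R'_def G_def split: if_splits)
        moreover have "g \<subseteq> f" using that(2) True by (auto simp: pattern_def)
        ultimately show ?thesis using Z(3) True by simp
      qed
      then show ?thesis using Z by (intro exI[of _ Z]) auto
    next
      case False
      obtain Y where Y: "finite Y" "card Y \<le> s"
        "\<forall>e\<in>R K. pattern \<chi> K e = h \<longrightarrow> \<not> e \<inter> Y \<subseteq> h" using IH(3) by metis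
      have "\<not> f \<inter> Y \<subseteq> h" if "f \<in> R' K" "pattern \<chi> K f = h" for f
      proof -
        have "f \<in> R K" using that False by (auto simp: R'_def G_def split: if_splits)
        then show ?thesis using Y(3) that(2) by simp
      qed
      then show ?thesis using Y by (intro exI[of _ Y]) auto
    qed
    moreover have "F \<subseteq> F0 \<union> (\<Union>K\<in>\<K>. R' K)"
    proof
      fix f assume f: "f \<in> F"
      show "f \<in> F0 \<union> (\<Union>K\<in>\<K>. R' K)"
      proof (cases "f \<in> G")
        case True
        then show ?thesis using e(2) by (auto simp: R'_def)
      next
        case False
        then have "f \<in> F0 \<union> (\<Union>K\<in>\<K>. R K)" using IH(4) f by auto
        then show ?thesis by (auto simp: R'_def)
      qed
    qed
    ultimately show ?thesis using IH(1,2)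
      by (intro exI[of _ F0] exI[of _ R']) auto
  qed
qed

text \<open>In the fibre over \<open>g\<close> the most popular element of \<open>Z g\<close>
  accounts for at least the fraction 1/s. Choosing it separately in every fibre loses only the
  factor \<open>s\<close> in total.\<close>

lemma popular_choice:
  fixes R :: "'e set" and h :: "'e \<Rightarrow> 'g" and Z :: "'g \<Rightarrow> 'z set"
  assumes R: "finite R" and Z: "\<And>g. finite (Z g)" "\<And>g. card (Z g) \<le> s"
    and hit: "\<And>e. e \<in> R \<Longrightarrow> \<exists>z\<in>Z (h e). Q z e"
  shows "\<exists>z. card R \<le> s * card {e \<in> R. Q (z (h e)) e}"
proof -
  have "\<exists>z. card {e \<in> R. h e = g} \<le> s * card {e \<in> R. h e = g \<and> Q z e}" for g
  proof (rule ccontr)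
    assume "\<not> ?thesis"
    then have less: "s * card {e \<in> R. h e = g \<and> Q z e} < card {e \<in> R. h e = g}" for z
      by (simp add: not_le)
    have "{e \<in> R. h e = g} \<subseteq> (\<Union>z\<in>Z g. {e \<in> R. h e = g \<and> Q z e})" using hit by auto
    then have "card {e \<in> R. h e = g} \<le> card (\<Union>z\<in>Z g. {e \<in> R. h e = g \<and> Q z e})"
      using R Z by (intro card_mono) auto
    also have "\<dots> \<le> (\<Sum>z\<in>Z g. card {e \<in> R. h e = g \<and> Q z e})" using Z by (intro card_UN_le)
    finally have *: "card {e \<in> R. h e = g} \<le> (\<Sum>z\<in>Z g. card {e \<in> R. h e = g \<and> Q z e})" .
    have ne: "Z g \<noteq> {}" using * less[of undefined] by auto
    have "s * (\<Sum>z\<in>Z g. card {e \<in> R. h e = g \<and> Q z e})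
        = (\<Sum>z\<in>Z g. s * card {e \<in> R. h e = g \<and> Q z e})" by (simp add: sum_distrib_left)
    also have "\<dots> < (\<Sum>z\<in>Z g. card {e \<in> R. h e = g})"
      using less ne Z by (intro sum_strict_mono) auto
    also have "\<dots> \<le> s * card {e \<in> R. h e = g}" using Z by simp
    finally show False using mult_le_mono2[OF *, of s] by linarith
  qed
  then have "\<exists>z. \<forall>g. card {e \<in> R. h e = g} \<le> s * card {e \<in> R. h e = g \<and> Q (z g) e}"
    by (intro choice allI)
  then obtain z where z: "card {e \<in> R. h e = g} \<le> s * card {e \<in> R. h e = g \<and> Q (z g) e}" for g
    by blast
  have part: "card A = (\<Sum>g\<in>h ` R. card {e \<in> A. h e = g})" if "A \<subseteq> R" for A
  proof -
    have fA: "finite A" using that R finite_subset by auto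
    have "(\<Sum>g\<in>h ` R. sum (\<lambda>_. 1::nat) {e \<in> A. h e = g}) = sum (\<lambda>_. 1) A"
      by (rule sum.group) (use fA R that in auto)
    then show ?thesis by simp
  qed
  have "card R = (\<Sum>g\<in>h ` R. card {e \<in> R. h e = g})" by (rule part) simp
  also have "\<dots> \<le> (\<Sum>g\<in>h ` R. s * card {e \<in> R. h e = g \<and> Q (z g) e})" by (intro sum_mono z)
  also have "\<dots> = s * (\<Sum>g\<in>h ` R. card {e \<in> {e \<in> R. Q (z (h e)) e}. h e = g})"
    unfolding sum_distrib_left by (intro sum.cong arg_cong2[where f = "(*)"] arg_cong[where f = card]) auto
  also have "\<dots> = s * card {e \<in> R. Q (z (h e)) e}"
    by (subst part[symmetric]) auto
  finally show ?thesis by blast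
qed

text \<open>This is Fueredi's intersection structure: all occurring intersection types are in
  \<open>J\<close>, and each type in \<open>J\<close> is rich at each edge. Richness refers to
  \<open>F\<close> itself and not to a host graph, so edges can be chosen anew without leaving the
  structure.\<close>

definition homogeneous :: "nat \<Rightarrow> nat \<Rightarrow> 'a set set \<Rightarrow> ('a \<Rightarrow> nat) \<Rightarrow> nat set set \<Rightarrow> bool" where
  "homogeneous s k F \<chi> J \<longleftrightarrow>
     (\<forall>e\<in>F. bij_betw \<chi> e {..<k}) \<and> (\<forall>K\<in>J. K \<subset> {..<k}) \<and>
     (\<forall>K\<in>J. \<forall>e\<in>F. rich s F (pattern \<chi> K e)) \<and>
     (\<forall>e\<in>F. \<forall>f\<in>F. e \<noteq> f \<longrightarrow> \<chi> ` (e \<inter> f) \<in> J)"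

text \<open>Induction on the set of admissible intersection types. Either peeling keeps a constant
  fraction of the edges, and the peeled family is homogeneous, or one type \<open>K\<close> is
  responsible for a constant fraction of the removals, and a constant fraction of those edges never
  meets in type \<open>K\<close> again.\<close>

lemma homogeneous_subfamily_rainbow:
  fixes F :: "'a set set"
  assumes "finite \<K>" "finite F" "\<forall>e\<in>F. bij_betw \<chi> e {..<k}" "\<forall>K\<in>\<K>. K \<subset> {..<k}"
    "\<forall>e\<in>F. \<forall>f\<in>F. e \<noteq> f \<longrightarrow> \<chi> ` (e \<inter> f) \<in> \<K>"
  shows "\<exists>F'\<subseteq>F. \<exists>J. homogeneous s k F' \<chi> J \<and>
    card F \<le> ((s + 1) * (2 ^ k + 1)) ^ Suc (card \<K>) * card F'"
  using assms
proof (induction \<K> arbitrary: F rule: finite_psubset_induct)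
  case (psubset \<K>)
  \<comment> \<open>The factor \<open>2 ^ k + 1\<close> is a pigeonhole over the peeled family and
    at most \<open>2 ^ k\<close> types; \<open>s + 1\<close> covers the loss in the popular
    choice.\<close>
  define M where "M = (s + 1) * (2 ^ k + 1)"
  have M1: "1 \<le> M" by (simp add: M_def)
  have "card \<K> \<le> card (Pow {..<k})"
    using psubset.prems(3) by (intro card_mono) auto
  then have cK: "card \<K> \<le> 2 ^ k" by (simp add: card_Pow)
  obtain F0 R where P: "F0 \<subseteq> F" "\<forall>e\<in>F0. \<forall>K\<in>\<K>. rich s F0 (pattern \<chi> K e)"
    "\<forall>K. R K \<subseteq> F \<and> (\<forall>g. \<exists>Z. finite Z \<and> card Z \<le> s \<and>
       (\<forall>e\<in>R K. pattern \<chi> K e = g \<longrightarrow> \<not> e \<inter> Z \<subseteq> g))"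
    "F \<subseteq> F0 \<union> (\<Union>K\<in>\<K>. R K)"
    using peel_non_rich[OF psubset.prems(1), of \<K> s \<chi>] by (elim exE conjE)
  have fR: "finite F0" "finite (R K)" for K
    using P(1,3) psubset.prems(1) by (meson finite_subset)+
  have "card F \<le> card (F0 \<union> (\<Union>K\<in>\<K>. R K))"
    using P(4) fR psubset.hyps by (intro card_mono) auto
  also have "\<dots> \<le> card F0 + (\<Sum>K\<in>\<K>. card (R K))"
    using card_Un_le[of F0 "\<Union>K\<in>\<K>. R K"] card_UN_le[OF psubset.hyps, of R] by linarith
  finally have total: "card F \<le> card F0 + (\<Sum>K\<in>\<K>. card (R K))" .
  show ?case
  proof (cases "card F \<le> (2 ^ k + 1) * card F0")
    case True
    have "homogeneous s k F0 \<chi> \<K>"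
      unfolding homogeneous_def using P(1,2) psubset.prems(2,3,4)
      by (intro conjI ballI impI) (simp_all add: subset_iff)
    moreover have "card F \<le> M ^ Suc (card \<K>) * card F0"
    proof -
      have "2 ^ k + 1 \<le> M" by (simp add: M_def)
      also have "M \<le> M ^ Suc (card \<K>)" using M1 by simp
      finally show ?thesis using True by (meson le_trans mult_le_mono1)
    qed
    ultimately show ?thesis using P(1) unfolding M_def by blast
  next
    case False
    have "\<exists>K\<in>\<K>. card F \<le> (2 ^ k + 1) * card (R K)"
    proof (rule ccontr)
      assume "\<not> ?thesis"
      then have less: "(2 ^ k + 1) * card (R K) < card F" if "K \<in> \<K>" for K
        using that by (auto simp: not_le)
      have pos: "card F > 0" using False by (metis gr0I le0)
      have "(2 ^ k + 1) * (\<Sum>K\<in>\<K>. card (R K)) \<le> card \<K> * card F"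
        unfolding sum_distrib_left using sum_bounded_above[of \<K> _ "card F"] less
        by (metis (no_types, lifting) less_imp_le of_nat_id)
      then have "(2 ^ k + 1) * (\<Sum>K\<in>\<K>. card (R K)) \<le> 2 ^ k * card F"
        using mult_le_mono1[OF cK, of "card F"] by linarith
      then have "(2 ^ k + 1) * card F0 + (2 ^ k + 1) * (\<Sum>K\<in>\<K>. card (R K)) < card F + 2 ^ k * card F"
        using False by linarith
      then have "(2 ^ k + 1) * (card F0 + (\<Sum>K\<in>\<K>. card (R K))) < card F + 2 ^ k * card F"
        by (simp add: distrib_left)
      also have "\<dots> = (2 ^ k + 1) * card F" by simp
      finally show False using total by (metis leD mult_le_mono2)
    qed
    then obtain K where K: "K \<in> \<K>" "card F \<le> (2 ^ k + 1) * card (R K)" by blast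
    obtain Z where Z: "\<And>g. finite (Z g)" "\<And>g. card (Z g) \<le> s"
      "\<And>g. \<forall>e\<in>R K. pattern \<chi> K e = g \<longrightarrow> \<not> e \<inter> Z g \<subseteq> g"
      using P(3) by metis
    have "\<exists>z\<in>Z (pattern \<chi> K e). z \<in> e - pattern \<chi> K e" if "e \<in> R K" for e
      using Z(3)[of "pattern \<chi> K e"] that by auto
    from popular_choice[of "R K" Z s "pattern \<chi> K" "\<lambda>z e. z \<in> e - pattern \<chi> K e", OF fR(2) Z(1,2) this]
    obtain z where z: "card (R K) \<le> s * card {e \<in> R K. z (pattern \<chi> K e) \<in> e - pattern \<chi> K e}"
      by blast
    define R' where "R' = {e \<in> R K. z (pattern \<chi> K e) \<in> e - pattern \<chi> K e}"
    have R'F: "R' \<subseteq> F" using P(3) by (auto simp: R'_def)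
    \<comment> \<open>Two edges that meet in type \<open>K\<close> have the same pattern
      \<open>g\<close>, namely their intersection. Both then contain \<open>z g\<close>, which lies
      outside \<open>g\<close>.\<close>
    have new: "\<chi> ` (e \<inter> f) \<in> \<K> - {K}" if ef: "e \<in> R'" "f \<in> R'" "e \<noteq> f" for e f
    proof -
      have "\<chi> ` (e \<inter> f) \<noteq> K"
      proof
        assume eq: "\<chi> ` (e \<inter> f) = K"
        have "pattern \<chi> K e = e \<inter> f"
          using pattern_image_Int[of \<chi> e "{..<k}" f] ef R'F psubset.prems(2) eq by auto
        moreover have "pattern \<chi> K f = e \<inter> f"
          using pattern_image_Int[of \<chi> f "{..<k}" e] ef R'F psubset.prems(2) eq
          by (auto simp: Int_commute)
        ultimately show False using ef by (auto simp: R'_def)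
      qed
      then show ?thesis using psubset.prems(4) ef R'F by auto
    qed
    have "\<K> - {K} \<subset> \<K>" using K by auto
    moreover have "finite R'" using R'F psubset.prems(1) finite_subset by blast
    moreover have "\<forall>e\<in>R'. bij_betw \<chi> e {..<k}" using R'F psubset.prems(2) by auto
    moreover have "\<forall>K\<in>\<K> - {K}. K \<subset> {..<k}" using psubset.prems(3) by simp
    moreover have "\<forall>e\<in>R'. \<forall>f\<in>R'. e \<noteq> f \<longrightarrow> \<chi> ` (e \<inter> f) \<in> \<K> - {K}" using new by simp
    ultimately obtain F' J where F': "F' \<subseteq> R'" "homogeneous s k F' \<chi> J"
      "card R' \<le> M ^ Suc (card (\<K> - {K})) * card F'"
      using psubset.IH[of "\<K> - {K}" R'] unfolding M_def by blast
    have c: "Suc (card (\<K> - {K})) = card \<K>"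
      using K psubset.hyps by (metis card_Suc_Diff1)
    have "card F \<le> (2 ^ k + 1) * (s * card R')"
      using K(2) z unfolding R'_def by (meson le_trans mult_le_mono2)
    also have "\<dots> \<le> M * card R'" by (simp add: M_def algebra_simps)
    also have "\<dots> \<le> M * (M ^ card \<K> * card F')" using F'(3) c by simp
    finally have "card F \<le> M ^ Suc (card \<K>) * card F'" by simp
    then show ?thesis using F'(1,2) R'F unfolding M_def by blast
  qed
qed

lemma homogeneous_subfamily:
  assumes "1 \<le> k"
  shows "\<exists>C. \<forall>(V :: 'a set) F. finite V \<longrightarrow> kgraph_on k V F \<longrightarrow>
    (\<exists>F'\<subseteq>F. \<exists>\<chi> J. homogeneous s k F' \<chi> J \<and> card F \<le> C * card F')"
proof (rule exI[of _ "k ^ k * ((s + 1) * (2 ^ k + 1)) ^ (2 ^ k + 1)"], intro allI impI)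
  fix V :: "'a set" and F assume V: "finite V" and F: "kgraph_on k V F"
  have fF: "finite F"
    by (rule rev_finite_subset[of "Pow V"]) (use V F in \<open>auto simp: kgraph_on_def\<close>)
  obtain \<chi> where \<chi>: "card F \<le> k ^ k * card {e \<in> F. bij_betw \<chi> e {..<k}}"
    using rainbow_colouring[OF V F assms] by blast
  define F1 where "F1 = {e \<in> F. bij_betw \<chi> e {..<k}}"
  define \<K> where "\<K> = {K. K \<subset> {..<k}}"
  have sub: "\<K> \<subseteq> Pow {..<k}" by (auto simp: \<K>_def)
  then have fK: "finite \<K>" by (rule finite_subset) simp
  have "card \<K> \<le> card (Pow {..<k})" using sub by (intro card_mono) auto
  then have cK: "Suc (card \<K>) \<le> 2 ^ k + 1" by (simp add: card_Pow)
  have int: "\<chi> ` (e \<inter> f) \<in> \<K>" if "e \<in> F1" "f \<in> F1" "e \<noteq> f" for e f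
  proof -
    have b: "bij_betw \<chi> e {..<k}" "bij_betw \<chi> f {..<k}" using that by (auto simp: F1_def)
    have "card e = k" "card f = k" "finite e" "finite f"
      using that F by (auto simp: F1_def kgraph_on_def)
    then have "\<not> e \<subseteq> f" using that(3) card_subset_eq[of f e] by auto
    then have "e \<inter> f \<subset> e" by blast
    moreover have "inj_on \<chi> e" "\<chi> ` e = {..<k}" using b by (auto simp: bij_betw_def)
    ultimately have "\<chi> ` (e \<inter> f) \<subset> {..<k}" using image_strict_mono[of \<chi> e "e \<inter> f"] by simp
    then show ?thesis by (simp add: \<K>_def)
  qed
  obtain F' J where F': "F' \<subseteq> F1" "homogeneous s k F' \<chi> J"
    "card F1 \<le> ((s + 1) * (2 ^ k + 1)) ^ Suc (card \<K>) * card F'"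
  proof -
    have "finite F1" "\<forall>e\<in>F1. bij_betw \<chi> e {..<k}" "\<forall>K\<in>\<K>. K \<subset> {..<k}"
      "\<forall>e\<in>F1. \<forall>f\<in>F1. e \<noteq> f \<longrightarrow> \<chi> ` (e \<inter> f) \<in> \<K>"
      using fF int by (simp_all add: F1_def \<K>_def)
    from homogeneous_subfamily_rainbow[OF fK this, of s] that show ?thesis by blast
  qed
  have "((s + 1) * (2 ^ k + 1)) ^ Suc (card \<K>) \<le> ((s + 1) * (2 ^ k + 1)) ^ (2 ^ k + 1)"
    using cK by (intro power_increasing) auto
  then have "card F1 \<le> ((s + 1) * (2 ^ k + 1)) ^ (2 ^ k + 1) * card F'"
    by (rule order_trans[OF F'(3) mult_le_mono1])
  then have "k ^ k * card F1 \<le> k ^ k * (((s + 1) * (2 ^ k + 1)) ^ (2 ^ k + 1) * card F')"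
    by (rule mult_le_mono2)
  then have "card F \<le> k ^ k * ((s + 1) * (2 ^ k + 1)) ^ (2 ^ k + 1) * card F'"
    using \<chi> unfolding F1_def[symmetric] mult.assoc by (rule order_trans[rotated])
  then show "\<exists>F'\<subseteq>F. \<exists>\<chi> J. homogeneous s k F' \<chi> J \<and>
      card F \<le> k ^ k * ((s + 1) * (2 ^ k + 1)) ^ (2 ^ k + 1) * card F'"
    using F' unfolding F1_def by blast
qed

text \<open>Two reroutings: \<open>f\<close> meets \<open>e\<close> exactly in the
  \<open>K\<close>-pattern, and \<open>g\<close> meets \<open>e \<union> f\<close> exactly in the
  \<open>L\<close>-pattern of \<open>e\<close>, so \<open>f \<inter> g\<close> has type
  \<open>K \<inter> L\<close>. The second one avoids up to \<open>2 * k\<close> vertices.\<close>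

lemma homogeneous_Int:
  assumes hom: "homogeneous s k F \<chi> J" and F: "kgraph_on k V F" "F \<noteq> {}"
    and s: "2 * k \<le> s" and K: "K \<in> J" "L \<in> J"
  shows "K \<inter> L \<in> J"
proof -
  obtain e where e: "e \<in> F" using F by blast
  have fin: "finite f" "card f = k" if "f \<in> F" for f using that F by (auto simp: kgraph_on_def)
  have b: "bij_betw \<chi> e {..<k}" and KL: "K \<subset> {..<k}" "L \<subset> {..<k}"
    using hom e K by (auto simp: homogeneous_def)
  have "rich s F (pattern \<chi> K e)" "rich s F (pattern \<chi> L e)"
    using hom e K by (auto simp: homogeneous_def)
  moreover have "card e \<le> s" using fin e s by auto
  ultimately obtain f where f: "f \<in> F" "pattern \<chi> K e \<subseteq> f" "f \<inter> e \<subseteq> pattern \<chi> K e"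
    using richD[of s F "pattern \<chi> K e" e] fin(1)[OF e] by auto
  have "card (e \<union> f) \<le> s" using card_Un_le[of e f] fin e f s by simp
  then obtain g where g: "g \<in> F" "pattern \<chi> L e \<subseteq> g" "g \<inter> (e \<union> f) \<subseteq> pattern \<chi> L e"
    using richD[OF \<open>rich s F (pattern \<chi> L e)\<close>, of "e \<union> f"] fin e f by auto
  have "f \<inter> g = pattern \<chi> (K \<inter> L) e"
    using f g by (auto simp: pattern_def)
  moreover have "\<chi> ` pattern \<chi> (K \<inter> L) e = K \<inter> L"
    using image_pattern[OF b, of "K \<inter> L"] KL by auto
  moreover have "f \<noteq> g"
  proof
    assume "f = g"
    then have "f = pattern \<chi> (K \<inter> L) e" using \<open>f \<inter> g = _\<close> by simp
    then have "card f = card (K \<inter> L)" using card_pattern[OF b, of "K \<inter> L"] KL by auto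
    moreover have "card (K \<inter> L) < card {..<k}" using KL by (intro psubset_card_mono) auto
    ultimately show False using fin f by simp
  qed
  moreover have "\<chi> ` (f \<inter> g) \<in> J" if "f \<noteq> g"
    using hom f(1) g(1) that by (simp add: homogeneous_def)
  ultimately show ?thesis by simp
qed

text \<open>With more edges than \<open>j\<close>-subsets of \<open>V\<close>, two edges share their
  \<open>P\<close>-pattern. This converts the size of \<open>F\<close> into large members of
  \<open>J\<close>.\<close>

lemma homogeneous_cover:
  assumes hom: "homogeneous s k F \<chi> J" and V: "finite V" and F: "kgraph_on k V F"
    and large: "card V choose j < card F" and P: "P \<subseteq> {..<k}" "card P = j"
  shows "\<exists>K\<in>J. P \<subseteq> K"
proof -
  have b: "bij_betw \<chi> e {..<k}" if "e \<in> F" for e using that hom by (auto simp: homogeneous_def)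
  have "pattern \<chi> P ` F \<subseteq> {B. B \<subseteq> V \<and> card B = j}"
    using card_pattern[OF b P(1)] P(2) F by (auto simp: pattern_def kgraph_on_def)
  then have "card (pattern \<chi> P ` F) \<le> card {B. B \<subseteq> V \<and> card B = j}"
    using V by (intro card_mono) auto
  also have "\<dots> < card F" using large V by (simp add: n_subsets)
  finally have "\<not> inj_on (pattern \<chi> P) F" by (rule pigeonhole)
  then obtain e f where ef: "e \<in> F" "f \<in> F" "e \<noteq> f" "pattern \<chi> P e = pattern \<chi> P f"
    by (auto simp: inj_on_def)
  then have "pattern \<chi> P e \<subseteq> e \<inter> f" by (auto simp: pattern_def)
  then have "P \<subseteq> \<chi> ` (e \<inter> f)" using image_pattern[OF b[OF ef(1)] P(1)] by blast
  moreover have "\<chi> ` (e \<inter> f) \<in> J" using hom ef(1-3) by (simp add: homogeneous_def)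
  ultimately show ?thesis by blast
qed

section \<open>Intersection-closed families of colour sets\<close>

text \<open>\<open>K\<close> is the intersection of the separating members, one for each
  \<open>y\<close> outside \<open>K\<close>; since \<open>K\<close> is proper, the intersection is
  over a nonempty family.\<close>

lemma Int_closed_criterion:
  assumes J: "\<And>K L. K \<in> J \<Longrightarrow> L \<in> J \<Longrightarrow> K \<inter> L \<in> J" and U: "finite U" and K: "K \<subset> U"
    and sep: "\<And>y. y \<in> U - K \<Longrightarrow> \<exists>A\<in>J. K \<subseteq> A \<and> A \<subseteq> U \<and> y \<notin> A"
  shows "K \<in> J"
proof -
  have fin: "finite \<A> \<Longrightarrow> \<A> \<noteq> {} \<Longrightarrow> \<A> \<subseteq> J \<Longrightarrow> \<Inter>\<A> \<in> J" for \<A>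
    by (induction \<A> rule: finite_ne_induct) (auto intro: J)
  obtain A where A: "\<And>y. y \<in> U - K \<Longrightarrow> A y \<in> J \<and> K \<subseteq> A y \<and> A y \<subseteq> U \<and> y \<notin> A y"
    using sep by metis
  have "\<Inter>(A ` (U - K)) \<in> J" using A U K by (intro fin) auto
  moreover have "\<Inter>(A ` (U - K)) = K"
  proof
    show "K \<subseteq> \<Inter>(A ` (U - K))" using A by auto
    show "\<Inter>(A ` (U - K)) \<subseteq> K"
    proof
      fix x assume x: "x \<in> \<Inter>(A ` (U - K))"
      obtain y where "y \<in> U - K" using K by auto
      then have "x \<in> U" using x A[of y] by auto
      then show "x \<in> K" using x A[of x] by auto
    qed
  qed
  ultimately show ?thesis by simp
qed

text \<open>Everything is governed by the set \<open>N\<close> of colours whose complement is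
  missing from \<open>J\<close>. For two colours of \<open>N\<close> the covering hypothesis forces
  the complement of the pair into \<open>J\<close>. Intersections then give every proper
  \<open>K\<close> with \<open>card (N - K) \<noteq> 1\<close>. If \<open>N\<close> has at most one
  element this contains a star, otherwise a triangle.\<close>

lemma star_or_triangle_pattern:
  assumes k: "5 \<le> k" and J: "\<And>K L. K \<in> J \<Longrightarrow> L \<in> J \<Longrightarrow> K \<inter> L \<in> J"
    and proper: "\<And>K. K \<in> J \<Longrightarrow> K \<subset> {..<k}"
    and cover: "\<And>P. P \<subseteq> {..<k} \<Longrightarrow> card P = k - 2 \<Longrightarrow> \<exists>K\<in>J. P \<subseteq> K"
  shows "(\<exists>u<k. \<forall>K. u \<in> K \<and> K \<subset> {..<k} \<longrightarrow> K \<in> J) \<or>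
    (\<exists>T\<subseteq>{..<k}. card T = 3 \<and> (\<forall>K\<subseteq>T. card K = 2 \<longrightarrow> K \<in> J))"
proof -
  let ?U = "{..<k}"
  define N where "N = {i \<in> ?U. ?U - {i} \<notin> J}"
  have pair: "?U - {u, w} \<in> J" if uw: "u \<in> N" "w \<in> N" "u \<noteq> w" for u w
  proof -
    have "card (?U - {u, w}) = k - 2" using uw by (auto simp: N_def card_Diff_subset)
    then obtain K where K: "K \<in> J" "?U - {u, w} \<subseteq> K" using cover[of "?U - {u, w}"] by auto
    have "K \<subset> ?U" using proper K by auto
    then have "K = ?U - {u, w} \<or> K = ?U - {u} \<or> K = ?U - {w}" using K(2) by blast
    then show ?thesis using K uw by (auto simp: N_def)
  qed
  have mem: "K \<in> J" if K: "K \<subset> ?U" "card (N - K) \<noteq> 1" for K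
  proof (rule Int_closed_criterion[OF J _ K(1)])
    fix y assume y: "y \<in> ?U - K"
    show "\<exists>A\<in>J. K \<subseteq> A \<and> A \<subseteq> ?U \<and> y \<notin> A"
    proof (cases "y \<in> N")
      case True
      have "N - K \<noteq> {y}" using K(2) by auto
      then obtain u where "u \<in> N - K" "u \<noteq> y" using True y by blast
      then show ?thesis using pair[of u y] True y K by (intro bexI[of _ "?U - {u, y}"]) auto
    next
      case False
      then show ?thesis using y K by (intro bexI[of _ "?U - {y}"]) (auto simp: N_def)
    qed
  qed auto
  have fN: "finite N" "N \<subseteq> ?U" by (auto simp: N_def)
  show ?thesis
  proof (cases "card N \<le> 1")
    case True
    then obtain u where u: "u < k" "N \<subseteq> {u}"
    proof (cases "N = {}")
      case True
      then show ?thesis using that[of 0] k by auto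
    next
      case False
      then have "card N = 1" using \<open>card N \<le> 1\<close> fN by (metis One_nat_def card_0_eq le_Suc_eq le_zero_eq)
      then obtain u where "N = {u}" by (auto simp: card_1_singleton_iff)
      then show ?thesis using that[of u] fN by auto
    qed
    have "K \<in> J" if "u \<in> K" "K \<subset> ?U" for K
    proof (rule mem[OF that(2)])
      have "N - K = {}" using u that by blast
      then show "card (N - K) \<noteq> 1" by (simp only: card.empty)
    qed
    then show ?thesis using u by blast
  next
    case False
    have cU: "card (?U - N) = k - card N" using fN by (simp add: card_Diff_subset)
    \<comment> \<open>The triple lies outside \<open>N\<close> if \<open>card N = 2\<close>, has one
      point in \<open>N\<close> if \<open>card N = 3\<close>, and lies inside \<open>N\<close>
      otherwise; removing a pair of it from \<open>N\<close> always leaves at least two elements.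
      The points outside \<open>N\<close> in the first two cases exist because \<open>k\<close> is
      at least 5.\<close>
    have "\<exists>T\<subseteq>?U. card T = 3 \<and> (\<forall>K\<subseteq>T. card K = 2 \<longrightarrow> card (N - K) \<noteq> 1)"
    proof -
      consider "card N = 2" | "card N = 3" | "4 \<le> card N" using False by linarith
      then show ?thesis
      proof cases
        case 1
        then have "3 \<le> card (?U - N)" using k cU by linarith
        then obtain T where T: "T \<subseteq> ?U - N" "card T = 3" by (metis obtain_subset_with_card_n)
        have "N - K = N" if "K \<subseteq> T" for K using that T by blast
        then show ?thesis using T 1 by (intro exI[of _ T]) auto
      next
        case 2
        then have "2 \<le> card (?U - N)" using k cU by linarith
        then obtain I where I: "I \<subseteq> ?U - N" "card I = 2" "finite I"
          by (metis obtain_subset_with_card_n)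
        obtain x where x: "x \<in> N" using 2 by fastforce
        have "card (insert x I) = 3" using I x by (subst card_insert_disjoint) auto
        moreover have "card (N - K) \<noteq> 1" if "K \<subseteq> insert x I" for K
        proof -
          have "N - {x} \<subseteq> N - K" using that I by blast
          then have "card (N - {x}) \<le> card (N - K)" using fN by (intro card_mono) auto
          then show ?thesis using 2 x fN by simp
        qed
        ultimately show ?thesis using I x fN by (intro exI[of _ "insert x I"]) auto
      next
        case 3
        then have "3 \<le> card N" by simp
        then obtain T where T: "T \<subseteq> N" "card T = 3" "finite T" by (metis obtain_subset_with_card_n)
        have "card (N - K) \<noteq> 1" if "K \<subseteq> T" "card K = 2" for K
        proof -
          have "finite K" using that T finite_subset by blast
          then have "card (N - K) = card N - 2" using that T by (subst card_Diff_subset) auto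
          then show ?thesis using 3 by simp
        qed
        then show ?thesis using T fN by blast
      qed
    qed
    then obtain T where T: "T \<subseteq> ?U" "card T = 3" "\<And>K. K \<subseteq> T \<Longrightarrow> card K = 2 \<Longrightarrow> card (N - K) \<noteq> 1"
      by blast
    have "K \<in> J" if "K \<subseteq> T" "card K = 2" for K
    proof (rule mem)
      have "card K < card ?U" using that k by simp
      then show "K \<subset> ?U" using that T by (metis order.trans psubsetI less_irrefl)
    qed (use T that in auto)
    then show ?thesis using T by blast
  qed
qed

text \<open>\<open>up v\<close> is the closure of \<open>v\<close>, the set of points common to all
  members through \<open>v\<close>. No singleton is in \<open>J\<close>, so no single point is
  closed. A minimal closure turns out to be a pair, all complements of other single points lie in
  \<open>J\<close>, and their intersections are the proper sets above the pair.\<close>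

lemma pair_star_pattern:
  assumes k: "5 \<le> k" and J: "\<And>K L. K \<in> J \<Longrightarrow> L \<in> J \<Longrightarrow> K \<inter> L \<in> J"
    and proper: "\<And>K. K \<in> J \<Longrightarrow> K \<subset> {..<k}" and single: "\<And>v. {v} \<notin> J"
    and cover: "\<And>P. P \<subseteq> {..<k} \<Longrightarrow> card P = k - 3 \<Longrightarrow> \<exists>K\<in>J. P \<subseteq> K"
  shows "\<exists>a<k. \<exists>b<k. a \<noteq> b \<and> (\<forall>K. {a, b} \<subseteq> K \<and> K \<subset> {..<k} \<longrightarrow> K \<in> J)"
proof -
  let ?U = "{..<k}"
  define up where "up v = {u \<in> ?U. \<forall>K\<in>J. v \<in> K \<longrightarrow> u \<in> K}" for v
  have fup: "finite (up v)" for v by (simp add: up_def)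
  have self: "v \<in> up v" if "v < k" for v using that by (simp add: up_def)
  have trans: "up u \<subseteq> up v" if "u \<in> up v" for u v using that by (auto simp: up_def)
  have next_up: "\<exists>u. u \<in> up v \<and> u \<noteq> v" if v: "v < k" for v
  proof (rule ccontr)
    assume no: "\<not> ?thesis"
    have "{v} \<in> J"
    proof (rule Int_closed_criterion[OF J, of ?U])
      show "{v} \<subset> ?U"
      proof -
        have "card {v} < card ?U" using k by simp
        moreover have "{v} \<subseteq> ?U" using v by simp
        ultimately show ?thesis by (metis order.strict_iff_order less_irrefl)
      qed
      fix y assume y: "y \<in> ?U - {v}"
      then have "y \<notin> up v" using no by auto
      then obtain K where "K \<in> J" "v \<in> K" "y \<notin> K" using y by (auto simp: up_def)
      then show "\<exists>A\<in>J. {v} \<subseteq> A \<and> A \<subseteq> ?U \<and> y \<notin> A" using proper[of K] by blast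
    qed auto
    then show False using single by blast
  qed
  have cov3: "\<exists>K\<in>J. ?U - {x, y, z} \<subseteq> K"
    if "x < k" "y < k" "z < k" "x \<noteq> y" "x \<noteq> z" "y \<noteq> z" for x y z
  proof -
    have "card (?U - {x, y, z}) = card ?U - card {x, y, z}"
      using that by (intro card_Diff_subset) auto
    also have "\<dots> = k - 3" using that by simp
    finally show ?thesis using cover[of "?U - {x, y, z}"] by auto
  qed
  have "0 < k" using k by simp
  then have "\<exists>a<k. \<forall>v. v < k \<longrightarrow> card (up a) \<le> card (up v)"
    by (rule ex_has_least_nat)
  then obtain a where a: "a < k" "\<And>v. v < k \<Longrightarrow> card (up a) \<le> card (up v)" by blast
  \<comment> \<open>By minimality all points of \<open>up a\<close> have the same closure, so a
    member of \<open>J\<close> contains either all of \<open>up a\<close> or none of it.\<close>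
  have up_eq: "up u = up a" if "u \<in> up a" for u
  proof -
    have "u < k" using that by (simp add: up_def)
    then show ?thesis using trans[OF that] a(2) fup by (metis card_seteq)
  qed
  have equivE: "x \<in> K \<longleftrightarrow> y \<in> K" if "x \<in> up a" "y \<in> up a" "K \<in> J" for x y K
    using up_eq[OF that(1)] up_eq[OF that(2)] that by (auto simp: up_def)
  have upk: "x < k" if "x \<in> up a" for x using that by (simp add: up_def)
  obtain b where b: "b \<in> up a" "b \<noteq> a" using next_up[OF a(1)] by blast
  note aa = self[OF a(1)]
  have bk: "b < k" using upk b by auto
  have up2: "up a = {a, b}"
  proof (rule ccontr)
    assume "up a \<noteq> {a, b}"
    then obtain c where c: "c \<in> up a" "c \<noteq> a" "c \<noteq> b" using aa b by blast
    have ck: "c < k" using upk c by auto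
    obtain K where K: "K \<in> J" "?U - {a, b, c} \<subseteq> K" using cov3[of a b c] a b c bk ck by auto
    have "\<exists>x\<in>{a, b, c}. x \<notin> K" using K proper[OF K(1)] by blast
    then have out: "x \<notin> K" if "x \<in> up a" for x
      using equivE[OF that aa K(1)] equivE[OF that b(1) K(1)] equivE[OF that c(1) K(1)] by auto
    have upabc: "up a = {a, b, c}" using out K(2) upk aa b(1) c(1) by blast
    have single_off: "?U - {v} \<in> J" if v: "v < k" "v \<notin> up a" for v
    proof -
      obtain L where L: "L \<in> J" "?U - {a, b, v} \<subseteq> L"
        using cov3[of a b v] a b v bk aa by auto
      have "c \<in> L" using L(2) ck c v by auto
      then have "a \<in> L" "b \<in> L" using equivE[OF aa c(1) L(1)] equivE[OF b(1) c(1) L(1)] by auto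
      then have "L = ?U - {v}" using L proper[OF L(1)] by blast
      then show ?thesis using L by simp
    qed
    have "card {a, b, c} < card ?U" using k by (simp add: card_insert_if)
    then have "\<not> ?U \<subseteq> {a, b, c}" using card_mono[of "{a, b, c}" ?U] by auto
    then obtain v where v: "v < k" "v \<notin> up a" using upabc by auto
    obtain u where u: "u \<in> up v" "u \<noteq> v" using next_up[OF v(1)] by blast
    have vu: "u \<in> L" if "L \<in> J" "v \<in> L" for L using u that by (auto simp: up_def)
    have uk: "u < k" using u by (simp add: up_def)
    show False
    proof (cases "u \<in> up a")
      case True
      have "v \<in> K" using K(2) v upabc by auto
      then show False using vu[OF K(1)] out[OF True] by blast
    next
      case False
      then show False using vu[OF single_off[OF uk False]] v(1) u(2) by auto
    qed
  qed
  have ab: "a \<in> K \<longleftrightarrow> b \<in> K" if "K \<in> J" for K using equivE[OF aa b(1) that] .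
  \<comment> \<open>If the complement of \<open>v\<close> were missing, each \<open>w\<close>
    outside \<open>{a, b, v}\<close> would have \<open>v\<close> as its only companion in
    \<open>up w\<close>. This puts the complements of all such points into \<open>J\<close>, and
    together with \<open>?U - {a, b}\<close> they intersect in \<open>{v}\<close>.\<close>
  have all: "?U - {v} \<in> J" if v: "v < k" "v \<noteq> a" "v \<noteq> b" for v
  proof (rule ccontr)
    assume nv: "?U - {v} \<notin> J"
    obtain K where K: "K \<in> J" "?U - {a, b, v} \<subseteq> K" using cov3[of a b v] a b bk v by auto
    have aK: "a \<notin> K" "b \<notin> K"
    proof -
      show "a \<notin> K"
      proof
        assume "a \<in> K"
        then have "K = ?U - {v}" using ab K proper[OF K(1)] by blast
        then show False using nv K by simp
      qed
      then show "b \<notin> K" using ab[OF K(1)] by simp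
    qed
    have key: "v \<in> up w \<and> (\<forall>x<k. x \<notin> {a, b, v, w} \<longrightarrow> ?U - {x} \<in> J)"
      if w: "w < k" "w \<notin> {a, b, v}" for w
    proof -
      obtain u where u: "u \<in> up w" "u \<noteq> w" using next_up[OF w(1)] by blast
      have wu: "u \<in> L" if "L \<in> J" "w \<in> L" for L using u that by (auto simp: up_def)
      have uk: "u < k" using u by (simp add: up_def)
      have "w \<in> K" using K(2) w by auto
      then have "u \<in> K" using wu K(1) by blast
      then have uab: "u \<noteq> a" "u \<noteq> b" using aK by auto
      have off: "?U - {x} \<in> J" if x: "x < k" "x \<notin> {a, b, u, w}" for x
      proof -
        obtain L where L: "L \<in> J" "?U - {a, u, x} \<subseteq> L"
          using cov3[of a u x] a uk x uab by auto
        have "b \<in> L" using L(2) bk b uab x by auto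
        then have aL: "a \<in> L" using ab[OF L(1)] by simp
        have "w \<in> L" using L(2) w u x by auto
        then have "u \<in> L" using wu[OF L(1)] by simp
        then have "L = ?U - {x}" using L aL proper[OF L(1)] by blast
        then show ?thesis using L by simp
      qed
      have "u = v" using off[OF v(1)] nv v w by auto
      then show ?thesis using u off by auto
    qed
    have "card {a, b, v} \<le> 3" by (simp add: card_insert_if)
    then have "card {a, b, v} < card ?U" using k by simp
    then have "\<not> ?U \<subseteq> {a, b, v}" using card_mono[of "{a, b, v}" ?U] by auto
    then obtain w where w: "w < k" "w \<notin> {a, b, v}" by auto
    have "card {a, b, v, w} \<le> 4" by (simp add: card_insert_if)
    then have "card {a, b, v, w} < card ?U" using k by simp
    then have "\<not> ?U \<subseteq> {a, b, v, w}" using card_mono[of "{a, b, v, w}" ?U] by auto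
    then obtain w' where w': "w' < k" "w' \<notin> {a, b, v, w}" by auto
    \<comment> \<open>A point \<open>w\<close> yields the complements of the other points but not
      its own, so a second point \<open>w'\<close> is used for that one; it exists because there are
      at least five colours.\<close>
    have sing: "?U - {x} \<in> J" if x: "x < k" "x \<notin> {a, b, v}" for x
    proof (cases "x = w")
      case True
      then show ?thesis using key[of w'] w' w by auto
    next
      case False
      then show ?thesis using key[OF w] x by auto
    qed
    have "v \<in> K" using key[OF w] K w by (auto simp: up_def)
    then have "K = ?U - {a, b}" using K(2) aK proper[OF K(1)] by auto
    have "{v} \<in> J"
    proof (rule Int_closed_criterion[OF J, of ?U])
      have "a \<in> ?U - {v}" using a(1) v(2) by simp
      then show "{v} \<subset> ?U" using v(1) by blast
      fix y assume y: "y \<in> ?U - {v}"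
      show "\<exists>A\<in>J. {v} \<subseteq> A \<and> A \<subseteq> ?U \<and> y \<notin> A"
      proof (cases "y = a \<or> y = b")
        case True
        then show ?thesis using K \<open>K = _\<close> \<open>v \<in> K\<close> aK by (intro bexI[of _ K]) auto
      next
        case False
        then show ?thesis using sing[of y] y v by (intro bexI[of _ "?U - {y}"]) auto
      qed
    qed auto
    then show False using single by blast
  qed
  have "K \<in> J" if K: "{a, b} \<subseteq> K" "K \<subset> ?U" for K
  proof (rule Int_closed_criterion[OF J, of ?U])
    fix y assume y: "y \<in> ?U - K"
    then show "\<exists>A\<in>J. K \<subseteq> A \<and> A \<subseteq> ?U \<and> y \<notin> A"
      using all[of y] K by (intro bexI[of _ "?U - {y}"]) auto
  qed (use K in auto)
  then show ?thesis using a(1) bk b(2) by blast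
qed

subsection \<open>Centres of edges\<close>

lemma kgraph_on_subset: "kgraph_on k V H \<Longrightarrow> F \<subseteq> H \<Longrightarrow> kgraph_on k V F"
  by (auto simp: kgraph_on_def)

lemma kgraph_on_finite: "finite V \<Longrightarrow> kgraph_on k V H \<Longrightarrow> finite H"
  by (rule rev_finite_subset[of "Pow V"]) (auto simp: kgraph_on_def)

definition centre :: "nat \<Rightarrow> 'a set set \<Rightarrow> 'a set \<Rightarrow> 'a \<Rightarrow> bool" where
  "centre s H e c \<longleftrightarrow> c \<in> e \<and> (\<forall>K. c \<in> K \<and> K \<subseteq> e \<longrightarrow> rich s H K)"

text \<open>Two vertices of one edge with distinct colours in \<open>T\<close> form a rich pair, and
  an edge chosen anew through this pair supplies a fresh vertex of the third colour. This is a
  relation in which every pair extends to triangles.\<close>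

lemma linear_cycle_of_triangle_pattern:
  assumes H: "kgraph_on k V H" and F: "F \<subseteq> H" "F \<noteq> {}" and hom: "homogeneous s k F \<chi> J"
    and l: "3 \<le> l" and s: "2 * k * l \<le> s" and k: "1 \<le> k"
    and T: "T \<subseteq> {..<k}" "card T = 3" "\<And>K. K \<subseteq> T \<Longrightarrow> card K = 2 \<Longrightarrow> K \<in> J"
  shows "\<exists>C\<subseteq>H. linear_cycle k l C"
proof -
  define P where "P x y \<longleftrightarrow> (\<exists>e\<in>F. x \<in> e \<and> y \<in> e \<and> \<chi> x \<in> T \<and> \<chi> y \<in> T \<and> \<chi> x \<noteq> \<chi> y)" for x y
  have bij: "bij_betw \<chi> e {..<k}" if "e \<in> F" for e using that hom by (auto simp: homogeneous_def)
  have surj: "\<exists>z\<in>e. \<chi> z = c" if "e \<in> F" "c \<in> T" for e c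
  proof -
    have "c \<in> \<chi> ` e" using bij[OF that(1)] that(2) T(1) by (auto simp: bij_betw_def)
    then show ?thesis by auto
  qed
  have rich2: "rich s F {x, y}" if "e \<in> F" "x \<in> e" "y \<in> e" "\<chi> x \<in> T" "\<chi> y \<in> T" "\<chi> x \<noteq> \<chi> y" for x y e
  proof -
    have "{\<chi> x, \<chi> y} \<in> J" using that by (intro T(3)) auto
    then have "rich s F (pattern \<chi> {\<chi> x, \<chi> y} e)" using hom that by (auto simp: homogeneous_def)
    moreover have "pattern \<chi> {\<chi> x, \<chi> y} e = {x, y}"
      using bij_betw_imp_inj_on[OF bij[OF that(1)]] that by (auto simp: pattern_def dest: inj_onD)
    ultimately show ?thesis by simp
  qed
  have ls: "l \<le> s" using s k by (metis le_trans mult.assoc mult_le_mono1 mult_1 mult.commute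
        nat_mult_1_right one_le_numeral)
  obtain a b c where abc: "T = {a, b, c}" "a \<noteq> b" "b \<noteq> c" "a \<noteq> c"
    using T(2) by (metis card_3_iff)
  obtain e where e: "e \<in> F" using F by blast
  obtain x y where xy: "x \<in> e" "\<chi> x = a" "y \<in> e" "\<chi> y = b" using surj[OF e] abc by blast
  show ?thesis
  proof (rule linear_cycle_of_triangle_relation[OF H l s, of P])
    show "P x y" using e xy abc by (auto simp: P_def)
    show "P u v \<Longrightarrow> P v u" for u v by (auto simp: P_def)
    show "u \<noteq> v \<and> rich s H {u, v}" if "P u v" for u v
      using that rich2 rich_mono[OF _ F(1)] unfolding P_def by blast
    fix u v Z assume uv: "P u v" and Z: "finite (Z :: 'a set)" "card Z \<le> l"
    then obtain f where f: "f \<in> F" "u \<in> f" "v \<in> f" "\<chi> u \<in> T" "\<chi> v \<in> T" "\<chi> u \<noteq> \<chi> v"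
      by (auto simp: P_def)
    obtain g where g: "g \<in> F" "{u, v} \<subseteq> g" "g \<inter> Z \<subseteq> {u, v}"
      using richD[OF rich2[OF f] Z(1)] Z(2) ls by auto
    obtain c where c: "c \<in> T" "c \<noteq> \<chi> u" "c \<noteq> \<chi> v" using abc by auto
    obtain z where z: "z \<in> g" "\<chi> z = c" using surj[OF g(1) c(1)] by blast
    have "z \<notin> Z" using z g c by auto
    moreover have "P u z" "P z v" using g z c f by (auto simp: P_def)
    ultimately show "\<exists>z. z \<notin> Z \<and> P u z \<and> P z v" by blast
  qed
qed

text \<open>Homogeneity is applied to the edges without a centre. A star pattern there would give
  them a centre, as richness in a subfamily passes to \<open>H\<close>, and a triangle pattern would
  give a cycle. So the homogeneous part has at most \<open>n choose (k - 2)\<close> edges.\<close>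

lemma few_edges_without_centre:
  assumes k: "5 \<le> k" and l: "3 \<le> l" and s: "2 * k * l \<le> s"
  shows "\<exists>C. \<forall>(V :: 'a set) H. finite V \<longrightarrow> kgraph_on k V H \<longrightarrow>
    \<not> (\<exists>C\<subseteq>H. linear_cycle k l C) \<longrightarrow>
    card {e \<in> H. \<not> (\<exists>c. centre s H e c)} \<le> C * card V ^ (k - 2)"
proof -
  obtain C where C: "\<forall>(V :: 'a set) F. finite V \<longrightarrow> kgraph_on k V F \<longrightarrow>
    (\<exists>F'\<subseteq>F. \<exists>\<chi> J. homogeneous s k F' \<chi> J \<and> card F \<le> C * card F')"
    using homogeneous_subfamily[of k s] k by auto
  show ?thesis
  proof (rule exI[of _ C], intro allI impI)
    fix V :: "'a set" and H
    assume V: "finite V" and H: "kgraph_on k V H" and free: "\<not> (\<exists>C\<subseteq>H. linear_cycle k l C)"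
    define B where "B = {e \<in> H. \<not> (\<exists>c. centre s H e c)}"
    have BH: "B \<subseteq> H" by (auto simp: B_def)
    obtain F \<chi> J where F: "F \<subseteq> B" "homogeneous s k F \<chi> J" "card B \<le> C * card F"
      using C V kgraph_on_subset[OF H BH] by meson
    have FV: "kgraph_on k V F" using H F(1) BH by (meson kgraph_on_subset)
    have "card F \<le> card V choose (k - 2)"
    proof (rule ccontr)
      assume "\<not> ?thesis"
      then have large: "card V choose (k - 2) < card F" by simp
      then have ne: "F \<noteq> {}" by auto
      have "2 * k * 1 \<le> 2 * k * l" using l by (intro mult_le_mono2) simp
      then have "2 * k \<le> s" using s by linarith
      then have clo: "K \<inter> L \<in> J" if "K \<in> J" "L \<in> J" for K L
        using homogeneous_Int[OF F(2) FV ne] that by blast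
      have proper: "K \<subset> {..<k}" if "K \<in> J" for K using F(2) that by (simp add: homogeneous_def)
      have cover: "\<exists>K\<in>J. P \<subseteq> K" if "P \<subseteq> {..<k}" "card P = k - 2" for P
        using homogeneous_cover[OF F(2) V FV large that] .
      have "(\<exists>u<k. \<forall>K. u \<in> K \<and> K \<subset> {..<k} \<longrightarrow> K \<in> J) \<or>
          (\<exists>T\<subseteq>{..<k}. card T = 3 \<and> (\<forall>K\<subseteq>T. card K = 2 \<longrightarrow> K \<in> J))"
        by (rule star_or_triangle_pattern[OF k]) (fact clo proper cover)+
      then show False
      proof (elim disjE exE conjE)
        fix u assume u: "u < k" "\<forall>K. u \<in> K \<and> K \<subset> {..<k} \<longrightarrow> K \<in> J"
        obtain e where e: "e \<in> F" using ne by blast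
        then have b: "bij_betw \<chi> e {..<k}" using F(2) by (simp add: homogeneous_def)
        then have "u \<in> \<chi> ` e" using u(1) by (simp add: bij_betw_def)
        then obtain c where c: "c \<in> e" "\<chi> c = u" by auto
        have "rich s H K" if K: "c \<in> K" "K \<subseteq> e" for K
        proof (cases "K = e")
          case True
          then show ?thesis using e F(1) BH by (intro rich_member) auto
        next
          case False
          have "\<chi> ` K \<subset> \<chi> ` e" using b False K(2)
            by (intro image_strict_mono) (auto simp: bij_betw_def)
          then have "\<chi> ` K \<in> J" using u(2) K(1) c b by (auto simp: bij_betw_def)
          then have "rich s F (pattern \<chi> (\<chi> ` K) e)" using F(2) e by (auto simp: homogeneous_def)
          moreover have "pattern \<chi> (\<chi> ` K) e = K"
            using pattern_image_Int[OF b, of K] K(2) by (simp add: Int_absorb1)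
          ultimately show ?thesis using rich_mono[of s F K H] F(1) BH by auto
        qed
        then have "centre s H e c" using c by (simp add: centre_def)
        then show False using e F(1) by (auto simp: B_def)
      next
        fix T assume T: "T \<subseteq> {..<k}" "card T = 3" "\<forall>K\<subseteq>T. card K = 2 \<longrightarrow> K \<in> J"
        have "\<exists>C\<subseteq>H. linear_cycle k l C"
          by (rule linear_cycle_of_triangle_pattern[OF H _ ne F(2) l s _ T(1,2)])
            (use F(1) BH k T in auto)
        then show False using free by blast
      qed
    qed
    also have "\<dots> \<le> card V ^ (k - 2)" by (rule binomial_le_power)
    finally have "C * card F \<le> C * card V ^ (k - 2)" by (rule mult_le_mono2)
    then show "card {e \<in> H. \<not> (\<exists>c. centre s H e c)} \<le> C * card V ^ (k - 2)"
      using F(3) unfolding B_def by linarith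
  qed
qed

section \<open>Bounding exceptional vertices by averaging\<close>

lemma exists_sparse_subset:
  assumes V: "finite V" "b \<le> card V" and Q: "Q \<subseteq> {f. f \<subseteq> V \<and> card f = r}"
  shows "\<exists>B\<subseteq>V. card B = b \<and> (card V choose b) * card {f \<in> Q. B \<subseteq> f} \<le> (r choose b) * card Q"
proof (rule ccontr)
  assume no: "\<not> ?thesis"
  define I where "I = {B. B \<subseteq> V \<and> card B = b}"
  have cI: "card I = card V choose b" using V by (simp add: I_def n_subsets)
  have fI: "finite I" using V by (simp add: I_def)
  have fQ: "finite Q" by (rule finite_subset[OF Q]) (use V in simp)
  have "I \<noteq> {}" using cI V by (metis card.empty less_irrefl zero_less_binomial_iff)
  have less: "(r choose b) * card Q < (card V choose b) * card {f \<in> Q. B \<subseteq> f}" if "B \<in> I" for B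
    using no that by (auto simp: I_def not_le)
  have "(card V choose b) * ((r choose b) * card Q) = (\<Sum>B\<in>I. (r choose b) * card Q)"
    by (simp add: cI)
  also have "\<dots> < (\<Sum>B\<in>I. (card V choose b) * card {f \<in> Q. B \<subseteq> f})"
    using \<open>I \<noteq> {}\<close> fI less by (intro sum_strict_mono) auto
  also have "\<dots> = (card V choose b) * (\<Sum>B\<in>I. card {f \<in> Q. B \<subseteq> f})"
    by (simp add: sum_distrib_left)
  also have "(\<Sum>B\<in>I. card {f \<in> Q. B \<subseteq> f}) = (\<Sum>f\<in>Q. r choose b)"
  proof (rule sum_multicount_gen[OF fI fQ], rule ballI)
    fix f assume "f \<in> Q"
    then have f: "f \<subseteq> V" "card f = r" using Q by auto
    then have "{B \<in> I. B \<subseteq> f} = {B. B \<subseteq> f \<and> card B = b}" by (auto simp: I_def)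
    moreover have "finite f" using f V finite_subset by blast
    ultimately show "card {B \<in> I. B \<subseteq> f} = r choose b" using f by (simp add: n_subsets)
  qed
  finally show False by simp
qed

text \<open>Only sets that meet \<open>D\<close> in exactly one point are counted, since these
  determine that point and the remainder.\<close>

lemma card_sets_meeting:
  assumes V: "finite V" and B: "B \<subseteq> V" and D: "D \<subseteq> V - B" "finite D" and r: "card B < r"
  shows "card D * ((card V - card B - card D) choose (r - card B - 1))
    \<le> card {f. B \<subseteq> f \<and> f \<subseteq> V \<and> card f = r \<and> f \<inter> D \<noteq> {}}"
proof -
  let ?X = "{h. h \<subseteq> V - B - D \<and> card h = r - card B - 1}"
  let ?E = "{f. B \<subseteq> f \<and> f \<subseteq> V \<and> card f = r \<and> f \<inter> D \<noteq> {}}"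
  let ?\<phi> = "\<lambda>(x, h). insert x (B \<union> h)"
  have fB: "finite B" using V B finite_subset by blast
  have fh: "finite h" if "h \<subseteq> V - B - D" for h using that V by (meson finite_Diff finite_subset)
  have "card (D \<times> ?X) \<le> card ?E"
  proof (rule card_inj_on_le[of ?\<phi>])
    show "inj_on ?\<phi> (D \<times> ?X)"
    proof (rule inj_onI, clarify)
      fix x h y g assume xy: "x \<in> D" "y \<in> D" and hg: "h \<subseteq> V - B - D" "g \<subseteq> V - B - D"
        and eq: "insert x (B \<union> h) = insert y (B \<union> g)"
      have "insert x (B \<union> h) \<inter> D = {x}" "insert y (B \<union> g) \<inter> D = {y}" using xy hg D(1) by auto
      then have "x = y" using eq by auto
      moreover have "h = insert x (B \<union> h) - B - D" "g = insert y (B \<union> g) - B - D"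
        using xy hg D(1) by auto
      ultimately show "x = y \<and> h = g" using eq by auto
    qed
    show "?\<phi> ` (D \<times> ?X) \<subseteq> ?E"
    proof clarify
      fix x h assume x: "x \<in> D" and h: "h \<subseteq> V - B - D" "card h = r - card B - 1"
      have "card (B \<union> h) = card B + card h" using h fB fh by (intro card_Un_disjoint) auto
      moreover have "x \<notin> B \<union> h" using x h D by auto
      ultimately have "card (insert x (B \<union> h)) = r" using h r fB fh by simp
      then show "B \<subseteq> insert x (B \<union> h) \<and> insert x (B \<union> h) \<subseteq> V \<and>
          card (insert x (B \<union> h)) = r \<and> insert x (B \<union> h) \<inter> D \<noteq> {}"
        using x h B D by auto
    qed
    show "finite ?E" by (rule rev_finite_subset[of "Pow V"]) (use V in auto)
  qed
  moreover have "card ?X = card (V - B - D) choose (r - card B - 1)"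
    using V by (simp add: n_subsets)
  moreover have "card (V - B - D) = card V - card B - card D"
    using D B fB V by (simp add: card_Diff_subset)
  ultimately show ?thesis by (simp add: card_cartesian_product)
qed

text \<open>On average a \<open>b\<close>-set lies in O(n^(r-1-b)) members of \<open>Q\<close>. For
  a \<open>B\<close> that attains this, every vertex of \<open>D\<close> forces a number of members
  of the same order, so \<open>D\<close> is bounded independently of \<open>V\<close>.\<close>

lemma sparse_exceptions:
  assumes br: "b < r"
  shows "\<exists>n0 d. \<forall>(V :: 'a set) Q. finite V \<longrightarrow> n0 \<le> card V \<longrightarrow>
    Q \<subseteq> {f. f \<subseteq> V \<and> card f = r} \<longrightarrow> card Q \<le> C * card V ^ (r - 1) \<longrightarrow>
    (\<exists>B\<subseteq>V. card B = b \<and> (\<exists>f. f \<notin> Q \<and> B \<subseteq> f \<and> f \<subseteq> V \<and> card f = r) \<and>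
      (\<forall>D\<subseteq>V - B. (\<forall>f. B \<subseteq> f \<and> f \<subseteq> V \<and> card f = r \<and> f \<inter> D \<noteq> {} \<longrightarrow> f \<in> Q) \<longrightarrow> card D \<le> d))"
proof -
  define j where "j = r - 1 - b"
  define C' where "C' = (2 * b) ^ b * ((r choose b) * C)"
  define d where "d = C' * (2 * j) ^ j"
  define n0 where "n0 = 2 * (b + d + 1) + j + 1 + b"
  show ?thesis
  proof (rule exI[of _ n0], rule exI[of _ d], intro allI impI)
    fix V :: "'a set" and Q
    assume V: "finite V" and n: "n0 \<le> card V" and Q: "Q \<subseteq> {f. f \<subseteq> V \<and> card f = r}"
      and cQ: "card Q \<le> C * card V ^ (r - 1)"
    define n where "n = card V"
    have bn: "b \<le> card V" using n by (simp add: n0_def)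
    have fQ: "finite Q" by (rule finite_subset[OF Q]) (use V in simp)
    obtain B where B: "B \<subseteq> V" "card B = b"
      "(n choose b) * card {f \<in> Q. B \<subseteq> f} \<le> (r choose b) * card Q"
      using exists_sparse_subset[OF V bn Q] unfolding n_def by blast
    define q where "q = card {f \<in> Q. B \<subseteq> f}"
    have "n ^ b * q \<le> (2 * b) ^ b * (n choose b) * q"
      using power_le_binomial_shift[of 0 n b] bn unfolding n_def by (intro mult_le_mono1) simp
    also have "\<dots> \<le> (2 * b) ^ b * ((r choose b) * card Q)"
      using mult_le_mono2[OF B(3), of "(2 * b) ^ b"] by (simp only: q_def mult.assoc)
    also have "\<dots> \<le> (2 * b) ^ b * ((r choose b) * (C * n ^ (r - 1)))"
      using cQ unfolding n_def by (intro mult_le_mono2)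
    also have "\<dots> = n ^ b * (C' * n ^ j)"
    proof -
      have "r - 1 = b + j" using br by (simp add: j_def)
      then show ?thesis by (simp add: C'_def power_add mult_ac)
    qed
    finally have "n ^ b * q \<le> n ^ b * (C' * n ^ j)" .
    moreover have "0 < n" using n by (simp add: n_def n0_def)
    ultimately have q: "q \<le> C' * n ^ j" by simp
    have bound: "card D \<le> d"
      if D: "D \<subseteq> V - B" "\<forall>f. B \<subseteq> f \<and> f \<subseteq> V \<and> card f = r \<and> f \<inter> D \<noteq> {} \<longrightarrow> f \<in> Q" for D
    proof (rule ccontr)
      assume "\<not> card D \<le> d"
      then have "d + 1 \<le> card D" by simp
      \<comment> \<open>Cutting \<open>D\<close> down to \<open>d + 1\<close> vertices makes the
        binomial below independent of \<open>card D\<close>, so that \<open>n0\<close> can be fixed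
        in advance.\<close>
      then obtain D' where D': "D' \<subseteq> D" "card D' = d + 1" "finite D'"
        by (metis obtain_subset_with_card_n)
      define m where "m = (n - (b + d + 1)) choose j"
      have "(d + 1) * m \<le> card {f. B \<subseteq> f \<and> f \<subseteq> V \<and> card f = r \<and> f \<inter> D' \<noteq> {}}"
        using card_sets_meeting[OF V B(1), of D' r] D D' B br
        by (auto simp: m_def n_def j_def algebra_simps)
      also have "\<dots> \<le> q"
        unfolding q_def using fQ D' D(2) by (intro card_mono) auto
      also have "\<dots> \<le> C' * ((2 * j) ^ j * m)"
      proof -
        have "n ^ j \<le> (2 * j) ^ j * m"
          unfolding m_def using n by (intro power_le_binomial_shift) (auto simp: n0_def n_def)
        then show ?thesis using q by (meson le_trans mult_le_mono2)
      qed
      finally have "(d + 1) * m \<le> d * m" by (simp add: d_def mult.assoc)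
      moreover have "0 < m" unfolding m_def using n by (simp add: n0_def n_def)
      ultimately show False by simp
    qed
    \<comment> \<open>Otherwise the bound just proved would apply to all of \<open>V - B\<close>,
      which has more than \<open>d\<close> elements.\<close>
    have "\<exists>f. f \<notin> Q \<and> B \<subseteq> f \<and> f \<subseteq> V \<and> card f = r"
    proof (rule ccontr)
      assume "\<not> ?thesis"
      then have "card (V - B) \<le> d" by (intro bound) auto
      moreover have "card (V - B) = n - b"
        using B(2) card_Diff_subset[OF finite_subset[OF B(1) V] B(1)] by (simp add: n_def)
      ultimately show False using n by (simp add: n0_def n_def)
    qed
    then show "\<exists>B\<subseteq>V. card B = b \<and> (\<exists>f. f \<notin> Q \<and> B \<subseteq> f \<and> f \<subseteq> V \<and> card f = r) \<and>
      (\<forall>D\<subseteq>V - B. (\<forall>f. B \<subseteq> f \<and> f \<subseteq> V \<and> card f = r \<and> f \<inter> D \<noteq> {} \<longrightarrow> f \<in> Q) \<longrightarrow> card D \<le> d)"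
      using B bound by (intro exI[of _ B]) simp
  qed
qed

section \<open>A core of \<open>t\<close> centres\<close>

definition centres :: "nat \<Rightarrow> 'a set set \<Rightarrow> 'a set \<Rightarrow> 'a set" where
  "centres s H f = {c. c \<notin> f \<and> insert c f \<in> H \<and> centre s H (insert c f) c}"

lemma centres_rich_nbs: "c \<in> centres s H f \<Longrightarrow> f \<subseteq> rich_nbs s H c"
  by (auto simp: centres_def centre_def rich_nbs_def)

text \<open>A centre \<open>c\<close> outside \<open>S\<close> closes the alternating path: by
  \<open>{c, x, x'}\<close> for odd length, by \<open>{c, x}\<close> and \<open>{c, x'}\<close>,
  which meet in \<open>c\<close>, for even length.\<close>

lemma cycle_of_linked_set_and_centre:
  assumes H: "kgraph_on k V H" and S: "finite S" "card S = t" "1 \<le> t"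
    and linked: "linked (2 * k + 2 * t + 2) s H S" and s: "2 * k * (2 * t + 2) \<le> s"
    and x: "x \<in> (\<Inter>c\<in>S. rich_nbs s H c)" "x' \<in> (\<Inter>c\<in>S. rich_nbs s H c)" "x \<noteq> x'"
    and c: "c \<in> centres s H f" "c \<notin> S" "x \<in> f" "x' \<in> f"
    and l: "l = 2 * t + 1 \<or> l = 2 * t + 2"
  shows "\<exists>C\<subseteq>H. linear_cycle k l C"
proof -
  have r: "rich s H K" if "c \<in> K" "K \<subseteq> insert c f" for K
    using c(1) that by (auto simp: centres_def centre_def)
  have cx: "c \<noteq> x" "c \<noteq> x'" using c by (auto simp: centres_def)
  have xS: "x \<notin> S" "x' \<notin> S" using x by (auto simp: rich_nbs_def)
  from l show ?thesis
  proof
    assume l: "l = 2 * t + 1"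
    show ?thesis unfolding l
    proof (rule odd_cycle_of_linked_set[OF H S linked _ _ x, of "{c, x, x'}"])
      show "2 * k * (2 * t + 1) \<le> s" using s by (simp add: algebra_simps)
    qed (use r c xS in auto)
  next
    assume l: "l = 2 * t + 2"
    show ?thesis unfolding l
      by (rule even_cycle_of_linked_set[OF H S linked _ s x(1,2), of "{c, x}" "{c, x'}" c])
        (use r c xS cx x(3) in auto)
  qed
qed

lemma core_set:
  assumes k: "5 \<le> k" and t: "1 \<le> t" and l: "l = 2 * t + 1 \<or> l = 2 * t + 2"
    and s: "s = 2 * k * (2 * t + 2)"
  shows "\<exists>n0 d. \<forall>(V :: 'a set) H. finite V \<longrightarrow> n0 \<le> card V \<longrightarrow> kgraph_on k V H \<longrightarrow>
    \<not> (\<exists>C\<subseteq>H. linear_cycle k l C) \<longrightarrow>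
    t * (card V choose (k - 1)) \<le> card H + t * t * card V ^ (k - 2) \<longrightarrow>
    (\<exists>S\<subseteq>V. card S = t \<and> linked (2 * k + 2 * t + 2) s H S \<and>
      card (V - S - (\<Inter>c\<in>S. rich_nbs s H c)) \<le> d)"
proof -
  define r where "r = 2 * k + 2 * t + 2"
  have l3: "3 \<le> l" using l t by auto
  have sl: "2 * k * l \<le> s" using l unfolding s by auto
  obtain C1 where C1: "\<forall>(V :: 'a set) H. finite V \<longrightarrow> kgraph_on k V H \<longrightarrow>
    \<not> (\<exists>C\<subseteq>H. linear_cycle k l C) \<longrightarrow>
    card {e \<in> H. \<not> (\<exists>c. centre s H e c)} \<le> C1 * card V ^ (k - 2)"
    using few_edges_without_centre[OF k l3 sl] by blast
  \<comment> \<open>The summands are the three errors: the lower order terms of the star, the edges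
    without a centre, and the (k-1)-sets whose centres are not linked.\<close>
  define C where "C = t * t + C1 + 2 ^ r"
  have "2 < k - 1" using k by simp
  from sparse_exceptions[OF this, of C] obtain n1 d where sparse:
    "\<forall>(V :: 'a set) Q. finite V \<longrightarrow> n1 \<le> card V \<longrightarrow>
    Q \<subseteq> {f. f \<subseteq> V \<and> card f = k - 1} \<longrightarrow> card Q \<le> C * card V ^ (k - 1 - 1) \<longrightarrow>
    (\<exists>B\<subseteq>V. card B = 2 \<and> (\<exists>f. f \<notin> Q \<and> B \<subseteq> f \<and> f \<subseteq> V \<and> card f = k - 1) \<and>
      (\<forall>D\<subseteq>V - B. (\<forall>f. B \<subseteq> f \<and> f \<subseteq> V \<and> card f = k - 1 \<and> f \<inter> D \<noteq> {} \<longrightarrow> f \<in> Q)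
        \<longrightarrow> card D \<le> d))"
    by (elim exE)
  show ?thesis
  proof (rule exI[of _ "n1 + 1"], rule exI[of _ d], intro allI impI)
    fix V :: "'a set" and H
    assume V: "finite V" and n1: "n1 + 1 \<le> card V" and H: "kgraph_on k V H"
      and free: "\<not> (\<exists>C\<subseteq>H. linear_cycle k l C)"
      and large: "t * (card V choose (k - 1)) \<le> card H + t * t * card V ^ (k - 2)"
    define n where "n = card V"
    define A where "A = {f. f \<subseteq> V \<and> card f = k - 1}"
    have fA: "finite A" and cA: "card A = n choose (k - 1)"
      using V by (auto simp: A_def n_def n_subsets)
    have nbV: "rich_nbs s H c \<subseteq> V" for c
      using rich_finite[OF H] by (auto simp: rich_nbs_def)
    have cenV: "centres s H f \<subseteq> V" for f using H by (auto simp: centres_def kgraph_on_def)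
    have cenfin: "finite (centres s H f)" "card (centres s H f) \<le> n" for f
      using finite_subset[OF cenV V] card_mono[OF V cenV] by (auto simp: n_def)
    have no_extra: "c \<in> S" if S: "finite S" "card S = t" "linked r s H S"
      and x: "x \<in> (\<Inter>c\<in>S. rich_nbs s H c)" "x' \<in> (\<Inter>c\<in>S. rich_nbs s H c)" "x \<noteq> x'"
      and c: "c \<in> centres s H f" "x \<in> f" "x' \<in> f" for S x x' c f
      using cycle_of_linked_set_and_centre[OF H S(1,2) t _ _ x c(1) _ c(2,3) l] S(3) free s
      unfolding r_def by blast
    \<comment> \<open>A bad \<open>f\<close> is contained in the common neighbourhood of two of its
      centres, and that neighbourhood has fewer than \<open>r\<close> vertices. So each of
      \<open>n * n\<close> pairs accounts for at most \<open>2 ^ r\<close> bad sets.\<close>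
    define bad where "bad = {f \<in> A. \<not> linked r s H (centres s H f)}"
    have cbad: "card bad \<le> n * n * 2 ^ r"
    proof -
      define X where "X = {(c, c') \<in> V \<times> V. card (rich_nbs s H c \<inter> rich_nbs s H c') < r}"
      have fX: "finite X" by (rule rev_finite_subset[of "V \<times> V"]) (use V in \<open>auto simp: X_def\<close>)
      have cX: "card X \<le> n * n"
        using card_mono[of "V \<times> V" X] V by (auto simp: X_def n_def card_cartesian_product)
      let ?P = "\<lambda>(c, c'). Pow (rich_nbs s H c \<inter> rich_nbs s H c')"
      have fin: "finite (rich_nbs s H c \<inter> rich_nbs s H c')" for c c'
        using nbV V by (meson finite_Int finite_subset)
      have "bad \<subseteq> (\<Union>p\<in>X. ?P p)"
      proof
        fix f assume "f \<in> bad"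
        then obtain c c' where c: "c \<in> centres s H f" "c' \<in> centres s H f"
          "card (rich_nbs s H c \<inter> rich_nbs s H c') < r"
          by (auto simp: bad_def linked_def not_le)
        then have "(c, c') \<in> X" using cenV by (auto simp: X_def)
        moreover have "f \<in> ?P (c, c')" using centres_rich_nbs[OF c(1)] centres_rich_nbs[OF c(2)] by auto
        ultimately show "f \<in> (\<Union>p\<in>X. ?P p)" by blast
      qed
      then have "card bad \<le> card (\<Union>p\<in>X. ?P p)"
        using fX fin by (intro card_mono) (auto simp del: Pow_Int_eq)
      also have "\<dots> \<le> (\<Sum>p\<in>X. card (?P p))" using fX by (rule card_UN_le)
      also have "\<dots> \<le> (\<Sum>p\<in>X. 2 ^ r)"
      proof (rule sum_mono)
        fix p assume "p \<in> X"
        then obtain c c' where "p = (c, c')" "card (rich_nbs s H c \<inter> rich_nbs s H c') < r"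
          by (auto simp: X_def)
        then show "card (?P p) \<le> 2 ^ r" using fin
            by (simp add: card_Pow power_increasing del: Pow_Int_eq)
      qed
      also have "\<dots> \<le> n * n * 2 ^ r" using cX by simp
      finally show ?thesis .
    qed
    have cen_le: "card (centres s H f) \<le> t" if f: "f \<in> A" "f \<notin> bad" for f
    proof (rule ccontr)
      assume more: "\<not> ?thesis"
      then have "t \<le> card (centres s H f)" by simp
      then obtain S where S: "S \<subseteq> centres s H f" "card S = t" "finite S"
        by (metis obtain_subset_with_card_n)
      then have "S \<noteq> centres s H f" using more by auto
      then obtain c where c: "c \<in> centres s H f" "c \<notin> S" using S(1) by blast
      have lin: "linked r s H S" using f S(1) by (auto simp: bad_def linked_def)
      have "2 \<le> card f" using f k by (simp add: A_def)
      then obtain x x' where x: "x \<in> f" "x' \<in> f" "x \<noteq> x'"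
        by (metis obtain_subset_with_card_n card_2_iff insert_subset)
      have "f \<subseteq> (\<Inter>c\<in>S. rich_nbs s H c)"
        using S(1) by (intro INT_greatest centres_rich_nbs) auto
      then show False using no_extra[OF S(3,2) lin _ _ x(3) c(1) x(1,2)] x(1,2) c(2) by (meson subsetD)
    qed
    define Q where "Q = {f \<in> A. f \<in> bad \<or> card (centres s H f) \<noteq> t}"
    have cQ: "card Q \<le> C * n ^ (k - 2)"
    proof -
      define G where "G = {e \<in> H. \<exists>c. centre s H e c}"
      have fH: "finite H" using kgraph_on_finite[OF V H] .
      have "card H = card G + card {e \<in> H. \<not> (\<exists>c. centre s H e c)}"
        unfolding G_def using fH by (subst card_Un_disjoint[symmetric]) (auto intro!: arg_cong[where f = card])
      then have HG: "card H \<le> card G + C1 * n ^ (k - 2)"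
        using C1 V H free unfolding n_def by fastforce
      have "G \<subseteq> (\<lambda>(f, c). insert c f) ` (SIGMA f:A. centres s H f)"
      proof
        fix e assume "e \<in> G"
        then obtain c where c: "e \<in> H" "centre s H e c" by (auto simp: G_def)
        then have ce: "c \<in> e" by (simp add: centre_def)
        have "e \<subseteq> V" "card e = k" "finite e" using c(1) H by (auto simp: kgraph_on_def)
        then have "e - {c} \<in> A" using ce by (auto simp: A_def)
        moreover have "c \<in> centres s H (e - {c})" using c ce by (simp add: centres_def insert_absorb)
        moreover have "e = insert c (e - {c})" using ce by auto
        ultimately show "e \<in> (\<lambda>(f, c). insert c f) ` (SIGMA f:A. centres s H f)"
          by (intro image_eqI[of _ _ "(e - {c}, c)"]) auto
      qed
      then have "card G \<le> card ((\<lambda>(f, c). insert c f) ` (SIGMA f:A. centres s H f))"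
        using fA cenfin by (intro card_mono) auto
      also have "\<dots> \<le> card (SIGMA f:A. centres s H f)"
        using fA cenfin by (intro card_image_le) auto
      also have "\<dots> = (\<Sum>f\<in>A. card (centres s H f))" using fA cenfin by (intro card_SigmaI) auto
      finally have G: "card G \<le> (\<Sum>f\<in>A. card (centres s H f))" .
      have split: "(\<Sum>f\<in>A. card (centres s H f))
          \<le> (\<Sum>f\<in>A. (if f \<in> bad then 0 else card (centres s H f))) + n * card bad"
      proof -
        have "(\<Sum>f\<in>A. card (centres s H f))
            \<le> (\<Sum>f\<in>A. (if f \<in> bad then 0 else card (centres s H f)) + (if f \<in> bad then n else 0))"
          using cenfin by (intro sum_mono) auto
        also have "\<dots> = (\<Sum>f\<in>A. (if f \<in> bad then 0 else card (centres s H f)))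
            + (\<Sum>f\<in>A. (if f \<in> bad then n else 0))" by (rule sum.distrib)
        also have "(\<Sum>f\<in>A. (if f \<in> bad then n else 0)) = n * card bad"
        proof -
          have "(\<Sum>f\<in>A. (if f \<in> bad then n else 0)) = (\<Sum>f\<in>A \<inter> bad. n)"
            using fA by (subst sum.inter_restrict) auto
          also have "A \<inter> bad = bad" by (auto simp: bad_def)
          finally show ?thesis by simp
        qed
        finally show ?thesis .
      qed
      \<comment> \<open>A bad set contributes 0 and 1, which fits because \<open>t\<close> is
        positive; any other member of \<open>Q\<close> has fewer than \<open>t\<close> centres and
        leaves room for its 1.\<close>
      have "(\<Sum>f\<in>A. (if f \<in> bad then 0 else card (centres s H f)) + (if f \<in> Q then 1 else 0))
          \<le> (\<Sum>f\<in>A. t)"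
      proof (rule sum_mono)
        fix f assume "f \<in> A"
        then show "(if f \<in> bad then 0 else card (centres s H f)) + (if f \<in> Q then 1 else 0) \<le> t"
          using cen_le[of f] t by (auto simp: Q_def)
      qed
      moreover have "(\<Sum>f\<in>A. (if f \<in> Q then 1 else 0 :: nat)) = card Q"
      proof -
        have "(\<Sum>f\<in>A. (if f \<in> Q then 1 else 0 :: nat)) = (\<Sum>f\<in>A \<inter> Q. 1)"
          using fA by (subst sum.inter_restrict) auto
        also have "A \<inter> Q = Q" by (auto simp: Q_def)
        finally show ?thesis by simp
      qed
      ultimately have up: "(\<Sum>f\<in>A. (if f \<in> bad then 0 else card (centres s H f))) + card Q
          \<le> t * (n choose (k - 1))" by (simp add: sum.distrib cA mult.commute)
      have "n * card bad \<le> n * (n * n * 2 ^ r)" using cbad by (rule mult_le_mono2)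
      also have "\<dots> = 2 ^ r * n ^ 3" by (simp add: power3_eq_cube)
      \<comment> \<open>Quadratically many bad sets with up to \<open>n\<close> centres each give a
        cubic error, which is affordable because \<open>k - 2\<close> is at least 3.\<close>
      also have "\<dots> \<le> 2 ^ r * n ^ (k - 2)"
        using k n1 by (intro mult_le_mono2 power_increasing) (auto simp: n_def)
      finally have nb: "n * card bad \<le> 2 ^ r * n ^ (k - 2)" .
      have "C * n ^ (k - 2) = t * t * n ^ (k - 2) + C1 * n ^ (k - 2) + 2 ^ r * n ^ (k - 2)"
        by (simp add: C_def distrib_right)
      then show ?thesis
        using HG G split up nb large unfolding n_def[symmetric] by linarith
    qed
    have QA: "Q \<subseteq> {f. f \<subseteq> V \<and> card f = k - 1}" by (auto simp: Q_def A_def)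
    have cQ': "card Q \<le> C * card V ^ (k - 1 - 1)" using cQ by (simp add: n_def numeral_2_eq_2)
    have "n1 \<le> card V" using n1 by simp
    from sparse[rule_format, OF V this QA cQ'] obtain B f0 where B: "B \<subseteq> V" "card B = 2"
      and f0: "f0 \<notin> Q" "B \<subseteq> f0" "f0 \<subseteq> V" "card f0 = k - 1" and only_Q:
      "\<forall>D\<subseteq>V - B. (\<forall>f. B \<subseteq> f \<and> f \<subseteq> V \<and> card f = k - 1 \<and> f \<inter> D \<noteq> {} \<longrightarrow> f \<in> Q) \<longrightarrow> card D \<le> d"
      by (elim exE conjE)
    \<comment> \<open>The core is read off from one unexceptional \<open>f0\<close> above
      \<open>B\<close>. Any other unexceptional set above \<open>B\<close> shares the two vertices
      of \<open>B\<close> with \<open>f0\<close>, so its \<open>t\<close> centres lie in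
      \<open>S\<close> and therefore are \<open>S\<close>.\<close>
    define S where "S = centres s H f0"
    define W where "W = (\<Inter>c\<in>S. rich_nbs s H c)"
    have S: "finite S" "card S = t" "linked r s H S"
      using f0 cenfin by (auto simp: S_def Q_def bad_def A_def)
    have f0W: "f0 \<subseteq> W" unfolding W_def S_def by (intro INT_greatest centres_rich_nbs)
    obtain x x' where x: "B = {x, x'}" "x \<noteq> x'" using B(2) by (metis card_2_iff)
    have "card (V - S - W) \<le> d"
    proof (rule only_Q[rule_format])
      show "V - S - W \<subseteq> V - B" using f0 f0W by blast
      fix f assume f: "B \<subseteq> f \<and> f \<subseteq> V \<and> card f = k - 1 \<and> f \<inter> (V - S - W) \<noteq> {}"
      show "f \<in> Q"
      proof (rule ccontr)
        assume "f \<notin> Q"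
        then have c: "card (centres s H f) = t" using f by (auto simp: Q_def A_def)
        have "centres s H f \<subseteq> S"
        proof
          fix c assume "c \<in> centres s H f"
          then show "c \<in> S"
            using no_extra[OF S, of x x' c f] x f f0 f0W unfolding W_def by blast
        qed
        then have "centres s H f = S" using c S by (simp add: card_subset_eq)
        then have "f \<subseteq> W" unfolding W_def by (intro INT_greatest centres_rich_nbs) auto
        then show False using f by blast
      qed
    qed
    then show "\<exists>S\<subseteq>V. card S = t \<and> linked (2 * k + 2 * t + 2) s H S \<and>
        card (V - S - (\<Inter>c\<in>S. rich_nbs s H c)) \<le> d"
      using S cenV unfolding W_def r_def S_def by blast
  qed
qed

subsection \<open>Families without singleton intersections\<close>

text \<open>Extend \<open>K\<close> to an edge \<open>e\<close> that avoids the rest of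
  \<open>L\<close>, and \<open>L\<close> to an edge \<open>f\<close> that avoids the rest of
  \<open>e\<close>; then \<open>e \<inter> f = K \<inter> L\<close>. The forbidden intersection size
  thus passes from edges to rich sets.\<close>

lemma rich_Int_not_single:
  assumes G: "kgraph_on k V G" and ns: "\<And>A B. A \<in> G \<Longrightarrow> B \<in> G \<Longrightarrow> card (A \<inter> B) \<noteq> 1"
    and s: "k \<le> s" and K: "rich s G K" and L: "rich s G L"
  shows "card (K \<inter> L) \<noteq> 1"
proof -
  have "finite L" "card L \<le> s" using rich_finite[OF G L] s by auto
  then obtain e where e: "e \<in> G" "K \<subseteq> e" "e \<inter> L \<subseteq> K" using richD[OF K] by blast
  have "finite e" "card e \<le> s" using e(1) G s by (auto simp: kgraph_on_def)
  then obtain f where f: "f \<in> G" "L \<subseteq> f" "f \<inter> e \<subseteq> L" using richD[OF L] by blast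
  have "e \<inter> f = K \<inter> L" using e f by auto
  then show ?thesis using ns[OF e(1) f(1)] by simp
qed

definition pair_centre :: "nat \<Rightarrow> 'a set set \<Rightarrow> 'a set \<Rightarrow> 'a set \<Rightarrow> bool" where
  "pair_centre s G e p \<longleftrightarrow> p \<subseteq> e \<and> card p = 2 \<and> (\<forall>K. p \<subseteq> K \<and> K \<subseteq> e \<longrightarrow> rich s G K)"

text \<open>\<open>J\<close> contains no singleton, because a rich singleton would meet itself in
  one point. With (k-3)-sets covered, the pair-star pattern remains, and it provides a pair
  centre.\<close>

lemma few_edges_without_pair_centre:
  assumes k: "5 \<le> k" and s: "2 * k \<le> s"
  shows "\<exists>C. \<forall>(V :: 'a set) G. finite V \<longrightarrow> kgraph_on k V G \<longrightarrow>
    (\<forall>A\<in>G. \<forall>B\<in>G. card (A \<inter> B) \<noteq> 1) \<longrightarrow>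
    card {e \<in> G. \<not> (\<exists>p. pair_centre s G e p)} \<le> C * card V ^ (k - 3)"
proof -
  obtain C where C: "\<forall>(V :: 'a set) F. finite V \<longrightarrow> kgraph_on k V F \<longrightarrow>
    (\<exists>F'\<subseteq>F. \<exists>\<chi> J. homogeneous s k F' \<chi> J \<and> card F \<le> C * card F')"
    using homogeneous_subfamily[of k s] k by auto
  show ?thesis
  proof (rule exI[of _ C], intro allI impI)
    fix V :: "'a set" and G
    assume V: "finite V" and G: "kgraph_on k V G" and ns: "\<forall>A\<in>G. \<forall>B\<in>G. card (A \<inter> B) \<noteq> 1"
    define B where "B = {e \<in> G. \<not> (\<exists>p. pair_centre s G e p)}"
    have BG: "B \<subseteq> G" by (auto simp: B_def)
    obtain F \<chi> J where F: "F \<subseteq> B" "homogeneous s k F \<chi> J" "card B \<le> C * card F"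
      using C V kgraph_on_subset[OF G BG] by meson
    have FV: "kgraph_on k V F" using G F(1) BG by (meson kgraph_on_subset)
    have "card F \<le> card V choose (k - 3)"
    proof (rule ccontr)
      assume "\<not> ?thesis"
      then have large: "card V choose (k - 3) < card F" by simp
      then have ne: "F \<noteq> {}" by auto
      obtain e where e: "e \<in> F" using ne by blast
      have b: "bij_betw \<chi> e {..<k}" using F(2) e by (simp add: homogeneous_def)
      have clo: "K \<inter> L \<in> J" if "K \<in> J" "L \<in> J" for K L
        using homogeneous_Int[OF F(2) FV ne s that] .
      have proper: "K \<subset> {..<k}" if "K \<in> J" for K using F(2) that by (simp add: homogeneous_def)
      have richF: "rich s G (pattern \<chi> K e)" if "K \<in> J" for K
        using F e BG that rich_mono[of s F _ G] by (auto simp: homogeneous_def)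
      have single: "{v} \<notin> J" for v
      proof
        assume v: "{v} \<in> J"
        have "card (pattern \<chi> {v} e) = 1" using card_pattern[OF b, of "{v}"] proper[OF v] by auto
        then show False
          using rich_Int_not_single[OF G _ _ richF[OF v] richF[OF v]] ns s by simp
      qed
      have cover: "\<exists>K\<in>J. P \<subseteq> K" if "P \<subseteq> {..<k}" "card P = k - 3" for P
        using homogeneous_cover[OF F(2) V FV large that] .
      have "\<exists>a<k. \<exists>b<k. a \<noteq> b \<and> (\<forall>K. {a, b} \<subseteq> K \<and> K \<subset> {..<k} \<longrightarrow> K \<in> J)"
        by (rule pair_star_pattern[OF k]) (fact clo proper single cover)+
      then obtain u w where uw: "u < k" "w < k" "u \<noteq> w"
        "\<forall>K. {u, w} \<subseteq> K \<and> K \<subset> {..<k} \<longrightarrow> K \<in> J" by (elim exE conjE)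
      define p where "p = pattern \<chi> {u, w} e"
      have p: "p \<subseteq> e" "card p = 2" "\<chi> ` p = {u, w}"
        using card_pattern[OF b, of "{u, w}"] image_pattern[OF b, of "{u, w}"] uw
        by (auto simp: p_def pattern_def)
      have "rich s G K" if K: "p \<subseteq> K" "K \<subseteq> e" for K
      proof (cases "K = e")
        case True
        then show ?thesis using e F(1) BG by (intro rich_member) auto
      next
        case False
        have "\<chi> ` K \<subset> \<chi> ` e" using b False K(2)
          by (intro image_strict_mono) (auto simp: bij_betw_def)
        moreover have "{u, w} \<subseteq> \<chi> ` K" using image_mono[OF K(1), of \<chi>] p(3) by simp
        ultimately have "\<chi> ` K \<in> J" using uw(4) b by (simp add: bij_betw_def)
        then have "rich s G (pattern \<chi> (\<chi> ` K) e)" by (rule richF)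
        moreover have "pattern \<chi> (\<chi> ` K) e = K"
          using pattern_image_Int[OF b, of K] K(2) by (simp add: Int_absorb1)
        ultimately show ?thesis by simp
      qed
      then have "pair_centre s G e p" using p by (simp add: pair_centre_def)
      then show False using e F(1) by (auto simp: B_def)
    qed
    also have "\<dots> \<le> card V ^ (k - 3)" by (rule binomial_le_power)
    finally have "C * card F \<le> C * card V ^ (k - 3)" by (rule mult_le_mono2)
    then show "card {e \<in> G. \<not> (\<exists>p. pair_centre s G e p)} \<le> C * card V ^ (k - 3)"
      using F(3) unfolding B_def by linarith
  qed
qed

definition pair_centres :: "nat \<Rightarrow> 'a set set \<Rightarrow> 'a set \<Rightarrow> 'a set set" where
  "pair_centres s G f = {p. p \<inter> f = {} \<and> p \<union> f \<in> G \<and> pair_centre s G (p \<union> f) p}"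

text \<open>Frankl's theorem on families without singleton intersections, with uniqueness. A
  nonempty set has at most one pair of centres, so a family this large gives a pair to nearly every
  (k-2)-set, and (k-2)-sets that share one vertex already agree on it.\<close>

lemma no_singleton_intersection_extremal:
  assumes k: "5 \<le> k"
  shows "\<exists>n0. \<forall>(V :: 'a set) G. finite V \<longrightarrow> n0 \<le> card V \<longrightarrow> kgraph_on k V G \<longrightarrow>
    (\<forall>A\<in>G. \<forall>B\<in>G. card (A \<inter> B) \<noteq> 1) \<longrightarrow> (card V - 2) choose (k - 2) \<le> card G \<longrightarrow>
    (\<exists>x\<in>V. \<exists>y\<in>V. x \<noteq> y \<and> G = {A. A \<subseteq> V \<and> card A = k \<and> x \<in> A \<and> y \<in> A})"
proof -
  define s where "s = 2 * k"
  obtain C1 where C1: "\<forall>(V :: 'a set) G. finite V \<longrightarrow> kgraph_on k V G \<longrightarrow>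
    (\<forall>A\<in>G. \<forall>B\<in>G. card (A \<inter> B) \<noteq> 1) \<longrightarrow>
    card {e \<in> G. \<not> (\<exists>p. pair_centre s G e p)} \<le> C1 * card V ^ (k - 3)"
    using few_edges_without_pair_centre[OF k, of s] unfolding s_def by blast
  \<comment> \<open>The summand 2 pays for the difference between \<open>n choose (k - 2)\<close>
    and \<open>(n - 2) choose (k - 2)\<close>, which is at most
    \<open>2 * n ^ (k - 3)\<close>.\<close>
  define C where "C = C1 + 2"
  have "1 < k - 2" using k by simp
  from sparse_exceptions[OF this, of C] obtain n1 d where sparse:
    "\<forall>(V :: 'a set) Q. finite V \<longrightarrow> n1 \<le> card V \<longrightarrow>
    Q \<subseteq> {f. f \<subseteq> V \<and> card f = k - 2} \<longrightarrow> card Q \<le> C * card V ^ (k - 2 - 1) \<longrightarrow>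
    (\<exists>B\<subseteq>V. card B = 1 \<and> (\<exists>f. f \<notin> Q \<and> B \<subseteq> f \<and> f \<subseteq> V \<and> card f = k - 2) \<and>
      (\<forall>D\<subseteq>V - B. (\<forall>f. B \<subseteq> f \<and> f \<subseteq> V \<and> card f = k - 2 \<and> f \<inter> D \<noteq> {} \<longrightarrow> f \<in> Q)
        \<longrightarrow> card D \<le> d))"
    by (elim exE)
  define M where "M = (2 * (k - 3)) ^ (k - 3) * (s + 2 ^ d)"
  show ?thesis
  proof (rule exI[of _ "n1 + M + k + 6"], intro allI impI)
    fix V :: "'a set" and G
    assume V: "finite V" and n0: "n1 + M + k + 6 \<le> card V" and G: "kgraph_on k V G"
      and ns: "\<forall>A\<in>G. \<forall>B\<in>G. card (A \<inter> B) \<noteq> 1" and large: "(card V - 2) choose (k - 2) \<le> card G"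
    define n where "n = card V"
    have fG: "finite G" using kgraph_on_finite[OF V G] .
    have rich_Int: "card (K \<inter> L) \<noteq> 1" if "rich s G K" "rich s G L" for K L
      by (rule rich_Int_not_single[OF G _ _ that]) (use ns in \<open>auto simp: s_def\<close>)
    define A where "A = {f. f \<subseteq> V \<and> card f = k - 2}"
    have fA: "finite A" and cA: "card A = n choose (k - 2)"
      using V by (auto simp: A_def n_def n_subsets)
    have pcr: "rich s G K" if "p \<in> pair_centres s G f" "p \<subseteq> K" "K \<subseteq> p \<union> f" for p f K
      using that by (auto simp: pair_centres_def pair_centre_def)
    \<comment> \<open>Distinct pairs are disjoint, since a single common vertex is forbidden; adding
      \<open>x\<close> to both then produces an intersection of size one.\<close>
    have same: "p = q" if p: "p \<in> pair_centres s G f" and q: "q \<in> pair_centres s G g"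
      and x: "x \<in> f" "x \<in> g" for p q f g x
    proof (rule ccontr)
      assume "p \<noteq> q"
      have c: "card p = 2" "card q = 2" using p q by (auto simp: pair_centres_def pair_centre_def)
      then have fin: "finite p" "finite q" by (metis card.infinite zero_neq_numeral)+
      have "card (p \<inter> q) \<noteq> 1" using pcr[OF p, of p] pcr[OF q, of q] rich_Int by simp
      moreover have "card (p \<inter> q) < 2"
      proof -
        have "\<not> p \<subseteq> q" using \<open>p \<noteq> q\<close> c fin card_subset_eq[of q p] by auto
        then have "p \<inter> q \<subset> p" by blast
        then show ?thesis using psubset_card_mono[OF fin(1), of "p \<inter> q"] c by simp
      qed
      ultimately have "card (p \<inter> q) = 0" by linarith
      then have "p \<inter> q = {}" using fin by simp
      moreover have "x \<notin> p" "x \<notin> q" using p q x by (auto simp: pair_centres_def)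
      ultimately have "card (insert x p \<inter> insert x q) = 1" by simp
      moreover have "rich s G (insert x p)" "rich s G (insert x q)"
        using x by (auto intro: pcr[OF p] pcr[OF q])
      ultimately show False using rich_Int[of "insert x p" "insert x q"] by simp
    qed
    define Q where "Q = {f \<in> A. pair_centres s G f = {}}"
    have QA: "Q \<subseteq> {f. f \<subseteq> V \<and> card f = k - 2}" by (auto simp: Q_def A_def)
    have cQ: "card Q \<le> C * card V ^ (k - 2 - 1)"
    proof -
      define E where "E = {e \<in> G. \<exists>p. pair_centre s G e p}"
      have "card G = card E + card {e \<in> G. \<not> (\<exists>p. pair_centre s G e p)}"
        unfolding E_def using fG by (subst card_Un_disjoint[symmetric]) (auto intro!: arg_cong[where f = card])
      then have GE: "card G \<le> card E + C1 * n ^ (k - 3)"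
        using C1 V G ns unfolding n_def by fastforce
      define the_pair where "the_pair f = (SOME p. p \<in> pair_centres s G f)" for f
      have "E \<subseteq> (\<lambda>f. the_pair f \<union> f) ` (A - Q)"
      proof
        fix e assume "e \<in> E"
        then obtain p where p: "e \<in> G" "pair_centre s G e p" by (auto simp: E_def)
        then have pe: "p \<subseteq> e" "card p = 2" by (auto simp: pair_centre_def)
        have e: "e \<subseteq> V" "card e = k" "finite e" using p(1) G by (auto simp: kgraph_on_def)
        have "p \<union> (e - p) = e" using pe by auto
        then have pc: "p \<in> pair_centres s G (e - p)" using p by (auto simp: pair_centres_def)
        have "finite p" using pe e finite_subset by blast
        then have ce: "card (e - p) = k - 2" using pe e by (simp add: card_Diff_subset)
        have eA: "e - p \<in> A - Q" using pc e ce by (auto simp: A_def Q_def)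
        have "the_pair (e - p) \<in> pair_centres s G (e - p)"
          unfolding the_pair_def using pc by (rule someI)
        moreover have "e - p \<noteq> {}"
        proof
          assume "e - p = {}"
          then have "card (e - p) = 0" by (simp only: card.empty)
          then show False using ce k by linarith
        qed
        then obtain x where "x \<in> e - p" by blast
        ultimately have "the_pair (e - p) = p" using same[OF _ pc] by metis
        then show "e \<in> (\<lambda>f. the_pair f \<union> f) ` (A - Q)"
          using eA pe by (intro image_eqI[of _ _ "e - p"]) auto
      qed
      then have "card E \<le> card (A - Q)" using fA by (intro surj_card_le) auto
      also have "\<dots> = card A - card Q" using fA by (intro card_Diff_subset) (auto simp: Q_def)
      finally have "card E + card Q \<le> n choose (k - 2)"
        using card_mono[OF fA, of Q] cA by (auto simp: Q_def)
      moreover have "n choose (k - 2) \<le> (n - 2 choose (k - 2)) + 2 * (n choose (k - 3))"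
      proof -
        have "k - 2 = Suc (k - 3)" using k by simp
        then show ?thesis using binomial_shift_upper[of n "k - 3" 2] by simp
      qed
      moreover have "n choose (k - 3) \<le> n ^ (k - 3)" by (rule binomial_le_power)
      moreover have "C * n ^ (k - 3) = C1 * n ^ (k - 3) + 2 * n ^ (k - 3)"
        by (simp add: C_def distrib_right)
      ultimately have "card Q \<le> C * n ^ (k - 3)" using GE large unfolding n_def by linarith
      moreover have "k - 2 - 1 = k - 3" by simp
      ultimately show ?thesis by (simp only: n_def)
    qed
    have "n1 \<le> card V" using n0 by simp
    from sparse[rule_format, OF V this QA cQ] obtain B f0 where B: "B \<subseteq> V" "card B = 1"
      and f0: "f0 \<notin> Q" "B \<subseteq> f0" "f0 \<subseteq> V" "card f0 = k - 2" and only_Q: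
      "\<forall>D\<subseteq>V - B. (\<forall>f. B \<subseteq> f \<and> f \<subseteq> V \<and> card f = k - 2 \<and> f \<inter> D \<noteq> {} \<longrightarrow> f \<in> Q) \<longrightarrow> card D \<le> d"
      by (elim exE conjE)
    obtain x where x: "B = {x}" using B(2) by (auto simp: card_1_singleton_iff)
    obtain p where p: "p \<in> pair_centres s G f0" using f0 by (auto simp: Q_def A_def)
    have cp: "card p = 2" using p by (auto simp: pair_centres_def pair_centre_def)
    then have fp: "finite p" by (metis card.infinite zero_neq_numeral)
    have pV: "p \<subseteq> V" using p G by (auto simp: pair_centres_def kgraph_on_def)
    define W where "W = {y. y \<notin> p \<and> rich s G (insert y p)}"
    define D where "D = V - p - W"
    have inW: "f \<subseteq> W" if "p \<in> pair_centres s G f" for f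
    proof
      fix y assume "y \<in> f"
      then show "y \<in> W" using that pcr[OF that, of "insert y p"] by (auto simp: W_def pair_centres_def)
    qed
    have cD: "card D \<le> d"
    proof (rule only_Q[rule_format])
      show "D \<subseteq> V - B" using inW[OF p] f0 by (auto simp: D_def)
      fix f assume f: "B \<subseteq> f \<and> f \<subseteq> V \<and> card f = k - 2 \<and> f \<inter> D \<noteq> {}"
      show "f \<in> Q"
      proof (rule ccontr)
        assume "f \<notin> Q"
        then obtain q where q: "q \<in> pair_centres s G f" using f by (auto simp: Q_def A_def)
        have "q = p" by (rule same[OF q p, of x]) (use x f f0 in auto)
        then have "f \<subseteq> W" using inW q by simp
        then show False using f by (auto simp: D_def)
      qed
    qed
    have fD: "finite D" using V by (simp add: D_def)
    \<comment> \<open>An edge meets \<open>p\<close> in zero or two vertices. If it is disjoint from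
      \<open>p\<close>, a vertex \<open>y\<close> of \<open>W\<close> on it would be its whole
      intersection with the rich set \<open>insert y p\<close>.\<close>
    have edge: "e \<subseteq> D" if e: "e \<in> G" "\<not> p \<subseteq> e" for e
    proof -
      have "card (e \<inter> p) \<noteq> 1" using rich_Int[OF rich_member[OF e(1)] pcr[OF p, of p]] by simp
      moreover have "e \<inter> p \<subset> p" using e(2) by auto
      then have "card (e \<inter> p) < 2" using psubset_card_mono[OF fp, of "e \<inter> p"] cp by simp
      ultimately have "card (e \<inter> p) = 0" by linarith
      then have ep: "e \<inter> p = {}" using fp by simp
      have "y \<notin> W" if "y \<in> e" for y
      proof
        assume "y \<in> W"
        then have "card (e \<inter> insert y p) \<noteq> 1"
          using rich_Int[OF rich_member[OF e(1)]] by (simp add: W_def)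
        moreover have "e \<inter> insert y p = {y}" using ep that by auto
        ultimately show False by simp
      qed
      then show ?thesis using ep e(1) G by (auto simp: D_def kgraph_on_def)
    qed
    define P where "P = {e. p \<subseteq> e \<and> e \<subseteq> V \<and> card e = k}"
    have cP: "card P = (n - 2) choose (k - 2)"
      unfolding P_def n_def using card_supersets[OF V pV, of k] cp k by simp
    have fP: "finite P" by (rule rev_finite_subset[of "Pow V"]) (use V in \<open>auto simp: P_def\<close>)
    have GP: "e \<in> P" if "e \<in> G" "p \<subseteq> e" for e using that G by (auto simp: P_def kgraph_on_def)
    \<comment> \<open>An exceptional \<open>z\<close> costs almost all of the order n^(k-3) sets
      above \<open>insert z p\<close>, whereas the edges that do not contain \<open>p\<close> lie
      inside \<open>D\<close> and number at most \<open>2 ^ d\<close>.\<close>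
    have "D = {}"
    proof (rule ccontr)
      assume "D \<noteq> {}"
      then obtain z where z: "z \<in> V" "z \<notin> p" "\<not> rich s G (insert z p)" by (auto simp: D_def W_def)
      define R where "R = {e. insert z p \<subseteq> e \<and> e \<subseteq> V \<and> card e = k}"
      have cz: "card (insert z p) = 3" using z cp fp by simp
      have cR: "card R = (n - 3) choose (k - 3)"
        unfolding R_def n_def using card_supersets[OF V, of "insert z p" k] cz pV z k by simp
      have RP: "R \<subseteq> P" by (auto simp: R_def P_def)
      have few: "card {e \<in> G. insert z p \<subseteq> e} \<le> s * n ^ (k - 4)"
        using card_supersets_not_rich[OF G V z(3)] cz pV z k by (simp add: n_def)
      have "G \<subseteq> (P - R) \<union> {e \<in> G. insert z p \<subseteq> e} \<union> Pow D"
      proof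
        fix e assume e: "e \<in> G"
        show "e \<in> (P - R) \<union> {e \<in> G. insert z p \<subseteq> e} \<union> Pow D"
        proof (cases "p \<subseteq> e")
          case True
          then show ?thesis using GP[OF e True] e by (auto simp: R_def)
        qed (use edge e in auto)
      qed
      then have "card G \<le> card ((P - R) \<union> {e \<in> G. insert z p \<subseteq> e} \<union> Pow D)"
        using fP fG fD by (intro card_mono) auto
      also have "\<dots> \<le> card (P - R) + card {e \<in> G. insert z p \<subseteq> e} + card (Pow D)"
        by (meson card_Un_le add_le_mono1 le_trans)
      also have "card (P - R) = card P - card R"
        using RP fP by (intro card_Diff_subset) (auto intro: finite_subset)
      also have "card (Pow D) \<le> 2 ^ d" using cD fD by (simp add: card_Pow power_increasing)
      finally have "card R \<le> s * n ^ (k - 4) + 2 ^ d"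
        using large few card_mono[OF fP RP] cP unfolding n_def by linarith
      also have "\<dots> \<le> (s + 2 ^ d) * n ^ (k - 4)"
      proof -
        have "1 \<le> n ^ (k - 4)" using n0 by (simp add: n_def)
        then have "2 ^ d * 1 \<le> 2 ^ d * n ^ (k - 4)" by (rule mult_le_mono2)
        then show ?thesis by (simp add: distrib_right)
      qed
      finally have "(2 * (k - 3)) ^ (k - 3) * card R \<le> M * n ^ (k - 4)"
        unfolding M_def mult.assoc by (rule mult_le_mono2)
      moreover have "n ^ (k - 3) \<le> (2 * (k - 3)) ^ (k - 3) * card R"
        unfolding cR using n0 by (intro power_le_binomial_shift) (auto simp: n_def)
      moreover have "n ^ (k - 3) = n * n ^ (k - 4)"
      proof -
        have "k - 3 = Suc (k - 4)" using k by simp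
        then show ?thesis by simp
      qed
      ultimately have "n * n ^ (k - 4) \<le> M * n ^ (k - 4)" by linarith
      moreover have "0 < n ^ (k - 4)" using n0 by (simp add: n_def)
      ultimately have "n \<le> M" using mult_le_cancel2 by blast
      then show False using n0 by (simp add: n_def)
    qed
    have "G \<subseteq> P"
    proof
      fix e assume e: "e \<in> G"
      have "p \<subseteq> e"
      proof (rule ccontr)
        assume "\<not> p \<subseteq> e"
        then have "e = {}" using edge[OF e] \<open>D = {}\<close> by simp
        then show False using e G k by (auto simp: kgraph_on_def)
      qed
      then show "e \<in> P" using GP e by simp
    qed
    then have GP: "G = P" using large cP fP unfolding n_def by (simp add: card_seteq)
    obtain y z where yz: "p = {y, z}" "y \<noteq> z" using cp by (meson card_2_iff)
    have "G = {A. A \<subseteq> V \<and> card A = k \<and> y \<in> A \<and> z \<in> A}"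
      unfolding GP P_def yz(1) by auto
    moreover have "y \<in> V" "z \<in> V" using yz pV by auto
    ultimately show "\<exists>x\<in>V. \<exists>y\<in>V. x \<noteq> y \<and> G = {A. A \<subseteq> V \<and> card A = k \<and> x \<in> A \<and> y \<in> A}"
      using yz(2) by blast
  qed
qed

subsection \<open>Extremal families\<close>

definition star :: "'a set \<Rightarrow> nat \<Rightarrow> 'a set \<Rightarrow> 'a set set" where
  "star V k S = {A. A \<subseteq> V \<and> card A = k \<and> A \<inter> S \<noteq> {}}"

lemma finite_star: "finite V \<Longrightarrow> finite (star V k S)"
  by (rule rev_finite_subset[of "Pow V"]) (auto simp: star_def)

lemma card_star:
  assumes V: "finite V" and S: "S \<subseteq> V"
  shows "card (star V k S) = (card V choose k) - (card V - card S choose k)"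
proof -
  let ?A = "{A. A \<subseteq> V \<and> card A = k}" and ?B = "{A. A \<subseteq> V - S \<and> card A = k}"
  have "star V k S = ?A - ?B" by (auto simp: star_def)
  moreover have "card (?A - ?B) = card ?A - card ?B"
    using V by (intro card_Diff_subset) auto
  moreover have "card (V - S) = card V - card S"
    using V S finite_subset by (metis card_Diff_subset)
  ultimately show ?thesis using V by (simp add: n_subsets)
qed

text \<open>Extremality becomes a comparison: if \<open>H\<close> is at least as large as the star,
  then at most as many star edges are missing as there are edges off \<open>S\<close>.\<close>

lemma card_star_balance:
  assumes V: "finite V" and H: "kgraph_on k V H"
  shows "card H + card (star V k S - H) = card (star V k S) + card {e \<in> H. e \<inter> S = {}}"
proof -
  have fH: "finite H" using kgraph_on_finite[OF V H] .
  have fs: "finite (star V k S)" using finite_star[OF V] .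
  have "H = (H \<inter> star V k S) \<union> {e \<in> H. e \<inter> S = {}}"
    using H by (auto simp: star_def kgraph_on_def)
  then have "card H = card (H \<inter> star V k S) + card {e \<in> H. e \<inter> S = {}}"
    using fH by (subst card_Un_disjoint[symmetric]) (auto simp: star_def)
  moreover have "card (star V k S) = card (H \<inter> star V k S) + card (star V k S - H)"
    using fs by (subst card_Un_disjoint[symmetric]) (auto intro!: arg_cong[where f = card])
  ultimately show ?thesis by simp
qed

text \<open>Such an edge consists of some of the at most \<open>d\<close> exceptional vertices and
  at most one vertex of \<open>W\<close>, so the count is only linear in
  \<open>card V\<close>.\<close>

lemma few_edges_off_core:
  assumes V: "finite V" and H: "kgraph_on k V H" and D: "card (V - S - W) \<le> d"
  shows "card {e \<in> H. e \<inter> S = {} \<and> card (e \<inter> W) \<le> 1} \<le> 2 ^ d * (card V + 1)"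
proof -
  let ?D = "V - S - W" and ?E = "{e \<in> H. e \<inter> S = {} \<and> card (e \<inter> W) \<le> 1}"
  let ?X = "insert {} ((\<lambda>x. {x}) ` V)"
  have "?E \<subseteq> (\<lambda>(X, Y). X \<union> Y) ` (Pow ?D \<times> ?X)"
  proof
    fix e assume "e \<in> ?E"
    then have e: "e \<subseteq> V" "finite e" "e \<inter> S = {}" "card (e \<inter> W) \<le> 1"
      using H by (auto simp: kgraph_on_def)
    have "e \<inter> W \<in> ?X"
    proof (cases "e \<inter> W = {}")
      case False
      then have "card (e \<inter> W) \<noteq> 0" using e(2) by simp
      then have "card (e \<inter> W) = 1" using e(4) by linarith
      then obtain x where "e \<inter> W = {x}" by (auto simp: card_1_singleton_iff)
      then show ?thesis using e(1) by auto
    qed simp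
    moreover have "e = (e \<inter> ?D) \<union> (e \<inter> W)" using e by auto
    ultimately show "e \<in> (\<lambda>(X, Y). X \<union> Y) ` (Pow ?D \<times> ?X)"
      by (intro image_eqI[of _ _ "(e \<inter> ?D, e \<inter> W)"]) auto
  qed
  then have "card ?E \<le> card (Pow ?D \<times> ?X)"
    using V by (intro surj_card_le) auto
  also have "\<dots> = 2 ^ card ?D * card ?X" using V by (simp add: card_cartesian_product card_Pow)
  also have "\<dots> \<le> 2 ^ d * (card V + 1)"
  proof (rule mult_le_mono)
    show "2 ^ card ?D \<le> (2::nat) ^ d" using D by (rule power_increasing) simp
    have "card ((\<lambda>x. {x}) ` V) \<le> card V" using V by (rule card_image_le)
    then show "card ?X \<le> card V + 1" using V by (simp add: card_insert_if)
  qed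
  finally show ?thesis .
qed

text \<open>An exceptional vertex \<open>x\<close> forms a non-rich pair with some
  \<open>c \<in> S\<close>. The \<open>k\<close>-sets above this pair belong to the star, and almost
  all of them are missing from \<open>H\<close>.\<close>

lemma many_missing_edges:
  assumes V: "finite V" and H: "kgraph_on k V H" and k: "3 \<le> k" and S: "S \<subseteq> V"
    and D: "V - S - (\<Inter>c\<in>S. rich_nbs s H c) \<noteq> {}"
  shows "(card V - 2) choose (k - 2) \<le> card (star V k S - H) + s * card V ^ (k - 3)"
proof -
  obtain x c where x: "x \<in> V" "x \<notin> S" "c \<in> S" "x \<notin> rich_nbs s H c" using D by auto
  then have xc: "x \<noteq> c" "\<not> rich s H {c, x}" by (auto simp: rich_nbs_def)
  have cV: "{c, x} \<subseteq> V" and c2: "card {c, x} = 2" using x S xc by auto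
  have "{e. {c, x} \<subseteq> e \<and> e \<subseteq> V \<and> card e = k} \<subseteq> (star V k S - H) \<union> {e \<in> H. {c, x} \<subseteq> e}"
    using x by (auto simp: star_def)
  then have "card {e. {c, x} \<subseteq> e \<and> e \<subseteq> V \<and> card e = k}
      \<le> card ((star V k S - H) \<union> {e \<in> H. {c, x} \<subseteq> e})"
    using finite_star[OF V, of k S] kgraph_on_finite[OF V H] by (intro card_mono) auto
  also have "\<dots> \<le> card (star V k S - H) + card {e \<in> H. {c, x} \<subseteq> e}" by (rule card_Un_le)
  also have "card {e \<in> H. {c, x} \<subseteq> e} \<le> s * card V ^ (k - 3)"
    using card_supersets_not_rich[OF H V xc(2) cV] c2 k by simp
  finally show ?thesis using card_supersets[OF V cV, of k] c2 k by simp
qed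

text \<open>An exceptional vertex costs order n^(k-2) star edges, against linearly many edges off
  \<open>S\<close> with at most one vertex in \<open>W\<close>. Edges off \<open>S\<close> with two
  vertices in \<open>W\<close> are left aside, because the cycles they close depend on the parity of
  \<open>l\<close>.\<close>

lemma core_set_dichotomy:
  assumes k: "5 \<le> k" and t: "1 \<le> t" and l: "l = 2 * t + 1 \<or> l = 2 * t + 2"
    and s: "s = 2 * k * (2 * t + 2)"
  shows "\<exists>n0. \<forall>(V :: 'a set) H. finite V \<longrightarrow> n0 \<le> card V \<longrightarrow> kgraph_on k V H \<longrightarrow>
    \<not> (\<exists>C\<subseteq>H. linear_cycle k l C) \<longrightarrow>
    (card V choose k) - (card V - t choose k) \<le> card H \<longrightarrow>
    (\<exists>S W. S \<subseteq> V \<and> card S = t \<and> linked (2 * k + 2 * t + 2) s H S \<and>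
      W = (\<Inter>c\<in>S. rich_nbs s H c) \<and>
      (V - S \<subseteq> W \<or>
       card {e \<in> H. e \<inter> S = {} \<and> card (e \<inter> W) \<le> 1} < card (star V k S - H)))"
proof -
  obtain n1 d where core: "\<forall>(V :: 'a set) H. finite V \<longrightarrow> n1 \<le> card V \<longrightarrow> kgraph_on k V H \<longrightarrow>
    \<not> (\<exists>C\<subseteq>H. linear_cycle k l C) \<longrightarrow>
    t * (card V choose (k - 1)) \<le> card H + t * t * card V ^ (k - 2) \<longrightarrow>
    (\<exists>S\<subseteq>V. card S = t \<and> linked (2 * k + 2 * t + 2) s H S \<and>
      card (V - S - (\<Inter>c\<in>S. rich_nbs s H c)) \<le> d)"
    using core_set[OF k t l s] by (elim exE)
  \<comment> \<open>Chosen so that the failure of both alternatives would force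
    \<open>n \<le> M\<close>.\<close>
  define M where "M = (2 * (k - 2)) ^ (k - 2) * (2 * 2 ^ d + s)"
  show ?thesis
  proof (rule exI[of _ "n1 + M + t + k + 4"], intro allI impI)
    fix V :: "'a set" and H
    assume V: "finite V" and n0: "n1 + M + t + k + 4 \<le> card V" and H: "kgraph_on k V H"
      and free: "\<not> (\<exists>C\<subseteq>H. linear_cycle k l C)"
      and large: "(card V choose k) - (card V - t choose k) \<le> card H"
    define n where "n = card V"
    have "t * (card V choose (k - 1)) \<le> card H + t * t * card V ^ (k - 2)"
      using star_lower_bound[of t "card V" k] large n0 k by linarith
    from core[rule_format, OF V _ H free this] n0 obtain S where S: "S \<subseteq> V" "card S = t" "linked (2 * k + 2 * t + 2) s H S"
      "card (V - S - (\<Inter>c\<in>S. rich_nbs s H c)) \<le> d"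
      by auto
    define W where "W = (\<Inter>c\<in>S. rich_nbs s H c)"
    have "V - S \<subseteq> W \<or>
       card {e \<in> H. e \<inter> S = {} \<and> card (e \<inter> W) \<le> 1} < card (star V k S - H)"
    proof (rule ccontr)
      assume no: "\<not> ?thesis"
      then have "V - S - W \<noteq> {}" by blast
      then have "(n - 2) choose (k - 2) \<le> card (star V k S - H) + s * n ^ (k - 3)"
        using many_missing_edges[OF V H _ S(1), of s] k unfolding W_def n_def by simp
      moreover have "card (star V k S - H) \<le> 2 ^ d * (n + 1)"
        using no few_edges_off_core[OF V H, of S W d] S(4) unfolding W_def n_def by linarith
      moreover have "2 ^ d * (n + 1) \<le> 2 ^ d * (2 * n ^ (k - 3))"
      proof (rule mult_le_mono2)
        have "n ^ 1 \<le> n ^ (k - 3)" using k n0 by (intro power_increasing) (auto simp: n_def)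
        then show "n + 1 \<le> 2 * n ^ (k - 3)" using n0 by (simp add: n_def)
      qed
      ultimately have "(n - 2) choose (k - 2) \<le> (2 * 2 ^ d + s) * n ^ (k - 3)"
        by (simp add: distrib_right)
      then have "(2 * (k - 2)) ^ (k - 2) * ((n - 2) choose (k - 2)) \<le> M * n ^ (k - 3)"
        unfolding M_def mult.assoc by (rule mult_le_mono2)
      moreover have "n ^ (k - 2) \<le> (2 * (k - 2)) ^ (k - 2) * ((n - 2) choose (k - 2))"
        using n0 by (intro power_le_binomial_shift) (auto simp: n_def)
      moreover have "n ^ (k - 2) = n * n ^ (k - 3)"
      proof -
        have "k - 2 = Suc (k - 3)" using k by simp
        then show ?thesis by simp
      qed
      ultimately have "n * n ^ (k - 3) \<le> M * n ^ (k - 3)" by linarith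
      moreover have "0 < n ^ (k - 3)" using n0 by (simp add: n_def)
      ultimately have "n \<le> M" using mult_le_cancel2 by blast
      then show False using n0 by (simp add: n_def)
    qed
    then show "\<exists>S W. S \<subseteq> V \<and> card S = t \<and> linked (2 * k + 2 * t + 2) s H S \<and>
      W = (\<Inter>c\<in>S. rich_nbs s H c) \<and>
      (V - S \<subseteq> W \<or>
       card {e \<in> H. e \<inter> S = {} \<and> card (e \<inter> W) \<le> 1} < card (star V k S - H))"
      using S(1-3) W_def by blast
  qed
qed

lemma two_elements: "2 \<le> card A \<Longrightarrow> \<exists>x\<in>A. \<exists>y\<in>A. x \<noteq> y"
  by (metis obtain_subset_with_card_n card_2_iff insert_subset)

lemma odd_cycle_free_extremal:
  assumes k: "5 \<le> k" and t: "1 \<le> t"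
  shows "\<exists>n0. \<forall>(V :: 'a set) H. finite V \<longrightarrow> n0 \<le> card V \<longrightarrow> kgraph_on k V H \<longrightarrow>
    \<not> (\<exists>C\<subseteq>H. linear_cycle k (2 * t + 1) C) \<longrightarrow>
    (card V choose k) - (card V - t choose k) \<le> card H \<longrightarrow>
    (\<exists>S\<subseteq>V. card S = t \<and> H = star V k S)"
proof -
  define s where "s = 2 * k * (2 * t + 2)"
  from core_set_dichotomy[OF k t _ s_def, of "2 * t + 1"] obtain n0 where core:
    "\<forall>(V :: 'a set) H. finite V \<longrightarrow> n0 \<le> card V \<longrightarrow> kgraph_on k V H \<longrightarrow>
    \<not> (\<exists>C\<subseteq>H. linear_cycle k (2 * t + 1) C) \<longrightarrow>
    (card V choose k) - (card V - t choose k) \<le> card H \<longrightarrow>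
    (\<exists>S W. S \<subseteq> V \<and> card S = t \<and> linked (2 * k + 2 * t + 2) s H S \<and>
      W = (\<Inter>c\<in>S. rich_nbs s H c) \<and>
      (V - S \<subseteq> W \<or>
       card {e \<in> H. e \<inter> S = {} \<and> card (e \<inter> W) \<le> 1} < card (star V k S - H)))"
    by auto
  show ?thesis
  proof (rule exI[of _ n0], intro allI impI)
    fix V :: "'a set" and H
    assume V: "finite V" and n0: "n0 \<le> card V" and H: "kgraph_on k V H"
      and free: "\<not> (\<exists>C\<subseteq>H. linear_cycle k (2 * t + 1) C)"
      and large: "(card V choose k) - (card V - t choose k) \<le> card H"
    from core[rule_format, OF V n0 H free large] obtain S W where
      S: "S \<subseteq> V" "card S = t" "linked (2 * k + 2 * t + 2) s H S"
      and W: "W = (\<Inter>c\<in>S. rich_nbs s H c)"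
      and dich: "V - S \<subseteq> W \<or>
        card {e \<in> H. e \<inter> S = {} \<and> card (e \<inter> W) \<le> 1} < card (star V k S - H)"
      by (elim exE conjE)
    have fS: "finite S" using S V finite_subset by blast
    have cs: "card (star V k S) \<le> card H" using large card_star[OF V S(1), of k] S(2) by simp
    \<comment> \<open>An edge off \<open>S\<close> with two vertices in \<open>W\<close> closes the
      alternating path between them.\<close>
    have off: "card (e \<inter> W) \<le> 1" if e: "e \<in> H" "e \<inter> S = {}" for e
    proof (rule ccontr)
      assume "\<not> ?thesis"
      then have "2 \<le> card (e \<inter> W)" by simp
      then obtain x y where xy: "x \<in> e \<inter> W" "y \<in> e \<inter> W" "x \<noteq> y" using two_elements by blast
      have "\<exists>C\<subseteq>H. linear_cycle k (2 * t + 1) C"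
        by (rule odd_cycle_of_linked_set[OF H fS S(2) t S(3), of x y e])
          (use xy e W in \<open>auto simp: s_def intro: rich_member\<close>)
      then show False using free by blast
    qed
    then have eq: "{e \<in> H. e \<inter> S = {}} = {e \<in> H. e \<inter> S = {} \<and> card (e \<inter> W) \<le> 1}" by auto
    have bal: "card H + card (star V k S - H) = card (star V k S) + card {e \<in> H. e \<inter> S = {}}"
      using card_star_balance[OF V H] .
    \<comment> \<open>In the other alternative more star edges would be missing than there are edges
      off \<open>S\<close>, and \<open>H\<close> would be smaller than the star.\<close>
    have VW: "V - S \<subseteq> W" using dich bal cs unfolding eq by linarith
    have "{e \<in> H. e \<inter> S = {}} = {}"
    proof (rule ccontr)
      assume "{e \<in> H. e \<inter> S = {}} \<noteq> {}"
      then obtain e where e: "e \<in> H" "e \<inter> S = {}" by blast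
      then have "e \<subseteq> V" "card e = k" using H by (auto simp: kgraph_on_def)
      then have "e \<inter> W = e" using e(2) VW by blast
      then show False using off[OF e] \<open>card e = k\<close> k by simp
    qed
    then have "H \<subseteq> star V k S" using H by (auto simp: star_def kgraph_on_def)
    then have "H = star V k S" using cs finite_star[OF V] by (simp add: card_seteq)
    then show "\<exists>S\<subseteq>V. card S = t \<and> H = star V k S" using S by blast
  qed
qed

lemma even_cycle_free_extremal:
  assumes k: "5 \<le> k" and t: "1 \<le> t"
  shows "\<exists>n0. \<forall>(V :: 'a set) H. finite V \<longrightarrow> n0 \<le> card V \<longrightarrow> kgraph_on k V H \<longrightarrow>
    \<not> (\<exists>C\<subseteq>H. linear_cycle k (2 * t + 2) C) \<longrightarrow>
    (card V choose k) - (card V - t choose k) + (card V - t - 2 choose (k - 2)) \<le> card H \<longrightarrow>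
    (\<exists>S x y. S \<subseteq> V \<and> card S = t \<and> x \<in> V - S \<and> y \<in> V - S \<and> x \<noteq> y \<and>
      H = star V k S \<union> {A. A \<subseteq> V - S \<and> card A = k \<and> x \<in> A \<and> y \<in> A})"
proof -
  define s where "s = 2 * k * (2 * t + 2)"
  from core_set_dichotomy[OF k t _ s_def, of "2 * t + 2"] obtain n0 where core:
    "\<forall>(V :: 'a set) H. finite V \<longrightarrow> n0 \<le> card V \<longrightarrow> kgraph_on k V H \<longrightarrow>
    \<not> (\<exists>C\<subseteq>H. linear_cycle k (2 * t + 2) C) \<longrightarrow>
    (card V choose k) - (card V - t choose k) \<le> card H \<longrightarrow>
    (\<exists>S W. S \<subseteq> V \<and> card S = t \<and> linked (2 * k + 2 * t + 2) s H S \<and>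
      W = (\<Inter>c\<in>S. rich_nbs s H c) \<and>
      (V - S \<subseteq> W \<or>
       card {e \<in> H. e \<inter> S = {} \<and> card (e \<inter> W) \<le> 1} < card (star V k S - H)))"
    by auto
  from no_singleton_intersection_extremal[OF k] obtain n1 where frankl:
    "\<forall>(V :: 'a set) G. finite V \<longrightarrow> n1 \<le> card V \<longrightarrow> kgraph_on k V G \<longrightarrow>
    (\<forall>A\<in>G. \<forall>B\<in>G. card (A \<inter> B) \<noteq> 1) \<longrightarrow> (card V - 2) choose (k - 2) \<le> card G \<longrightarrow>
    (\<exists>x\<in>V. \<exists>y\<in>V. x \<noteq> y \<and> G = {A. A \<subseteq> V \<and> card A = k \<and> x \<in> A \<and> y \<in> A})"
    by (elim exE)
  show ?thesis
  proof (rule exI[of _ "n0 + n1 + t"], intro allI impI)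
    fix V :: "'a set" and H
    assume V: "finite V" and n: "n0 + n1 + t \<le> card V" and H: "kgraph_on k V H"
      and free: "\<not> (\<exists>C\<subseteq>H. linear_cycle k (2 * t + 2) C)"
      and large: "(card V choose k) - (card V - t choose k) + (card V - t - 2 choose (k - 2)) \<le> card H"
    have n0: "n0 \<le> card V" using n by simp
    have large': "(card V choose k) - (card V - t choose k) \<le> card H" using large by simp
    from core[rule_format, OF V n0 H free large'] obtain S W where
      S: "S \<subseteq> V" "card S = t" "linked (2 * k + 2 * t + 2) s H S"
      and W: "W = (\<Inter>c\<in>S. rich_nbs s H c)"
      and dich: "V - S \<subseteq> W \<or>
        card {e \<in> H. e \<inter> S = {} \<and> card (e \<inter> W) \<le> 1} < card (star V k S - H)"
      by (elim exE conjE)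
    have fS: "finite S" using S V finite_subset by blast
    have cVS: "card (V - S) = card V - t" using S fS by (simp add: card_Diff_subset)
    define H1 where "H1 = {e \<in> H. e \<inter> S = {} \<and> card (e \<inter> W) \<le> 1}"
    define H2 where "H2 = {e \<in> H. e \<inter> S = {} \<and> 2 \<le> card (e \<inter> W)}"
    have fH: "finite H" using kgraph_on_finite[OF V H] .
    \<comment> \<open>Both edges have a vertex of \<open>W\<close> other than \<open>u\<close>. An
      alternating path between these two vertices is closed by \<open>A\<close> and
      \<open>B\<close>, which meet only in \<open>u\<close>.\<close>
    have ns: "card (A \<inter> B) \<noteq> 1" if AB: "A \<in> H2" "B \<in> H2" for A B
    proof
      assume "card (A \<inter> B) = 1"
      then obtain u where u: "A \<inter> B = {u}" by (auto simp: card_1_singleton_iff)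
      have other: "\<exists>x. x \<in> e \<inter> W \<and> x \<noteq> u" if "e \<in> H2" for e
        using that two_elements[of "e \<inter> W"] by (auto simp: H2_def)
      obtain x y where xy: "x \<in> A \<inter> W" "x \<noteq> u" "y \<in> B \<inter> W" "y \<noteq> u"
        using other[OF AB(1)] other[OF AB(2)] by blast
      have "\<exists>C\<subseteq>H. linear_cycle k (2 * t + 2) C"
        by (rule even_cycle_of_linked_set[OF H fS S(2) t S(3), of x y A B u])
          (use xy AB u W in \<open>auto simp: s_def H2_def intro: rich_member\<close>)
      then show False using free by blast
    qed
    have k2: "kgraph_on k (V - S) H2" using H by (auto simp: H2_def kgraph_on_def)
    have struct: "\<exists>x\<in>V - S. \<exists>y\<in>V - S. x \<noteq> y \<and> H2 = {A. A \<subseteq> V - S \<and> card A = k \<and> x \<in> A \<and> y \<in> A}"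
      if "card V - t - 2 choose (k - 2) \<le> card H2"
      by (rule frankl[rule_format, OF _ _ k2]) (use V n cVS ns that in auto)
    \<comment> \<open>The structural statement also gives the upper bound: a family at least this
      large is a full pair family, whose size is exactly this binomial.\<close>
    have c2: "card H2 \<le> card V - t - 2 choose (k - 2)"
    proof (rule ccontr)
      assume more: "\<not> ?thesis"
      then obtain x y where xy: "x \<in> V - S" "y \<in> V - S" "x \<noteq> y"
        "H2 = {A. A \<subseteq> V - S \<and> card A = k \<and> x \<in> A \<and> y \<in> A}" using struct by auto
      have "H2 = {A. {x, y} \<subseteq> A \<and> A \<subseteq> V - S \<and> card A = k}" unfolding xy(4) by auto
      then have "card H2 = card V - t - 2 choose (k - 2)"
        using card_supersets[of "V - S" "{x, y}" k] V xy(1-3) k cVS by (simp add: numeral_2_eq_2)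
      then show False using more by simp
    qed
    have split: "card {e \<in> H. e \<inter> S = {}} = card H1 + card H2"
    proof -
      have "{e \<in> H. e \<inter> S = {}} = H1 \<union> H2" by (auto simp: H1_def H2_def)
      moreover have "H1 \<inter> H2 = {}" by (auto simp: H1_def H2_def)
      ultimately show ?thesis using fH by (simp add: card_Un_disjoint H1_def H2_def)
    qed
    have bal: "card H + card (star V k S - H) = card (star V k S) + card {e \<in> H. e \<inter> S = {}}"
      using card_star_balance[OF V H] .
    have cs: "card (star V k S) + (card V - t - 2 choose (k - 2)) \<le> card H"
      using large card_star[OF V S(1), of k] S(2) by simp
    \<comment> \<open>Since \<open>H2\<close> cannot exceed the second binomial, missing star edges
      would have to be made up by \<open>H1\<close> alone, and the other alternative says that
      \<open>H1\<close> is too small for that.\<close>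
    have VW: "V - S \<subseteq> W" using dich bal cs split c2 unfolding H1_def[symmetric] by linarith
    have H1: "H1 = {}"
    proof (rule ccontr)
      assume "H1 \<noteq> {}"
      then obtain e where e: "e \<in> H" "e \<inter> S = {}" "card (e \<inter> W) \<le> 1" by (auto simp: H1_def)
      then have "e \<subseteq> V" "card e = k" using H by (auto simp: kgraph_on_def)
      then have "e \<inter> W = e" using e(2) VW by blast
      then show False using e(3) \<open>card e = k\<close> k by simp
    qed
    have "card (star V k S - H) = 0" "card V - t - 2 choose (k - 2) \<le> card H2"
      using bal cs split c2 H1 by simp_all
    then have sub: "star V k S \<subseteq> H" using finite_star[OF V, of k S] by simp
    obtain x y where xy: "x \<in> V - S" "y \<in> V - S" "x \<noteq> y"
      "H2 = {A. A \<subseteq> V - S \<and> card A = k \<and> x \<in> A \<and> y \<in> A}"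
      using struct \<open>card V - t - 2 choose (k - 2) \<le> card H2\<close> by blast
    have "H = star V k S \<union> H2"
    proof
      show "H \<subseteq> star V k S \<union> H2"
      proof
        fix e assume e: "e \<in> H"
        show "e \<in> star V k S \<union> H2"
        proof (cases "e \<inter> S = {}")
          case True
          then have "e \<in> H1 \<union> H2" using e by (auto simp: H1_def H2_def)
          then show ?thesis using H1 by simp
        next
          case False
          then show ?thesis using e H by (auto simp: star_def kgraph_on_def)
        qed
      qed
      show "star V k S \<union> H2 \<subseteq> H" using sub by (auto simp: H2_def)
    qed
    then show "\<exists>S x y. S \<subseteq> V \<and> card S = t \<and> x \<in> V - S \<and> y \<in> V - S \<and> x \<noteq> y \<and>
      H = star V k S \<union> {A. A \<subseteq> V - S \<and> card A = k \<and> x \<in> A \<and> y \<in> A}"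
      using S(1,2) xy by blast
  qed
qed

subsection \<open>Linear cycles up to isomorphism\<close>

lemma Suc_mod_if: "i < l \<Longrightarrow> Suc i mod l = (if Suc i = l then 0 else Suc i)"
  by auto

text \<open>Distinguished vertices correspond by index. The private parts of the edges are pairwise
  disjoint and all have \<open>k - 2\<close> elements, so arbitrary bijections between them fit
  together.\<close>

lemma linear_cycle_isomorphic:
  fixes C :: "'a set set" and D :: "'b set set"
  assumes C: "linear_cycle k l C" and D: "linear_cycle k l D"
  shows "hypergraph_iso C D"
proof -
  obtain F v where l: "l \<ge> 3" and CF: "C = F ` {..<l}"
    and F: "\<forall>i<l. finite (F i) \<and> card (F i) = k" and v: "inj_on v {..<l}"
    and Fv: "\<forall>i<l. F i \<inter> v ` {..<l} = {v i, v (Suc i mod l)}"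
    and Fd: "\<forall>i<l. \<forall>j<l. i \<noteq> j \<longrightarrow> (F i - v ` {..<l}) \<inter> (F j - v ` {..<l}) = {}"
    using C unfolding linear_cycle_def by (elim exE conjE)
  obtain G w where DG: "D = G ` {..<l}"
    and G: "\<forall>i<l. finite (G i) \<and> card (G i) = k" and w: "inj_on w {..<l}"
    and Gw: "\<forall>i<l. G i \<inter> w ` {..<l} = {w i, w (Suc i mod l)}"
    and Gd: "\<forall>i<l. \<forall>j<l. i \<noteq> j \<longrightarrow> (G i - w ` {..<l}) \<inter> (G j - w ` {..<l}) = {}"
    using D unfolding linear_cycle_def by (elim exE conjE)
  define P where "P i = F i - v ` {..<l}" for i
  define Q where "Q i = G i - w ` {..<l}" for i
  have sl: "Suc i mod l < l" for i using l by simp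
  have ne: "Suc i mod l \<noteq> i" if "i < l" for i using that l by (auto simp: Suc_mod_if)
  have cP: "finite (P i)" "card (P i) = k - 2" if "i < l" for i
  proof -
    have "v (Suc i mod l) \<noteq> v i" using inj_onD[OF v, of "Suc i mod l" i] ne that sl by auto
    then have "card (F i \<inter> v ` {..<l}) = 2" using Fv that by simp
    then show "card (P i) = k - 2" "finite (P i)"
      using F that by (simp_all add: P_def card_Diff_subset_Int)
  qed
  have cQ: "finite (Q i)" "card (Q i) = k - 2" if "i < l" for i
  proof -
    have "w (Suc i mod l) \<noteq> w i" using inj_onD[OF w, of "Suc i mod l" i] ne that sl by auto
    then have "card (G i \<inter> w ` {..<l}) = 2" using Gw that by simp
    then show "card (Q i) = k - 2" "finite (Q i)"
      using G that by (simp_all add: Q_def card_Diff_subset_Int)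
  qed
  have "\<forall>i. \<exists>g. i < l \<longrightarrow> bij_betw g (P i) (Q i)"
    using cP cQ finite_same_card_bij by metis
  then obtain g where g: "\<forall>i. i < l \<longrightarrow> bij_betw (g i) (P i) (Q i)" by (elim choice[THEN exE])
  define idx where "idx x = (THE i. i < l \<and> x \<in> P i)" for x
  have idx: "idx x = i" if "i < l" "x \<in> P i" for x i
  proof -
    have only: "j = i" if j: "j < l" "x \<in> P j" for j
    proof (rule ccontr)
      assume "j \<noteq> i"
      then have "P j \<inter> P i = {}"
        unfolding P_def using Fd[rule_format, OF j(1) \<open>i < l\<close>] by blast
      then show False using j \<open>x \<in> P i\<close> by blast
    qed
    show ?thesis unfolding idx_def
    proof (rule the_equality)
      show "i < l \<and> x \<in> P i" using that by blast
      show "j = i" if "j < l \<and> x \<in> P j" for j using only that by blast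
    qed
  qed
  define f where "f x = (if x \<in> v ` {..<l} then w (inv_into {..<l} v x) else g (idx x) x)" for x
  have fv: "f (v i) = w i" if "i < l" for i
    using that inv_into_f_f[OF v] by (simp add: f_def)
  have fP: "f x = g i x" if "i < l" "x \<in> P i" for x i
    using that idx[OF that] by (simp add: f_def P_def)
  have imP: "f ` P i = Q i" if i: "i < l" for i
  proof -
    have "f ` P i = g i ` P i" using fP[OF i] by (intro image_cong) auto
    then show ?thesis using g i by (auto simp: bij_betw_def)
  qed
  have Fdec: "F i = {v i, v (Suc i mod l)} \<union> P i" if "i < l" for i
    using Fv that unfolding P_def by (metis Int_Diff_Un)
  have Gdec: "G i = {w i, w (Suc i mod l)} \<union> Q i" if "i < l" for i
    using Gw that unfolding Q_def by (metis Int_Diff_Un)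
  have imF: "f ` F i = G i" if "i < l" for i
    using Fdec[OF that] Gdec[OF that] imP[OF that] fv[OF that] fv[OF sl[of i]] by (simp add: image_Un)
  have un: "x \<in> v ` {..<l} \<or> (\<exists>i<l. x \<in> P i)" if "x \<in> \<Union>C" for x
    using that unfolding CF P_def by auto
  have fQ: "f x \<in> Q i" if "i < l" "x \<in> P i" for x i using imP[OF that(1)] that(2) by blast
  have "inj_on f (\<Union>C)"
  proof (rule inj_onI)
    fix x y assume xy: "x \<in> \<Union>C" "y \<in> \<Union>C" and eq: "f x = f y"
    consider "x \<in> v ` {..<l}" "y \<in> v ` {..<l}" | i where "i < l" "x \<in> P i" "y \<in> v ` {..<l}"
      | j where "j < l" "y \<in> P j" "x \<in> v ` {..<l}"
      | i j where "i < l" "x \<in> P i" "j < l" "y \<in> P j"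
      using un[OF xy(1)] un[OF xy(2)] by blast
    then show "x = y"
    proof cases
      case 1
      then obtain i j where "i < l" "j < l" "x = v i" "y = v j" by auto
      then show ?thesis using eq fv inj_onD[OF w, of i j] by simp
    next
      case 2
      then obtain j where "j < l" "y = v j" by auto
      then have "f y \<in> w ` {..<l}" using fv by simp
      then show ?thesis using fQ[OF 2(1,2)] eq by (simp add: Q_def)
    next
      case 3
      then obtain i where "i < l" "x = v i" by auto
      then have "f x \<in> w ` {..<l}" using fv by simp
      then show ?thesis using fQ[OF 3(1,2)] eq by (simp add: Q_def)
    next
      case 4
      have "i = j"
      proof (rule ccontr)
        assume "i \<noteq> j"
        then have "Q i \<inter> Q j = {}"
          unfolding Q_def using Gd[rule_format, OF 4(1,3)] by blast
        then show False using fQ[OF 4(1,2)] fQ[OF 4(3,4)] eq by auto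
      qed
      then have "g i x = g i y" using eq fP 4 by simp
      moreover have "inj_on (g i) (P i)" using g 4 by (simp add: bij_betw_def)
      ultimately show ?thesis using 4 \<open>i = j\<close> by (auto dest: inj_onD)
    qed
  qed
  moreover have im: "(\<lambda>e. f ` e) ` C = D"
    unfolding CF DG image_image using imF by (intro image_cong) auto
  moreover have "f ` \<Union>C = \<Union>D" unfolding im[symmetric] by auto
  ultimately show ?thesis unfolding hypergraph_iso_def bij_betw_def by blast
qed

lemma linear_cycle_iso_closed:
  assumes C: "linear_cycle k l C" and iso: "hypergraph_iso C D"
  shows "linear_cycle k l D"
proof -
  obtain F v where l: "l \<ge> 3" and CF: "C = F ` {..<l}"
    and F: "\<forall>i<l. finite (F i) \<and> card (F i) = k" and v: "inj_on v {..<l}"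
    and Fv: "\<forall>i<l. F i \<inter> v ` {..<l} = {v i, v (Suc i mod l)}"
    and Fd: "\<forall>i<l. \<forall>j<l. i \<noteq> j \<longrightarrow> (F i - v ` {..<l}) \<inter> (F j - v ` {..<l}) = {}"
    using C unfolding linear_cycle_def by (elim exE conjE)
  obtain f where f: "inj_on f (\<Union>C)" "D = (\<lambda>e. f ` e) ` C"
    using iso unfolding hypergraph_iso_def bij_betw_def by (elim exE conjE)
  have FC: "F i \<subseteq> \<Union>C" if "i < l" for i using that unfolding CF by auto
  have vC: "v ` {..<l} \<subseteq> \<Union>C"
  proof
    fix x assume "x \<in> v ` {..<l}"
    then obtain i where "i < l" "x = v i" by auto
    then have "x \<in> F i" using Fv by auto
    then show "x \<in> \<Union>C" using FC \<open>i < l\<close> by blast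
  qed
  let ?v = "\<lambda>i. f (v i)"
  have im: "?v ` {..<l} = f ` v ` {..<l}" by (simp add: image_image)
  have "D = (\<lambda>i. f ` F i) ` {..<l}" unfolding f(2) CF image_image ..
  moreover have "\<forall>i<l. finite (f ` F i) \<and> card (f ` F i) = k"
    using F FC f(1) by (simp add: card_image inj_on_subset)
  moreover have "inj_on ?v {..<l}"
    using comp_inj_on[OF v, of f] inj_on_subset[OF f(1) vC] by (simp add: comp_def)
  moreover have "\<forall>i<l. f ` F i \<inter> ?v ` {..<l} = {?v i, ?v (Suc i mod l)}"
  proof (intro allI impI)
    fix i assume i: "i < l"
    have "f ` F i \<inter> ?v ` {..<l} = f ` (F i \<inter> v ` {..<l})"
      unfolding im using inj_on_image_Int[OF f(1) FC[OF i] vC] by simp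
    then show "f ` F i \<inter> ?v ` {..<l} = {?v i, ?v (Suc i mod l)}" using Fv i by simp
  qed
  moreover have "\<forall>i<l. \<forall>j<l. i \<noteq> j \<longrightarrow>
      (f ` F i - ?v ` {..<l}) \<inter> (f ` F j - ?v ` {..<l}) = {}"
  proof (intro allI impI)
    fix i j assume ij: "i < l" "j < l" "i \<noteq> j"
    have d: "f ` F i - ?v ` {..<l} = f ` (F i - v ` {..<l})" if "i < l" for i
      unfolding im using inj_on_image_set_diff[OF f(1), of "F i" "v ` {..<l}"] FC[OF that] vC by blast
    have "f ` (F i - v ` {..<l}) \<inter> f ` (F j - v ` {..<l})
        = f ` ((F i - v ` {..<l}) \<inter> (F j - v ` {..<l}))"
      using inj_on_image_Int[OF f(1), of "F i - v ` {..<l}" "F j - v ` {..<l}"] FC ij by blast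
    then show "(f ` F i - ?v ` {..<l}) \<inter> (f ` F j - ?v ` {..<l}) = {}"
      using Fd ij by (simp add: d)
  qed
  ultimately show ?thesis unfolding linear_cycle_def using l
    by (intro conjI exI[of _ "\<lambda>i. f ` F i"] exI[of _ ?v])
qed

text \<open>Linear cycles of given \<open>k\<close> and \<open>l\<close> form one isomorphism class,
  so containment of a copy no longer depends on the chosen representative \<open>C\<close>.\<close>

lemma contains_copy_linear_cycle_iff:
  assumes "linear_cycle k l C"
  shows "contains_copy G C \<longleftrightarrow> (\<exists>C'\<subseteq>G. linear_cycle k l C')"
  unfolding contains_copy_def
  by (meson assms linear_cycle_isomorphic linear_cycle_iso_closed)

section \<open>Cycle-freeness of the extremal families\<close>

lemma linear_cycle_degree_le_2:
  fixes F :: "nat \<Rightarrow> 'a set"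
  assumes v: "inj_on v {..<l}"
    and Fv: "\<forall>i<l. F i \<inter> v ` {..<l} = {v i, v (Suc i mod l)}"
    and Fd: "\<forall>i<l. \<forall>j<l. i \<noteq> j \<longrightarrow> (F i - v ` {..<l}) \<inter> (F j - v ` {..<l}) = {}"
  shows "card {i. i < l \<and> x \<in> F i} \<le> 2"
proof (cases "x \<in> v ` {..<l}")
  case True
  then obtain j where j: "j < l" "x = v j" by auto
  \<comment> \<open>The cyclic predecessor of \<open>j\<close> is written out by cases because
    \<open>0 - 1\<close> is \<open>0\<close> on natural numbers.\<close>
  have "{i. i < l \<and> x \<in> F i} \<subseteq> {j, if j = 0 then l - 1 else j - 1}"
  proof
    fix i assume "i \<in> {i. i < l \<and> x \<in> F i}"
    then have i: "i < l" "x \<in> F i \<inter> v ` {..<l}" using True by auto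
    then have "v j = v i \<or> v j = v (Suc i mod l)" using Fv j by auto
    moreover have "Suc i mod l < l" using j by simp
    ultimately have "j = i \<or> j = Suc i mod l" using inj_onD[OF v] i(1) j(1) by auto
    then show "i \<in> {j, if j = 0 then l - 1 else j - 1}"
      using i(1) j(1) by (auto simp: Suc_mod_if split: if_splits)
  qed
  then have "card {i. i < l \<and> x \<in> F i} \<le> card {j, if j = 0 then l - 1 else j - 1}"
    by (intro card_mono) auto
  also have "\<dots> \<le> 2" by (simp add: card_insert_if)
  finally show ?thesis .
next
  case False
  have "i = j" if "i < l" "x \<in> F i" "j < l" "x \<in> F j" for i j
  proof (rule ccontr)
    assume "i \<noteq> j"
    then have "(F i - v ` {..<l}) \<inter> (F j - v ` {..<l}) = {}" using Fd that by simp
    then show False using that False by blast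
  qed
  then have "card {i. i < l \<and> x \<in> F i} \<le> Suc 0" by (subst card_le_Suc0_iff_eq) auto
  then show ?thesis by simp
qed

text \<open>A vertex lies in at most two edges, so \<open>S\<close> meets at most
  \<open>2 * card S\<close> of them. For a \<open>t\<close>-set, length \<open>2 * t + 1\<close>
  leaves one edge off \<open>S\<close> and length \<open>2 * t + 2\<close> leaves two, which share
  at most one vertex.\<close>

lemma linear_cycle_edges_avoiding:
  assumes C: "linear_cycle k l C" and S: "finite S"
  shows "\<exists>F I. I \<subseteq> {..<l} \<and> l \<le> card I + 2 * card S \<and> (\<forall>i\<in>I. F i \<in> C \<and> F i \<inter> S = {}) \<and>
    (\<forall>i\<in>I. \<forall>j\<in>I. i \<noteq> j \<longrightarrow> (\<forall>x\<in>F i \<inter> F j. \<forall>y\<in>F i \<inter> F j. x = y))"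
proof -
  obtain F v where l: "l \<ge> 3" and CF: "C = F ` {..<l}" and v: "inj_on v {..<l}"
    and Fv: "\<forall>i<l. F i \<inter> v ` {..<l} = {v i, v (Suc i mod l)}"
    and Fd: "\<forall>i<l. \<forall>j<l. i \<noteq> j \<longrightarrow> (F i - v ` {..<l}) \<inter> (F j - v ` {..<l}) = {}"
    using C unfolding linear_cycle_def by (elim exE conjE)
  define I where "I = {i. i < l \<and> F i \<inter> S = {}}"
  have "{..<l} \<subseteq> I \<union> (\<Union>x\<in>S. {i. i < l \<and> x \<in> F i})" by (auto simp: I_def)
  then have "card {..<l} \<le> card (I \<union> (\<Union>x\<in>S. {i. i < l \<and> x \<in> F i}))"
    using S by (intro card_mono) (auto simp: I_def)
  also have "\<dots> \<le> card I + card (\<Union>x\<in>S. {i. i < l \<and> x \<in> F i})" by (rule card_Un_le)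
  also have "card (\<Union>x\<in>S. {i. i < l \<and> x \<in> F i}) \<le> (\<Sum>x\<in>S. card {i. i < l \<and> x \<in> F i})"
    using S by (rule card_UN_le)
  also have "\<dots> \<le> (\<Sum>x\<in>S. 2)" by (intro sum_mono linear_cycle_degree_le_2[OF v Fv Fd])
  finally have "l \<le> card I + 2 * card S" by (simp add: mult.commute)
  moreover have "x = y" if ij: "i < l" "j < l" "i \<noteq> j" and x: "x \<in> F i \<inter> F j" and y: "y \<in> F i \<inter> F j"
    for i j x y
  proof (rule ccontr)
    assume "x \<noteq> y"
    have "(F i - v ` {..<l}) \<inter> (F j - v ` {..<l}) = {}" using Fd ij by simp
    then have "x \<in> v ` {..<l}" "y \<in> v ` {..<l}" using x y by blast+
    then have "x \<in> {v i, v (Suc i mod l)}" "y \<in> {v i, v (Suc i mod l)}"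
      "x \<in> {v j, v (Suc j mod l)}" "y \<in> {v j, v (Suc j mod l)}"
      using Fv ij x y by blast+
    then have "v i = v (Suc j mod l)" "v j = v (Suc i mod l)"
      using \<open>x \<noteq> y\<close> inj_onD[OF v, of i j] ij by auto
    moreover have "Suc j mod l < l" "Suc i mod l < l" using l by auto
    \<comment> \<open>Two common vertices would make \<open>i\<close> and \<open>j\<close> cyclic
      successors of each other, which is impossible in a cycle of length at least 3.\<close>
    ultimately have "i = Suc j mod l" "j = Suc i mod l"
      using inj_onD[OF v, of i "Suc j mod l"] inj_onD[OF v, of j "Suc i mod l"] ij by auto
    then show False using ij l by (auto simp: Suc_mod_if split: if_splits)
  qed
  ultimately show ?thesis
    by (intro exI[of _ F] exI[of _ I] conjI) (auto simp: I_def CF)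
qed

lemma star_odd_cycle_free:
  assumes "finite S" "card S = t"
  shows "\<not> (\<exists>C\<subseteq>star V k S. linear_cycle k (2 * t + 1) C)"
proof
  assume "\<exists>C\<subseteq>star V k S. linear_cycle k (2 * t + 1) C"
  then obtain C where C: "C \<subseteq> star V k S" "linear_cycle k (2 * t + 1) C" by blast
  from linear_cycle_edges_avoiding[OF C(2) assms(1)] obtain F I where
    I0: "I \<subseteq> {..<2 * t + 1}" and I: "2 * t + 1 \<le> card I + 2 * card S" "\<forall>i\<in>I. F i \<in> C \<and> F i \<inter> S = {}"
    "\<forall>i\<in>I. \<forall>j\<in>I. i \<noteq> j \<longrightarrow> (\<forall>x\<in>F i \<inter> F j. \<forall>y\<in>F i \<inter> F j. x = y)"
    by (elim exE conjE)
  then have "I \<noteq> {}" using assms by auto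
  then show False using I(2) C(1) by (auto simp: star_def)
qed

text \<open>At least two edges of the cycle would avoid \<open>S\<close>; both contain
  \<open>x\<close> and \<open>y\<close>, but edges of a linear cycle share at most one
  vertex.\<close>

lemma star_with_pair_even_cycle_free:
  assumes S: "finite S" "card S = t" and xy: "x \<noteq> y"
    and G: "G = star V k S \<union> {A. A \<subseteq> V - S \<and> card A = k \<and> x \<in> A \<and> y \<in> A}"
  shows "\<not> (\<exists>C\<subseteq>G. linear_cycle k (2 * t + 2) C)"
proof
  assume "\<exists>C\<subseteq>G. linear_cycle k (2 * t + 2) C"
  then obtain C where C: "C \<subseteq> G" "linear_cycle k (2 * t + 2) C" by blast
  from linear_cycle_edges_avoiding[OF C(2) S(1)] obtain F I where
    I0: "I \<subseteq> {..<2 * t + 2}" and I: "2 * t + 2 \<le> card I + 2 * card S" "\<forall>i\<in>I. F i \<in> C \<and> F i \<inter> S = {}"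
    "\<forall>i\<in>I. \<forall>j\<in>I. i \<noteq> j \<longrightarrow> (\<forall>x\<in>F i \<inter> F j. \<forall>y\<in>F i \<inter> F j. x = y)"
    by (elim exE conjE)
  then have "2 \<le> card I" using S by simp
  then obtain i j where ij: "i \<in> I" "j \<in> I" "i \<noteq> j" using two_elements by metis
  have "x \<in> F i \<and> y \<in> F i" if "i \<in> I" for i
    using I(2) that C(1) G by (auto simp: star_def)
  then have "x \<in> F i \<inter> F j" "y \<in> F i \<inter> F j" using ij by auto
  then show False using I(3) ij xy by blast
qed

section \<open>Turan numbers and extremal families\<close>

text \<open>Uniqueness is demanded for all families with at least \<open>N\<close> edges. It thereby
  excludes larger families too, which bounds the maximum and characterises the extremal families in
  one stroke.\<close>

lemma turan_number_eqI:
  fixes P :: "nat set set \<Rightarrow> bool"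
  assumes P: "\<And>E. P E \<Longrightarrow> kgraph_on k {1..n} E \<and> \<not> contains_copy E C \<and> card E = N"
    and ex: "\<exists>E. P E"
    and uniq: "\<And>G. kgraph_on k {1..n} G \<Longrightarrow> \<not> contains_copy G C \<Longrightarrow> N \<le> card G \<Longrightarrow> P G"
  shows "turan_number k n C = N \<and> (\<forall>G. extremal_family k n C G \<longleftrightarrow> P G)"
proof -
  define X where "X = {card G | G :: nat set set. kgraph_on k {1..n} G \<and> \<not> contains_copy G C}"
  have "X \<subseteq> card ` Pow (Pow {1..n})" by (auto simp: X_def kgraph_on_def)
  then have "finite X" by (rule finite_subset) simp
  moreover have "N \<in> X" using ex P unfolding X_def by blast
  moreover have "m \<le> N" if m: "m \<in> X" for m
  proof (rule ccontr)
    assume more: "\<not> m \<le> N"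
    obtain G where G: "m = card G" "kgraph_on k {1..n} G" "\<not> contains_copy G C"
      using m unfolding X_def by blast
    then have "P G" using more by (intro uniq) auto
    then show False using P[of G] G(1) more by simp
  qed
  ultimately have "turan_number k n C = N"
    unfolding turan_number_def X_def[symmetric] by (intro Max_eqI) auto
  moreover have "extremal_family k n C G \<longleftrightarrow> P G" for G
    unfolding extremal_family_def using calculation P[of G] uniq[of G] by auto
  ultimately show ?thesis by blast
qed

theorem theorem6p1:
  fixes k t :: nat
  assumes "k \<ge> 5" and "t \<ge> 1"
  shows "\<exists>n0. \<forall>n\<ge>n0.
    (\<forall>C :: nat set set. linear_cycle k (2 * t + 1) C \<longrightarrow>
       turan_number k n C = (n choose k) - ((n - t) choose k) \<and>
       (\<forall>G. extremal_family k n C G \<longleftrightarrow>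
          (\<exists>S. S \<subseteq> {1..n} \<and> card S = t \<and>
             G = {A. A \<subseteq> {1..n} \<and> card A = k \<and> A \<inter> S \<noteq> {}}))) \<and>
    (\<forall>C :: nat set set. linear_cycle k (2 * t + 2) C \<longrightarrow>
       turan_number k n C =
         (n choose k) - ((n - t) choose k) + ((n - t - 2) choose (k - 2)) \<and>
       (\<forall>G. extremal_family k n C G \<longleftrightarrow>
          (\<exists>S x y. S \<subseteq> {1..n} \<and> card S = t \<and>
             x \<in> {1..n} - S \<and> y \<in> {1..n} - S \<and> x \<noteq> y \<and>
             G = {A. A \<subseteq> {1..n} \<and> card A = k \<and> A \<inter> S \<noteq> {}} \<union>
                 {A. A \<subseteq> {1..n} - S \<and> card A = k \<and> x \<in> A \<and> y \<in> A})))"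
proof -
  obtain n1 where odd: "\<forall>(V :: nat set) H. finite V \<longrightarrow> n1 \<le> card V \<longrightarrow> kgraph_on k V H \<longrightarrow>
    \<not> (\<exists>C\<subseteq>H. linear_cycle k (2 * t + 1) C) \<longrightarrow>
    (card V choose k) - (card V - t choose k) \<le> card H \<longrightarrow>
    (\<exists>S\<subseteq>V. card S = t \<and> H = star V k S)"
    using odd_cycle_free_extremal[OF assms] by (elim exE)
  obtain n2 where even: "\<forall>(V :: nat set) H. finite V \<longrightarrow> n2 \<le> card V \<longrightarrow> kgraph_on k V H \<longrightarrow>
    \<not> (\<exists>C\<subseteq>H. linear_cycle k (2 * t + 2) C) \<longrightarrow>
    (card V choose k) - (card V - t choose k) + (card V - t - 2 choose (k - 2)) \<le> card H \<longrightarrow>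
    (\<exists>S x y. S \<subseteq> V \<and> card S = t \<and> x \<in> V - S \<and> y \<in> V - S \<and> x \<noteq> y \<and>
      H = star V k S \<union> {A. A \<subseteq> V - S \<and> card A = k \<and> x \<in> A \<and> y \<in> A})"
    using even_cycle_free_extremal[OF assms] by (elim exE)
  have kg: "kgraph_on k {1..n} E" if "\<And>A. A \<in> E \<Longrightarrow> A \<subseteq> {1..n} \<and> card A = k" for n :: nat and E
    unfolding kgraph_on_def
  proof
    fix e assume "e \<in> E"
    then have "e \<subseteq> {1..n}" "card e = k" using that by auto
    then show "e \<subseteq> {1..n} \<and> finite e \<and> card e = k" using finite_subset[of e "{1..n}"] by simp
  qed
  show ?thesis
  \<comment> \<open>The summand \<open>t + 2\<close> makes room in \<open>{1..n}\<close> for the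
    witnesses \<open>{1..t}\<close>, \<open>t + 1\<close> and \<open>t + 2\<close>.\<close>
  proof (intro exI[of _ "n1 + n2 + t + 2"] allI impI conjI)
    fix n :: nat and C :: "nat set set"
    assume n: "n1 + n2 + t + 2 \<le> n" and C: "linear_cycle k (2 * t + 1) C"
    let ?P = "\<lambda>G. \<exists>S. S \<subseteq> {1..n} \<and> card S = t \<and> G = star {1..n} k S"
    have "turan_number k n C = (n choose k) - (n - t choose k) \<and>
        (\<forall>G. extremal_family k n C G \<longleftrightarrow> ?P G)"
    proof (rule turan_number_eqI)
      fix E assume "?P E"
      then obtain S where S: "S \<subseteq> {1..n}" "card S = t" "E = star {1..n} k S" by blast
      have "finite S" using S(1) finite_subset by blast
      then have "\<not> contains_copy E C"
        unfolding contains_copy_linear_cycle_iff[OF C] S(3) using S(2) by (rule star_odd_cycle_free)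
      moreover have "kgraph_on k {1..n} E" unfolding S(3) by (rule kg) (auto simp: star_def)
      moreover have "card E = (n choose k) - (n - t choose k)"
        unfolding S(3) using card_star[OF _ S(1), of k] S(2) by simp
      ultimately show "kgraph_on k {1..n} E \<and> \<not> contains_copy E C \<and>
          card E = (n choose k) - (n - t choose k)" by blast
    next
      have "{1..t} \<subseteq> {1..n} \<and> card {1..t} = t" using n by auto
      then show "\<exists>E. ?P E" by blast
    next
      fix G assume G: "kgraph_on k {1..n} G" "\<not> contains_copy G C"
        "(n choose k) - (n - t choose k) \<le> card G"
      have "\<not> (\<exists>C\<subseteq>G. linear_cycle k (2 * t + 1) C)"
        using G(2) unfolding contains_copy_linear_cycle_iff[OF C] .
      then show "?P G" using odd[rule_format, of "{1..n}" G] G n by simp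
    qed
    then show "turan_number k n C = (n choose k) - (n - t choose k)"
      and "extremal_family k n C G \<longleftrightarrow> (\<exists>S. S \<subseteq> {1..n} \<and> card S = t \<and>
        G = {A. A \<subseteq> {1..n} \<and> card A = k \<and> A \<inter> S \<noteq> {}})" for G
      by (simp_all add: star_def)
  next
    fix n :: nat and C :: "nat set set"
    assume n: "n1 + n2 + t + 2 \<le> n" and C: "linear_cycle k (2 * t + 2) C"
    let ?P = "\<lambda>G. \<exists>S x y. S \<subseteq> {1..n} \<and> card S = t \<and>
      x \<in> {1..n} - S \<and> y \<in> {1..n} - S \<and> x \<noteq> y \<and>
      G = star {1..n} k S \<union> {A. A \<subseteq> {1..n} - S \<and> card A = k \<and> x \<in> A \<and> y \<in> A}"
    let ?N = "(n choose k) - (n - t choose k) + (n - t - 2 choose (k - 2))"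
    have "turan_number k n C = ?N \<and> (\<forall>G. extremal_family k n C G \<longleftrightarrow> ?P G)"
    proof (rule turan_number_eqI)
      fix E assume "?P E"
      then obtain S x y where S: "S \<subseteq> {1..n}" "card S = t" and xy: "x \<in> {1..n} - S" "y \<in> {1..n} - S" "x \<noteq> y"
        and E: "E = star {1..n} k S \<union> {A. A \<subseteq> {1..n} - S \<and> card A = k \<and> x \<in> A \<and> y \<in> A}"
        by (elim exE conjE)
      have fS: "finite S" using S(1) finite_subset by blast
      let ?B = "{A. A \<subseteq> {1..n} - S \<and> card A = k \<and> x \<in> A \<and> y \<in> A}"
      have "\<not> contains_copy E C"
        unfolding contains_copy_linear_cycle_iff[OF C]
        by (rule star_with_pair_even_cycle_free[OF fS S(2) xy(3) E])
      moreover have "kgraph_on k {1..n} E" unfolding E by (rule kg) (auto simp: star_def)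
      moreover have "card E = ?N"
      proof -
        have B: "?B = {A. {x, y} \<subseteq> A \<and> A \<subseteq> {1..n} - S \<and> card A = k}" by auto
        have "card ({1..n} - S) = n - t" using S fS by (simp add: card_Diff_subset)
        then have "card ?B = n - t - 2 choose (k - 2)"
          unfolding B using card_supersets[of "{1..n} - S" "{x, y}" k] xy assms
          by (simp add: numeral_2_eq_2)
        moreover have "finite ?B" by (rule rev_finite_subset[of "Pow {1..n}"]) auto
        moreover have "star {1..n} k S \<inter> ?B = {}" by (auto simp: star_def)
        ultimately show ?thesis
          unfolding E using card_star[OF _ S(1), of k] S(2) finite_star[of "{1..n}" k S]
          by (simp add: card_Un_disjoint)
      qed
      ultimately show "kgraph_on k {1..n} E \<and> \<not> contains_copy E C \<and> card E = ?N" by blast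
    next
      have "{1..t} \<subseteq> {1..n} \<and> card {1..t} = t \<and> t + 1 \<in> {1..n} - {1..t} \<and>
        t + 2 \<in> {1..n} - {1..t} \<and> t + 1 \<noteq> t + 2" using n by auto
      then show "\<exists>E. ?P E" by blast
    next
      fix G assume G: "kgraph_on k {1..n} G" "\<not> contains_copy G C" "?N \<le> card G"
      have "\<not> (\<exists>C\<subseteq>G. linear_cycle k (2 * t + 2) C)"
        using G(2) unfolding contains_copy_linear_cycle_iff[OF C] .
      then show "?P G" using even[rule_format, of "{1..n}" G] G n by simp
    qed
    then show "turan_number k n C = ?N"
      and "extremal_family k n C G \<longleftrightarrow> (\<exists>S x y. S \<subseteq> {1..n} \<and> card S = t \<and>
             x \<in> {1..n} - S \<and> y \<in> {1..n} - S \<and> x \<noteq> y \<and>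
             G = {A. A \<subseteq> {1..n} \<and> card A = k \<and> A \<inter> S \<noteq> {}} \<union>
                 {A. A \<subseteq> {1..n} - S \<and> card A = k \<and> x \<in> A \<and> y \<in> A})" for G
      by (simp_all add: star_def)
  qed
qed

end
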